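(* (i) Let $E\in\mathfrak E_n(\mathbb D)$. Then there exists a sequence $(F_k)_{k\in\mathbb N}$ from $H_n^\infty(\mathbb D)$ with the following properties: $(\alpha)$ For $m$-almost all $t\in\mathbb T$, $\lim_{k\to\infty}\underline{F_k}(t)\cdot\underline E(t)=I_n$. $(\beta)$ The family $(\ln^+\|\underline{F_k}\|)_{k\in\mathbb N}$ is uniformly integrable with respect to $m$. $(\gamma)$ There exists a Borel subset $B_0$ of $\mathbb T$ with $m(B_0)=0$ such that for all $k\in\mathbb N$ and all $t\in\mathbb T\setminus B_0$ the inequality $\|\underline{F_k}(t)\cdot\underline E(t)\|\le1$ holds. (ii) Let $E\in\mathfrak N_n^+(\mathbb D)$ be such that there exists a sequence $(F_k)_{k\in\mathbb N}$ in $H_n^\infty(\mathbb D)$ satisfying conditions $(\alpha)$ and $(\beta)$. Then $E\in\mathfrak E_n(\mathbb D)$.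
   Context: $\mathbb D$ is the open unit disc, $\mathbb T$ the unit circle, $m$ normalized Lebesgue measure on $\mathbb T$, $\mathfrak M_n$ the complex $n\times n$ matrices with the operator norm induced by the Euclidean norm. Uniform integrability: a family $(f_\alpha)$ in $L^1(m)$ is uniformly integrable if $\sup_\alpha\int|f_\alpha|\,dm<\infty$ and for every $\epsilon>0$ there is $\delta>0$ such that $\int_\Delta|f_\alpha|\,dm<\epsilon$ for all $\alpha$ and all Borel $\Delta\subseteq\mathbb T$ with $m(\Delta)<\delta$. Smirnov class: $\mathfrak N_n^+(\mathbb D)$ is the set of holomorphic $F:\mathbb D\to\mathfrak M_n$ for which the family $t\mapsto\ln^+\|F(rt)\|$, $r\in[0,1)$, is uniformly integrable with respect to $m$. Such $F$ has radial boundary values $\underline F(t)=\lim_{r\to1-0}F(rt)$ for $m$-a.e. $t$. $H_n^\infty(\mathbb D)$ is the set of bounded holomorphic functions $\mathbb D\to\mathfrak M_n$. Outer: a scalar function $e:\mathbb D\to\mathbb C$ is outer if $e(z)=C\exp\{\int_{\mathbb T}\frac{t+z}{t-z}\ln[w(t)]\,m(dt)\}$ with $|C|=1$ and $w:\mathbb T\to[0,\infty)$ such that $\ln w$ is $m$-integrable. $\mathfrak E_n(\mathbb D)$ is the set of $E\in\mathfrak N_n^+(\mathbb D)$ with $\det E$ outer. *)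

theory Defs
  imports "HOL-Probability.Probability" "HOL-Complex_Analysis.Complex_Analysis"
begin

abbreviation unit_disc :: "complex set" where
  "unit_disc \<equiv> ball 0 1"

abbreviation unit_circle :: "complex set" where
  "unit_circle \<equiv> sphere 0 1"

definition circle_measure :: "complex measure" where
  "circle_measure =
     distr (uniform_measure lborel {0..<2 * pi}) (restrict_space borel unit_circle) cis"

lemma space_circle_measure [simp]: "space circle_measure = unit_circle"
  by (simp add: circle_measure_def space_restrict_space)

lemma sets_circle_measure [measurable_cong]:
  "sets circle_measure = sets (restrict_space borel unit_circle)"
  by (simp add: circle_measure_def)

lemma prob_space_circle_measure: "prob_space circle_measure"
proof -
  have "cis \<in> borel_measurable borel"
    by (intro borel_measurable_continuous_onI continuous_intros)
  then have meas: "cis \<in> uniform_measure lborel {0..<2 * pi} \<rightarrow>\<^sub>M restrict_space borel unit_circle"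
    by (intro measurable_restrict_space2) auto
  have "prob_space (uniform_measure lborel {0..<2 * pi})"
    by (rule prob_space_uniform_measure) auto
  then show ?thesis
    unfolding circle_measure_def using meas by (rule prob_space.prob_space_distr)
qed

definition uniformly_integrable ::
    "'a measure \<Rightarrow> 'i set \<Rightarrow> ('i \<Rightarrow> 'a \<Rightarrow> real) \<Rightarrow> bool" where
  "uniformly_integrable M A f \<longleftrightarrow>
     (\<forall>a\<in>A. integrable M (f a)) \<and>
     (\<exists>C. \<forall>a\<in>A. (LINT t|M. \<bar>f a t\<bar>) \<le> C) \<and>
     (\<forall>\<epsilon>>0. \<exists>\<delta>>0. \<forall>a\<in>A. \<forall>\<Delta>\<in>sets M. measure M \<Delta> < \<delta> \<longrightarrow> (LINT t:\<Delta>|M. \<bar>f a t\<bar>) < \<epsilon>)"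

text \<open>Positive part of the logarithm; the form below does not depend on the value of
  \<open>ln 0\<close>.\<close>

definition ln_plus :: "real \<Rightarrow> real" where
  "ln_plus x = ln (max 1 x)"

text \<open>The norm of \<open>complex ^ 'n ^ 'n\<close> as a type is the Hilbert--Schmidt norm, so the operator
  norm induced by the Euclidean norm has to be named separately.\<close>

definition op_norm :: "complex ^ 'n ^ 'n \<Rightarrow> real" where
  "op_norm A = onorm (\<lambda>v. A *v v)"

definition mat_holomorphic_on :: "(complex \<Rightarrow> complex ^ 'n ^ 'n) \<Rightarrow> complex set \<Rightarrow> bool" where
  "mat_holomorphic_on F S \<longleftrightarrow> (\<forall>i j. (\<lambda>z. F z $ i $ j) holomorphic_on S)"

definition smirnov_class :: "(complex \<Rightarrow> complex ^ 'n ^ 'n) set" where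
  "smirnov_class =
     {F. mat_holomorphic_on F unit_disc \<and>
         uniformly_integrable circle_measure {0..<1}
           (\<lambda>r t. ln_plus (op_norm (F (of_real r * t))))}"

definition bounded_holomorphic :: "(complex \<Rightarrow> complex ^ 'n ^ 'n) set" where
  "bounded_holomorphic =
     {F. mat_holomorphic_on F unit_disc \<and> (\<exists>C. \<forall>z\<in>unit_disc. op_norm (F z) \<le> C)}"

text \<open>Where the radial limit does not exist, the value is one fixed unspecified matrix; for
  functions in the Smirnov class this concerns only a null set of points of the circle.\<close>

definition boundary_value :: "(complex \<Rightarrow> complex ^ 'n ^ 'n) \<Rightarrow> complex \<Rightarrow> complex ^ 'n ^ 'n" where
  "boundary_value F t = Lim (at_left 1) (\<lambda>r. F (of_real r * t))"

text \<open>Integrability of \<open>ln w\<close> is meant with \<open>ln 0 = -\<infinity>\<close>, so it forces \<open>w > 0\<close> almost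
  everywhere; as the library's \<open>ln 0\<close> is a real number, this is a separate condition.\<close>

definition outer :: "(complex \<Rightarrow> complex) \<Rightarrow> bool" where
  "outer e \<longleftrightarrow>
     (\<exists>C w. cmod C = 1 \<and>
        (\<forall>t\<in>unit_circle. (0::real) \<le> w t) \<and>
        (AE t in circle_measure. 0 < w t) \<and>
        integrable circle_measure (\<lambda>t. ln (w t)) \<and>
        (\<forall>z\<in>unit_disc.
           e z = C * exp (LINT t|circle_measure. (t + z) / (t - z) * of_real (ln (w t)))))"

definition outer_class :: "(complex \<Rightarrow> complex ^ 'n ^ 'n) set" where
  "outer_class = {E \<in> smirnov_class. outer (\<lambda>z. det (E z))}"

end

theory Submission
  imports Defs "HOL-Real_Asymp.Real_Asymp"
begin

text \<open>
  (i) Take \<open>F\<^sub>k = \<phi>\<^sub>k E\<^sup>-\<^sup>1\<close>, where \<open>\<phi>\<^sub>k\<close> is the outer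
  function whose modulus on the circle is so small where \<open>\<parallel>E\<^sup>-\<^sup>1\<parallel>\<close> exceeds \<open>k\<close> that the product is bounded. By
  Cramer's rule \<open>E\<^sup>-\<^sup>1\<close> is a quotient of the adjugate, which lies in the Smirnov class, by the outer
  function \<open>det E\<close>; so the bound propagates into the disc. Since \<open>\<phi>\<^sub>k(0)\<close> tends to \<open>1\<close>, a subsequence
  of \<open>\<phi>\<^sub>k\<close> tends to \<open>1\<close> almost everywhere on the circle.

  (ii) Taking determinants reduces the claim to the scalar case: if \<open>g\<^sub>k\<close> are bounded and
  \<open>g\<^sub>k d\<close> tends to \<open>1\<close> on the circle with \<open>ln\<^sup>+ \<bar>g\<^sub>k\<bar>\<close> uniformly integrable, then
  \<open>g\<^sub>k d\<close> tends to \<open>1\<close> in the disc along a subsequence, and the inequalities \<open>ln \<bar>f\<bar> \<le> P[ln \<bar>f\<bar>]\<close>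
  for \<open>f = d\<close> and \<open>f = g\<^sub>k\<close> can only be compatible if the one for \<open>d\<close> is an equality.
\<close>

section \<open>Uniform integrability\<close>

text \<open>The obstacle is the passage between the disc and the circle. Mass of ln|f| may
  concentrate on null sets of the circle as the radius tends to 1, and then the boundary values of f
  no longer control f inside. Uniform integrability of \<open>ln_plus\<close> excludes this:
  Vitali's theorem carries the Poisson inequality from interior circles to the boundary. For
  exponentials of Herglotz integrals the inequality is an equality, so it survives division by an
  outer function, which is what the quotient in (i) needs. Conversely, equality for d forces d to be
  outer, because the quotient of d by the outer function with the same boundary modulus has modulus
  1 and is therefore constant; this is the end of (ii). Radial limits have to exist before any of
  this can be said. For bounded functions they come from square summability of the coefficients
  together with a weak type inequality for the radial maximal function. In the Smirnov class they
  come from writing f as a quotient of bounded functions. The boundary behaviour of Herglotz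
  integrals is then deduced from the Poisson inequality itself.\<close>

lemma uniformly_integrable_bound:
  fixes f :: "'i \<Rightarrow> 'a \<Rightarrow> real" and g :: "'j \<Rightarrow> 'a \<Rightarrow> real"
  assumes "finite_measure M" and ui: "uniformly_integrable M A f"
    and h: "\<And>b. b \<in> B \<Longrightarrow> h b \<in> A"
    and meas: "\<And>b. b \<in> B \<Longrightarrow> g b \<in> borel_measurable M"
    and bd: "\<And>b. b \<in> B \<Longrightarrow> AE t in M. \<bar>g b t\<bar> \<le> c + k * \<bar>f (h b) t\<bar>"
    and "0 \<le> c" "0 \<le> k"
  shows "uniformly_integrable M B g"
proof -
  interpret finite_measure M by fact
  have int_f: "integrable M (\<lambda>t. \<bar>f (h b) t\<bar>)" if "b \<in> B" for b
    using ui h[OF that] by (auto simp: uniformly_integrable_def)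
  have int_b: "integrable M (\<lambda>t. c + k * \<bar>f (h b) t\<bar>)" if "b \<in> B" for b
    using int_f[OF that] by auto
  have int_g: "integrable M (g b)" if "b \<in> B" for b
    by (rule Bochner_Integration.integrable_bound[OF int_b[OF that] meas[OF that]])
       (use bd[OF that] in \<open>eventually_elim, auto\<close>)
  obtain C where C: "\<And>a. a \<in> A \<Longrightarrow> (LINT t|M. \<bar>f a t\<bar>) \<le> C"
    using ui unfolding uniformly_integrable_def by blast
  have "(LINT t|M. \<bar>g b t\<bar>) \<le> c * measure M (space M) + k * C" if "b \<in> B" for b
  proof -
    have "(LINT t|M. \<bar>g b t\<bar>) \<le> (LINT t|M. c + k * \<bar>f (h b) t\<bar>)"
      by (rule integral_mono_AE) (use int_g int_b bd that in auto)
    also have "\<dots> = c * measure M (space M) + k * (LINT t|M. \<bar>f (h b) t\<bar>)"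
      using int_f[OF that] by simp
    also have "\<dots> \<le> c * measure M (space M) + k * C"
      using C[OF h[OF that]] \<open>0 \<le> k\<close> by (simp add: mult_left_mono)
    finally show ?thesis .
  qed
  moreover have "\<exists>\<delta>>0. \<forall>b\<in>B. \<forall>\<Delta>\<in>sets M. measure M \<Delta> < \<delta> \<longrightarrow> (LINT t:\<Delta>|M. \<bar>g b t\<bar>) < \<epsilon>"
    if "\<epsilon> > 0" for \<epsilon>
  proof -
    \<comment> \<open>The constant c and the multiple of f each receive half of
      \<open>\<epsilon>\<close>; k + 1 and c + 1 stand for k and c because these may be 0.\<close>
    have "\<epsilon> / (2 * (k + 1)) > 0"
      using \<open>\<epsilon> > 0\<close> \<open>0 \<le> k\<close> by simp
    then obtain d where "d > 0" and d: "\<And>a \<Delta>. a \<in> A \<Longrightarrow> \<Delta> \<in> sets M \<Longrightarrow> measure M \<Delta> < d \<Longrightarrow>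
        (LINT t:\<Delta>|M. \<bar>f a t\<bar>) < \<epsilon> / (2 * (k + 1))"
      using ui unfolding uniformly_integrable_def by meson
    define e where "e = min d (\<epsilon> / (2 * (c + 1)))"
    have "e > 0" using \<open>d > 0\<close> \<open>\<epsilon> > 0\<close> \<open>0 \<le> c\<close> by (simp add: e_def)
    moreover have "(LINT t:\<Delta>|M. \<bar>g b t\<bar>) < \<epsilon>"
      if "b \<in> B" and \<Delta>: "\<Delta> \<in> sets M" "measure M \<Delta> < e" for b \<Delta>
    proof -
      have "(LINT t:\<Delta>|M. \<bar>g b t\<bar>) \<le> (LINT t|M. c * indicator \<Delta> t + k * (indicator \<Delta> t * \<bar>f (h b) t\<bar>))"
        unfolding set_lebesgue_integral_def
      proof (rule integral_mono_AE)
        show "integrable M (\<lambda>t. indicator \<Delta> t *\<^sub>R \<bar>g b t\<bar>)"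
          using int_g[OF \<open>b \<in> B\<close>] \<Delta> integrable_mult_indicator by blast
        show "integrable M (\<lambda>t. c * indicator \<Delta> t + k * (indicator \<Delta> t * \<bar>f (h b) t\<bar>))"
          using integrable_mult_indicator[OF \<Delta>(1) int_f[OF \<open>b \<in> B\<close>]] \<Delta>(1)
          by (auto simp: emeasure_eq_measure intro!: integrable_real_indicator)
        show "AE t in M. indicator \<Delta> t *\<^sub>R \<bar>g b t\<bar>
            \<le> c * indicator \<Delta> t + k * (indicator \<Delta> t * \<bar>f (h b) t\<bar>)"
          using bd[OF \<open>b \<in> B\<close>] by eventually_elim (auto simp: indicator_def)
      qed
      also have "\<dots> = c * measure M \<Delta> + k * (LINT t:\<Delta>|M. \<bar>f (h b) t\<bar>)"
        using integrable_mult_indicator[OF \<Delta>(1) int_f[OF \<open>b \<in> B\<close>]] \<Delta>(1)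
        by (subst Bochner_Integration.integral_add)
           (auto simp: set_lebesgue_integral_def emeasure_eq_measure intro!: integrable_real_indicator)
      also have "\<dots> \<le> (c + 1) * measure M \<Delta> + (k + 1) * (LINT t:\<Delta>|M. \<bar>f (h b) t\<bar>)"
        by (intro add_mono mult_right_mono) (auto simp: set_lebesgue_integral_def)
      also have "\<dots> < (c + 1) * (\<epsilon> / (2 * (c + 1))) + (k + 1) * (\<epsilon> / (2 * (k + 1)))"
        using d[OF h[OF \<open>b \<in> B\<close>] \<Delta>(1)] \<Delta>(2) \<open>0 \<le> c\<close> \<open>0 \<le> k\<close> unfolding e_def
        by (intro add_strict_mono mult_strict_left_mono) auto
      also have "\<dots> = \<epsilon>"
      proof -
        have "c + 1 \<noteq> 0" "k + 1 \<noteq> 0" using \<open>0 \<le> c\<close> \<open>0 \<le> k\<close> by auto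
        then have "(c + 1) * (\<epsilon> / (2 * (c + 1))) = \<epsilon> / 2" "(k + 1) * (\<epsilon> / (2 * (k + 1))) = \<epsilon> / 2"
          by (simp_all add: divide_simps)
        then show ?thesis by (simp only:)
      qed
      finally show ?thesis .
    qed
    ultimately show ?thesis by blast
  qed
  ultimately show ?thesis
    unfolding uniformly_integrable_def using int_g by blast
qed

text \<open>Absolute continuity of the integral: truncation at a large N leaves a tail of small
  integral, and the truncated part contributes at most N times the measure of the set.\<close>

lemma uniformly_integrable_const:
  assumes "finite_measure M" and f: "integrable M f"
  shows "uniformly_integrable M A (\<lambda>_. f)"
proof -
  interpret finite_measure M by fact
  have [measurable]: "f \<in> borel_measurable M" using f by auto
  have "\<exists>\<delta>>0. \<forall>\<Delta>\<in>sets M. measure M \<Delta> < \<delta> \<longrightarrow> (LINT t:\<Delta>|M. \<bar>f t\<bar>) < \<epsilon>" if "\<epsilon> > 0" for \<epsilon>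
  proof -
    have "(\<lambda>n::nat. LINT t|M. (if \<bar>f t\<bar> > n then \<bar>f t\<bar> else 0)) \<longlonglongrightarrow> (LINT t|M. 0)"
    proof (rule integral_dominated_convergence[where w = "\<lambda>t. \<bar>f t\<bar>"])
      show "AE t in M. (\<lambda>n::nat. if \<bar>f t\<bar> > n then \<bar>f t\<bar> else 0) \<longlonglongrightarrow> 0"
      proof (intro always_eventually allI)
        fix t
        obtain n0 :: nat where "\<bar>f t\<bar> < n0" using reals_Archimedean2 by blast
        then have "\<forall>\<^sub>F n::nat in sequentially. (if \<bar>f t\<bar> > n then \<bar>f t\<bar> else 0) = 0"
          unfolding eventually_sequentially by (intro exI[of _ n0]) auto
        then show "(\<lambda>n::nat. if \<bar>f t\<bar> > n then \<bar>f t\<bar> else 0) \<longlonglongrightarrow> 0"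
          by (rule tendsto_eventually)
      qed
    qed (use f in auto)
    then have "\<forall>\<^sub>F n::nat in sequentially. (LINT t|M. (if \<bar>f t\<bar> > n then \<bar>f t\<bar> else 0)) < \<epsilon> / 2"
      using \<open>\<epsilon> > 0\<close> by (intro order_tendstoD) auto
    then obtain N :: nat where N: "(LINT t|M. (if \<bar>f t\<bar> > N then \<bar>f t\<bar> else 0)) < \<epsilon> / 2"
      using eventually_happens'[OF sequentially_bot] by blast
    have "(LINT t:\<Delta>|M. \<bar>f t\<bar>) < \<epsilon>" if \<Delta>: "\<Delta> \<in> sets M" "measure M \<Delta> < \<epsilon> / (2 * (N + 1))" for \<Delta>
    proof -
      have i1: "integrable M (\<lambda>t. if \<bar>f t\<bar> > N then \<bar>f t\<bar> else 0)"
        by (rule Bochner_Integration.integrable_bound[OF f]) auto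
      have i2: "integrable M (indicator \<Delta> :: _ \<Rightarrow> real)"
        using \<Delta> by (auto simp: emeasure_eq_measure intro!: integrable_real_indicator)
      have "(LINT t:\<Delta>|M. \<bar>f t\<bar>) \<le> (LINT t|M. (if \<bar>f t\<bar> > N then \<bar>f t\<bar> else 0) + real N * indicator \<Delta> t)"
        unfolding set_lebesgue_integral_def
      proof (rule integral_mono)
        show "integrable M (\<lambda>t. indicator \<Delta> t *\<^sub>R \<bar>f t\<bar>)"
          by (intro integrable_mult_indicator integrable_abs f \<Delta>(1))
        show "integrable M (\<lambda>t. (if \<bar>f t\<bar> > N then \<bar>f t\<bar> else 0) + real N * indicator \<Delta> t)"
          by (intro Bochner_Integration.integrable_add i1 integrable_mult_right i2)
      qed (auto simp: indicator_def)
      also have "\<dots> = (LINT t|M. (if \<bar>f t\<bar> > N then \<bar>f t\<bar> else 0)) + N * measure M \<Delta>"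
        using i1 i2 \<Delta> by (subst Bochner_Integration.integral_add) auto
      also have "\<dots> < \<epsilon> / 2 + \<epsilon> / 2"
      proof (rule add_less_le_mono[OF N])
        have "N * measure M \<Delta> \<le> (N + 1) * (\<epsilon> / (2 * (N + 1)))"
          using \<Delta> by (intro mult_mono) auto
        also have "\<dots> = \<epsilon> / 2" by (simp add: field_simps)
        finally show "N * measure M \<Delta> \<le> \<epsilon> / 2" .
      qed
      finally show ?thesis by simp
    qed
    then show ?thesis using \<open>\<epsilon> > 0\<close>
      by (intro exI[of _ "\<epsilon> / (2 * (N + 1))"]) auto
  qed
  then show ?thesis
    unfolding uniformly_integrable_def using f by auto
qed

lemma uniformly_integrable_add:
  assumes "finite_measure M" and f: "uniformly_integrable M A f" and g: "uniformly_integrable M A g"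
  shows "uniformly_integrable M A (\<lambda>a t. \<bar>f a t\<bar> + \<bar>g a t\<bar>)"
proof -
  interpret finite_measure M by fact
  have int: "integrable M (f a)" "integrable M (g a)" if "a \<in> A" for a
    using f g that by (auto simp: uniformly_integrable_def)
  obtain C1 C2 where C: "\<And>a. a \<in> A \<Longrightarrow> (LINT t|M. \<bar>f a t\<bar>) \<le> C1"
     "\<And>a. a \<in> A \<Longrightarrow> (LINT t|M. \<bar>g a t\<bar>) \<le> C2"
    using f g unfolding uniformly_integrable_def by blast
  have "(LINT t|M. \<bar>\<bar>f a t\<bar> + \<bar>g a t\<bar>\<bar>) \<le> C1 + C2" if "a \<in> A" for a
    using C[OF that] int[OF that] by simp
  moreover have "\<exists>\<delta>>0. \<forall>a\<in>A. \<forall>\<Delta>\<in>sets M. measure M \<Delta> < \<delta> \<longrightarrow> (LINT t:\<Delta>|M. \<bar>\<bar>f a t\<bar> + \<bar>g a t\<bar>\<bar>) < \<epsilon>"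
    if "\<epsilon> > 0" for \<epsilon>
  proof -
    obtain d1 where "d1 > 0" and d1: "\<And>a \<Delta>. a \<in> A \<Longrightarrow> \<Delta> \<in> sets M \<Longrightarrow> measure M \<Delta> < d1 \<Longrightarrow>
        (LINT t:\<Delta>|M. \<bar>f a t\<bar>) < \<epsilon> / 2"
      using f \<open>\<epsilon> > 0\<close> unfolding uniformly_integrable_def by (meson half_gt_zero)
    obtain d2 where "d2 > 0" and d2: "\<And>a \<Delta>. a \<in> A \<Longrightarrow> \<Delta> \<in> sets M \<Longrightarrow> measure M \<Delta> < d2 \<Longrightarrow>
        (LINT t:\<Delta>|M. \<bar>g a t\<bar>) < \<epsilon> / 2"
      using g \<open>\<epsilon> > 0\<close> unfolding uniformly_integrable_def by (meson half_gt_zero)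
    have "(LINT t:\<Delta>|M. \<bar>\<bar>f a t\<bar> + \<bar>g a t\<bar>\<bar>) < \<epsilon>"
      if "a \<in> A" "\<Delta> \<in> sets M" "measure M \<Delta> < min d1 d2" for a \<Delta>
    proof -
      have "set_integrable M \<Delta> (\<lambda>t. \<bar>f a t\<bar>)" "set_integrable M \<Delta> (\<lambda>t. \<bar>g a t\<bar>)"
        unfolding set_integrable_def
        by (intro integrable_mult_indicator integrable_abs int[OF that(1)] that(2))+
      then show ?thesis
        using d1[OF that(1,2)] d2[OF that(1,2)] that(3) by (simp add: set_integral_add)
    qed
    then show ?thesis using \<open>d1 > 0\<close> \<open>d2 > 0\<close>
      by (intro exI[of _ "min d1 d2"]) auto
  qed
  moreover have "\<And>a. a \<in> A \<Longrightarrow> integrable M (\<lambda>t. \<bar>f a t\<bar> + \<bar>g a t\<bar>)"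
    by (intro Bochner_Integration.integrable_add integrable_abs int)
  ultimately show ?thesis
    unfolding uniformly_integrable_def by blast
qed

text \<open>Fatou's lemma makes the limit integrable, so the differences are again uniformly
  integrable. The set where a difference exceeds a fixed level has measure tending to 0, by almost
  everywhere convergence; off this set the level itself bounds the integrand.\<close>

lemma uniformly_integrable_Vitali:
  fixes f :: "nat \<Rightarrow> 'a \<Rightarrow> real"
  assumes "finite_measure M" and f: "uniformly_integrable M UNIV f"
    and [measurable]: "g \<in> borel_measurable M"
    and lim: "AE t in M. (\<lambda>n. f n t) \<longlonglongrightarrow> g t"
  shows "integrable M g" and "(\<lambda>n. LINT t|M. \<bar>f n t - g t\<bar>) \<longlonglongrightarrow> 0"
proof -
  interpret finite_measure M by fact
  have int_f: "integrable M (f n)" for n using f by (auto simp: uniformly_integrable_def)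
  then have [measurable]: "f n \<in> borel_measurable M" for n by auto
  obtain C where C: "\<And>n. (LINT t|M. \<bar>f n t\<bar>) \<le> C"
    using f by (auto simp: uniformly_integrable_def)
  have "(\<integral>\<^sup>+ t. ennreal (norm (g t)) \<partial>M) \<le> (\<integral>\<^sup>+ t. liminf (\<lambda>n. ennreal \<bar>f n t\<bar>) \<partial>M)"
  proof (rule nn_integral_mono_AE, use lim in eventually_elim)
    fix t assume "(\<lambda>n. f n t) \<longlonglongrightarrow> g t"
    then have "(\<lambda>n. ennreal \<bar>f n t\<bar>) \<longlonglongrightarrow> ennreal \<bar>g t\<bar>"
      by (intro tendsto_intros)
    then show "ennreal (norm (g t)) \<le> liminf (\<lambda>n. ennreal \<bar>f n t\<bar>)"
      using lim_imp_Liminf[OF sequentially_bot, of "\<lambda>n. ennreal \<bar>f n t\<bar>" "ennreal \<bar>g t\<bar>"] by simp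
  qed
  also have "\<dots> \<le> liminf (\<lambda>n. \<integral>\<^sup>+ t. ennreal \<bar>f n t\<bar> \<partial>M)"
    by (rule nn_integral_liminf) auto
  also have "\<dots> \<le> liminf (\<lambda>n::nat. ennreal C)"
    by (intro Liminf_mono always_eventually allI)
       (use C int_f in \<open>auto simp: nn_integral_eq_integral intro: ennreal_leI\<close>)
  also have "\<dots> < \<infinity>" by (simp add: Liminf_const)
  finally show int_g: "integrable M g"
    by (intro integrableI_bounded) auto
  define h where "h n t = \<bar>f n t - g t\<bar>" for n t
  have [measurable]: "h n \<in> borel_measurable M" for n by (simp add: h_def[abs_def])
  have ui: "uniformly_integrable M UNIV h"
    by (rule uniformly_integrable_bound[where h = id and c = 0 and k = 1,
          OF \<open>finite_measure M\<close> uniformly_integrable_add[OF \<open>finite_measure M\<close> f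
            uniformly_integrable_const[OF \<open>finite_measure M\<close> int_g]]])
       (auto simp: h_def)
  then have int_h: "integrable M (h n)" for n by (auto simp: uniformly_integrable_def)
  have "(\<lambda>n. LINT t|M. h n t) \<longlonglongrightarrow> 0"
  proof (rule LIMSEQ_I)
    fix \<epsilon> :: real assume "\<epsilon> > 0"
    then obtain d where "d > 0" and d: "\<And>n \<Delta>. \<Delta> \<in> sets M \<Longrightarrow> measure M \<Delta> < d \<Longrightarrow>
        (LINT t:\<Delta>|M. \<bar>h n t\<bar>) < \<epsilon> / 2"
      using ui unfolding uniformly_integrable_def by (meson half_gt_zero UNIV_I)
    \<comment> \<open>The level below which the differences contribute at most half of
      \<open>\<epsilon>\<close>; the added 1 allows for total mass 0.\<close>
    define e where "e = \<epsilon> / (2 * (measure M (space M) + 1))"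
    have "e > 0" using \<open>\<epsilon> > 0\<close> by (simp add: e_def add_nonneg_pos)
    define \<Delta> where "\<Delta> n = {t \<in> space M. h n t > e}" for n
    have [measurable]: "\<Delta> n \<in> sets M" for n by (simp add: \<Delta>_def)
    have "(\<lambda>n. LINT t|M. indicator (\<Delta> n) t :: real) \<longlonglongrightarrow> (LINT t|M. 0)"
    proof (rule integral_dominated_convergence[where w = "\<lambda>t. 1"])
      show "AE t in M. (\<lambda>n. indicator (\<Delta> n) t :: real) \<longlonglongrightarrow> 0"
        using lim
      proof eventually_elim
        fix t assume "(\<lambda>n. f n t) \<longlonglongrightarrow> g t"
        then have "(\<lambda>n. h n t) \<longlonglongrightarrow> 0"
          unfolding h_def by (intro tendsto_rabs_zero) (simp add: LIM_zero)
        then have "\<forall>\<^sub>F n in sequentially. h n t < e"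
          using \<open>e > 0\<close> by (rule order_tendstoD)
        then have "\<forall>\<^sub>F n in sequentially. (indicator (\<Delta> n) t :: real) = 0"
          by eventually_elim (auto simp: \<Delta>_def)
        then show "(\<lambda>n. indicator (\<Delta> n) t :: real) \<longlonglongrightarrow> 0" by (rule tendsto_eventually)
      qed
    qed (auto simp: indicator_def)
    then have "(\<lambda>n. measure M (\<Delta> n)) \<longlonglongrightarrow> 0" by simp
    then have "\<forall>\<^sub>F n in sequentially. measure M (\<Delta> n) < d"
      using \<open>d > 0\<close> by (rule order_tendstoD)
    then obtain N where N: "\<And>n. n \<ge> N \<Longrightarrow> measure M (\<Delta> n) < d"
      by (auto simp: eventually_sequentially)
    have "norm ((LINT t|M. h n t) - 0) < \<epsilon>" if "n \<ge> N" for n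
    proof -
      have i1: "integrable M (\<lambda>t. indicator (\<Delta> n) t * \<bar>h n t\<bar>)"
        using int_h[of n] integrable_mult_indicator[of "\<Delta> n" M "\<lambda>t. \<bar>h n t\<bar>"] by auto
      have "(LINT t|M. h n t) \<le> (LINT t|M. e + indicator (\<Delta> n) t * \<bar>h n t\<bar>)"
      proof (rule integral_mono)
        show "integrable M (\<lambda>t. e + indicator (\<Delta> n) t * \<bar>h n t\<bar>)"
          by (intro Bochner_Integration.integrable_add i1 finite_measure.integrable_const) unfold_locales
        show "h n t \<le> e + indicator (\<Delta> n) t * \<bar>h n t\<bar>" if "t \<in> space M" for t
          using that \<open>e > 0\<close> by (auto simp: \<Delta>_def indicator_def)
      qed (rule int_h)
      also have "\<dots> = e * measure M (space M) + (LINT t:\<Delta> n|M. \<bar>h n t\<bar>)"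
        using i1 by (simp add: set_lebesgue_integral_def)
      also have "\<dots> < \<epsilon> / 2 + \<epsilon> / 2"
      proof (rule add_le_less_mono)
        have "e * measure M (space M) \<le> e * (measure M (space M) + 1)"
          using \<open>e > 0\<close> by simp
        also have "\<dots> = \<epsilon> / 2"
        proof -
          have "measure M (space M) + 1 \<noteq> 0" using measure_nonneg[of M "space M"] by linarith
          then show ?thesis unfolding e_def by (simp add: field_simps)
        qed
        finally show "e * measure M (space M) \<le> \<epsilon> / 2" .
      qed (use d[of "\<Delta> n" n] N[OF that] in auto)
      finally have "(LINT t|M. h n t) < \<epsilon>" by simp
      moreover have "(LINT t|M. h n t) \<ge> 0" by (simp add: h_def)
      ultimately show ?thesis by simp
    qed
    then show "\<exists>N. \<forall>n\<ge>N. norm ((LINT t|M. h n t) - 0) < \<epsilon>" by blast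
  qed
  then show "(\<lambda>n. LINT t|M. \<bar>f n t - g t\<bar>) \<longlonglongrightarrow> 0" by (simp add: h_def)
qed

section \<open>Integration on the circle, Poisson and Herglotz integrals\<close>

interpretation circle: prob_space circle_measure
  by (rule prob_space_circle_measure)

lemma measurable_circle_ident [measurable]: "(\<lambda>t. t) \<in> borel_measurable circle_measure"
  by (simp add: measurable_cong_sets[OF sets_circle_measure refl] measurable_restrict_space1)

lemma borel_measurable_cnj [measurable]: "cnj \<in> borel_measurable borel"
  by (intro borel_measurable_continuous_onI continuous_intros)

lemma measurable_circle_continuous:
  "continuous_on unit_circle f \<Longrightarrow> f \<in> borel_measurable circle_measure"
  by (simp add: measurable_cong_sets[OF sets_circle_measure refl] borel_measurable_continuous_on_restrict)

lemma integrable_circle_continuous: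
  fixes f :: "complex \<Rightarrow> 'b :: {banach, second_countable_topology}"
  assumes "continuous_on unit_circle f"
  shows "integrable circle_measure f"
proof -
  have "compact (f ` unit_circle)"
    by (intro compact_continuous_image assms compact_sphere)
  then obtain B where "\<And>t. t \<in> unit_circle \<Longrightarrow> norm (f t) \<le> B"
    using compact_imp_bounded[of "f ` unit_circle"] unfolding bounded_iff by blast
  then show ?thesis
    by (intro circle.integrable_const_bound[of _ B] measurable_circle_continuous assms AE_I2) auto
qed

text \<open>Bridge to the integral over a real interval, the form in which contour integrals along
  the circle are parametrised.\<close>

lemma circle_integral:
  fixes f :: "complex \<Rightarrow> complex"
  assumes f: "continuous_on unit_circle f"
  shows "(LINT t|circle_measure. f t) = integral {0..2 * pi} (\<lambda>x. f (cis x)) / (2 * pi)"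
proof -
  have cis: "cis \<in> uniform_measure lborel {0..<2 * pi} \<rightarrow>\<^sub>M restrict_space borel unit_circle"
  proof (intro measurable_restrict_space2)
    have "cis \<in> borel_measurable borel"
      by (intro borel_measurable_continuous_onI continuous_intros)
    then show "cis \<in> borel_measurable (uniform_measure lborel {0..<2 * pi})"
      by simp
  qed auto
  have cont: "continuous_on UNIV (\<lambda>x. f (cis x))"
    by (intro continuous_on_compose2[OF f] continuous_intros) auto
  then have meas: "(\<lambda>x. f (cis x)) \<in> borel_measurable lborel"
    by (simp add: borel_measurable_continuous_onI)
  have unif: "uniform_measure lborel {0..<2 * pi}
      = density lborel (\<lambda>x. ennreal (indicator {0..<2 * pi} x / (2 * pi)))"
    unfolding uniform_measure_def
    by (intro arg_cong[where f = "density lborel"])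
       (auto simp: fun_eq_iff indicator_def divide_ennreal ennreal_1[symmetric] simp del: ennreal_1)
  have "(LINT t|circle_measure. f t) = (LINT x|uniform_measure lborel {0..<2 * pi}. f (cis x))"
    unfolding circle_measure_def
    by (rule integral_distr[OF cis])
       (use f in \<open>simp add: borel_measurable_continuous_on_restrict\<close>)
  also have "\<dots> = (LINT x|lborel. (indicator {0..<2 * pi} x / (2 * pi)) *\<^sub>R f (cis x))"
    unfolding unif using meas by (intro integral_density) auto
  \<comment> \<open>Passing from the half-open to the closed interval changes the integrand at a
    single point.\<close>
  also have "\<dots> = (LINT x|lborel. (1 / (2 * pi)) *\<^sub>R (indicator {0..2 * pi} x *\<^sub>R f (cis x)))"
  proof (rule integral_cong_AE)
    have "AE x in lborel. x \<noteq> 2 * pi" by (rule AE_lborel_singleton)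
    then show "AE x in lborel. (indicator {0..<2 * pi} x / (2 * pi)) *\<^sub>R f (cis x)
        = (1 / (2 * pi)) *\<^sub>R (indicator {0..2 * pi} x *\<^sub>R f (cis x))"
      by eventually_elim (auto simp: indicator_def)
  qed (use meas in measurable)
  also have "\<dots> = (1 / (2 * pi)) *\<^sub>R (LINT x:{0..2 * pi}|lborel. f (cis x))"
    unfolding set_lebesgue_integral_def by (rule integral_scaleR_right)
  also have "(LINT x:{0..2 * pi}|lborel. f (cis x)) = integral {0..2 * pi} (\<lambda>x. f (cis x))"
    by (intro set_borel_integral_eq_integral borel_integrable_atLeastAtMost'
          continuous_on_subset[OF cont]) auto
  finally show ?thesis by (simp add: scaleR_conv_of_real)
qed

text \<open>With \<open>u = cis x\<close> one has du = i u dx, so writing Cauchy's formula with the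
  normalised measure produces the extra factor \<open>t\<close>.\<close>

lemma circle_Cauchy:
  assumes F: "continuous_on (cball 0 1) F" "F holomorphic_on ball 0 1" and z: "cmod z < 1"
  shows "(LINT t|circle_measure. F t * t / (t - z)) = F z"
proof -
  have c: "continuous_on unit_circle (\<lambda>t. F t * t / (t - z))"
    using z by (intro continuous_intros continuous_on_subset[OF F(1)]) auto
  have "((\<lambda>u. F u / (u - z)) has_contour_integral (2 * of_real pi * \<i> * F z)) (circlepath 0 1)"
    using F z by (intro Cauchy_integral_circlepath) auto
  then have "((\<lambda>x. F (cis x) / (cis x - z) * \<i> * cis x) has_integral 2 * of_real pi * \<i> * F z) {0..2 * pi}"
    by (simp add: circlepath_def has_contour_integral_part_circlepath_iff)
  then have "((\<lambda>x. 1 / \<i> * (F (cis x) / (cis x - z) * \<i> * cis x)) has_integral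
      (1 / \<i> * (2 * of_real pi * \<i> * F z))) {0..2 * pi}"
    by (rule has_integral_mult_right)
  then have "integral {0..2 * pi} (\<lambda>x. F (cis x) * cis x / (cis x - z)) = 2 * of_real pi * F z"
    by (intro integral_unique) (simp add: mult_ac)
  then show ?thesis
    by (simp add: circle_integral[OF c])
qed

lemma circle_integral_holomorphic:
  assumes "continuous_on (cball 0 1) F" "F holomorphic_on ball 0 1"
  shows "(LINT t|circle_measure. F t) = F 0"
proof -
  have "(LINT t|circle_measure. F t) = (LINT t|circle_measure. F t * t / (t - 0))"
    by (intro Bochner_Integration.integral_cong) auto
  then show ?thesis using circle_Cauchy[OF assms, of 0] by simp
qed

section \<open>The Poisson kernel and the Poisson formula\<close>

definition poisson_kernel :: "complex \<Rightarrow> complex \<Rightarrow> real" where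
  "poisson_kernel z t = Re ((t + z) / (t - z))"

lemma poisson_kernel_measurable [measurable (raw)]:
  assumes [measurable]: "f \<in> borel_measurable M" "g \<in> borel_measurable M"
  shows "(\<lambda>x. poisson_kernel (f x) (g x)) \<in> borel_measurable M"
  unfolding poisson_kernel_def by measurable

lemma poisson_kernel_eq:
  assumes "cmod t = 1" "cmod z < 1"
  shows "poisson_kernel z t = (1 - (cmod z)\<^sup>2) / (cmod (t - z))\<^sup>2"
proof -
  have "(cmod t)\<^sup>2 = 1" using assms by simp
  then have "(Re t)\<^sup>2 + (Im t)\<^sup>2 = 1" by (simp add: cmod_power2)
  moreover have "(Re t - Re z)\<^sup>2 + (Im t - Im z)\<^sup>2 = (cmod (t - z))\<^sup>2"
    by (simp add: cmod_power2)
  ultimately show ?thesis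
    unfolding poisson_kernel_def Re_divide cmod_power2
    by (simp add: power2_eq_square algebra_simps)
qed

text \<open>Harnack's bounds, from 1 - |z| \<le> |t - z| \<le> 1 + |z|. The upper bound dominates
  integrands and makes Poisson integrals continuous in L1; the positive lower bound converts a bound
  on a Poisson integral back into integrability on the circle.\<close>

lemma poisson_kernel_bounds:
  assumes t: "cmod t = 1" and z: "cmod z < 1"
  shows "(1 - cmod z) / (1 + cmod z) \<le> poisson_kernel z t"
    and "poisson_kernel z t \<le> (1 + cmod z) / (1 - cmod z)"
    and "0 < poisson_kernel z t"
proof -
  have a: "cmod (t - z) \<le> 1 + cmod z" "1 - cmod z \<le> cmod (t - z)"
    using t norm_triangle_ineq4[of t z] norm_triangle_ineq2[of t z] by auto
  have b: "1 - (cmod z)\<^sup>2 = (1 - cmod z) * (1 + cmod z)"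
    by (simp add: power2_eq_square algebra_simps)
  have pos: "0 < cmod (t - z)" using a z by linarith
  have "(1 - cmod z) / (1 + cmod z) = (1 - (cmod z)\<^sup>2) / (1 + cmod z)\<^sup>2"
  proof -
    have "1 + cmod z \<noteq> 0" using norm_ge_zero[of z] by linarith
    then show ?thesis unfolding b by (simp add: power2_eq_square)
  qed
  also have "\<dots> \<le> poisson_kernel z t"
    unfolding poisson_kernel_eq[OF t z] using a pos z
    by (intro divide_left_mono power_mono) (auto simp: b intro!: mult_nonneg_nonneg)
  finally show 1: "(1 - cmod z) / (1 + cmod z) \<le> poisson_kernel z t" .
  have "poisson_kernel z t \<le> (1 - (cmod z)\<^sup>2) / (1 - cmod z)\<^sup>2"
    unfolding poisson_kernel_eq[OF t z] using a pos z
    by (intro divide_left_mono power_mono) (auto simp: b intro!: mult_nonneg_nonneg)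
  also have "\<dots> = (1 + cmod z) / (1 - cmod z)"
    using z unfolding b by (simp add: power2_eq_square)
  finally show "poisson_kernel z t \<le> (1 + cmod z) / (1 - cmod z)" .
  have "0 < (1 - cmod z) / (1 + cmod z)" using z by (intro divide_pos_pos) (auto simp: add_pos_nonneg)
  with 1 show "0 < poisson_kernel z t" by linarith
qed

lemma poisson_kernel_continuous:
  "cmod z < 1 \<Longrightarrow> continuous_on unit_circle (\<lambda>t. poisson_kernel z t)"
  unfolding poisson_kernel_def by (intro continuous_intros) auto

text \<open>On the circle the kernel splits into \<open>t / (t - z)\<close> and
  \<open>cnj z * t / (1 - cnj z * t)\<close>. The first is the Cauchy kernel and reproduces
  \<open>F z\<close>. The second extends holomorphically to the disc and vanishes at 0, so by the
  mean value property it contributes nothing.\<close>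

lemma poisson_formula:
  assumes F: "continuous_on (cball 0 1) F" "F holomorphic_on ball 0 1" and z: "cmod z < 1"
  shows "(LINT t|circle_measure. of_real (poisson_kernel z t) * F t) = F z"
proof -
  define G where "G t = F t * (cnj z * t / (1 - cnj z * t))" for t
  have nz: "1 - cnj z * t \<noteq> 0" if "cmod t \<le> 1" for t
  proof -
    have "cmod (cnj z * t) < 1"
      using z that by (simp add: norm_mult) (metis mult_left_le norm_ge_zero order_le_less_trans)
    then show ?thesis by auto
  qed
  have G: "continuous_on (cball 0 1) G" "G holomorphic_on ball 0 1"
    unfolding G_def using F nz by (auto intro!: continuous_intros holomorphic_intros)
  have eq: "of_real (poisson_kernel z t) * F t = F t * t / (t - z) + G t" if "t \<in> unit_circle" for t
  proof -
    have t: "t * cnj t = 1" "t \<noteq> 0" "t - z \<noteq> 0"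
      using that z by (auto simp: complex_norm_square[symmetric])
    then have ct: "cnj t = 1 / t" by (simp add: field_simps)
    have n: "1 - cnj z * t \<noteq> 0" using nz that by auto
    have "complex_of_real (poisson_kernel z t) = ((t + z) / (t - z) + cnj ((t + z) / (t - z))) / 2"
      unfolding poisson_kernel_def complex_add_cnj by simp
    also have "cnj ((t + z) / (t - z)) = (1 + cnj z * t) / (1 - cnj z * t)"
      using t n by (simp add: ct field_simps)
    also have "((t + z) / (t - z) + (1 + cnj z * t) / (1 - cnj z * t)) / 2
        = t / (t - z) + cnj z * t / (1 - cnj z * t)"
    proof -
      define A where "A = t / (t - z)"
      define B where "B = cnj z * t / (1 - cnj z * t)"
      have "(t + z) / (t - z) = 2 * A - 1"
        using t by (simp add: A_def field_simps)
      moreover have "(1 + cnj z * t) / (1 - cnj z * t) = 2 * B + 1"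
        using n by (simp add: B_def field_simps)
      ultimately show ?thesis
        unfolding A_def[symmetric] B_def[symmetric] by simp
    qed
    finally show ?thesis by (simp add: G_def algebra_simps)
  qed
  have "(LINT t|circle_measure. of_real (poisson_kernel z t) * F t)
      = (LINT t|circle_measure. F t * t / (t - z) + G t)"
    by (intro Bochner_Integration.integral_cong refl) (simp add: eq)
  also have "\<dots> = (LINT t|circle_measure. F t * t / (t - z)) + (LINT t|circle_measure. G t)"
    using z by (intro Bochner_Integration.integral_add integrable_circle_continuous continuous_intros
          continuous_on_subset[OF F(1)] continuous_on_subset[OF G(1)]) auto
  also have "\<dots> = F z"
    unfolding circle_Cauchy[OF F z] circle_integral_holomorphic[OF G] by (simp add: G_def)
  finally show ?thesis .
qed

lemma poisson_formula_Re:
  assumes F: "continuous_on (cball 0 1) F" "F holomorphic_on ball 0 1" and z: "cmod z < 1"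
  shows "(LINT t|circle_measure. poisson_kernel z t * Re (F t)) = Re (F z)"
proof -
  have "integrable circle_measure (\<lambda>t. of_real (poisson_kernel z t) * F t)"
    using z by (intro integrable_circle_continuous continuous_intros poisson_kernel_continuous
       continuous_on_subset[OF F(1)]) auto
  then have "(LINT t|circle_measure. Re (of_real (poisson_kernel z t) * F t)) = Re (F z)"
    by (subst integral_Re) (auto simp: poisson_formula[OF assms])
  then show ?thesis by simp
qed

lemma poisson_kernel_integral: "cmod z < 1 \<Longrightarrow> (LINT t|circle_measure. poisson_kernel z t) = 1"
  using poisson_formula_Re[of "\<lambda>_. 1" z] by simp

lemma integrable_poisson_kernel_mult:
  fixes u :: "complex \<Rightarrow> 'b :: {banach, second_countable_topology}"
  assumes "integrable circle_measure u" "cmod z < 1"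
  shows "integrable circle_measure (\<lambda>t. poisson_kernel z t *\<^sub>R u t)"
proof (rule Bochner_Integration.integrable_bound)
  show "integrable circle_measure (\<lambda>t. (1 + cmod z) / (1 - cmod z) * norm (u t))"
    using assms by auto
  show "AE t in circle_measure. norm (poisson_kernel z t *\<^sub>R u t)
      \<le> norm ((1 + cmod z) / (1 - cmod z) * norm (u t))"
  proof (intro AE_I2)
    fix t assume "t \<in> space circle_measure"
    then have t: "cmod t = 1" by simp
    have "norm (poisson_kernel z t *\<^sub>R u t) = poisson_kernel z t * norm (u t)"
      using poisson_kernel_bounds(3)[OF t assms(2)] by simp
    also have "\<dots> \<le> (1 + cmod z) / (1 - cmod z) * norm (u t)"
      by (intro mult_right_mono poisson_kernel_bounds(2) t assms) auto
    also have "\<dots> \<le> norm ((1 + cmod z) / (1 - cmod z) * norm (u t))"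
      by (simp only: real_norm_def abs_ge_self)
    finally show "norm (poisson_kernel z t *\<^sub>R u t) \<le> norm ((1 + cmod z) / (1 - cmod z) * norm (u t))" .
  qed
qed (use assms(1) in measurable)

section \<open>Herglotz integrals\<close>

definition herglotz :: "(complex \<Rightarrow> real) \<Rightarrow> complex \<Rightarrow> complex" where
  "herglotz u z = (LINT t|circle_measure. (t + z) / (t - z) * of_real (u t))"

text \<open>The kernel \<open>(t + z) / (t - z)\<close> is 1 plus twice the geometric series in
  \<open>cnj t * z\<close> from n = 1 on; hence the coefficient 1 at n = 0 and 2 elsewhere. The
  expansion yields holomorphy and also gives access to the Fourier coefficients of
  \<open>u\<close>.\<close>

lemma herglotz_sums:
  assumes u: "integrable circle_measure u" and z: "cmod z < 1"
  shows "(\<lambda>n. (if n = 0 then 1 else 2) * (LINT t|circle_measure. cnj t ^ n * of_real (u t)) * z ^ n)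
           sums herglotz u z"
proof -
  let ?f = "\<lambda>n t. (if n = 0 then 1 else 2) * (cnj t * z) ^ n * complex_of_real (u t)"
  have nrm: "norm (?f n t) = (if n = 0 then 1 else 2) * cmod z ^ n * \<bar>u t\<bar>" if "cmod t = 1" for n t
    using that by (simp add: norm_mult norm_power)
  have int: "integrable circle_measure (?f n)" for n
  proof (rule Bochner_Integration.integrable_bound)
    show "integrable circle_measure (\<lambda>t. (if n = 0 then 1 else 2) * cmod z ^ n * \<bar>u t\<bar>)"
      using u by auto
    show "?f n \<in> borel_measurable circle_measure"
      using u by measurable
    show "AE t in circle_measure. norm (?f n t) \<le> norm ((if n = 0 then 1 else 2) * cmod z ^ n * \<bar>u t\<bar>)"
    proof (intro AE_I2)
      fix t assume "t \<in> space circle_measure"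
      then show "norm (?f n t) \<le> norm ((if n = 0 then 1 else 2) * cmod z ^ n * \<bar>u t\<bar>)"
        by (subst nrm) auto
    qed
  qed
  have summ: "summable (\<lambda>n. (if n = 0 then 1 else 2) * cmod z ^ n * c)" for c
  proof -
    have "summable (\<lambda>n. 2 * cmod z ^ n * c - (if n = 0 then 1 else 0) * c)"
      using z summable_single[of 0 "\<lambda>_. 1 :: real"]
      by (intro summable_diff summable_mult summable_mult2 summable_geometric) auto
    also have "(\<lambda>n. 2 * cmod z ^ n * c - (if n = 0 then 1 else 0) * c)
        = (\<lambda>n. (if n = 0 then 1 else 2) * cmod z ^ n * c)"
      by auto
    finally show ?thesis .
  qed
  have eq: "(\<lambda>n. ?f n t) sums ((t + z) / (t - z) * of_real (u t))" if t: "cmod t = 1" for t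
  proof -
    let ?w = "cnj t * z"
    have w: "cmod ?w < 1" using t z by (simp add: norm_mult)
    have "(\<lambda>n. 2 * ?w ^ n - (if n = 0 then 1 else 0)) sums (2 * (1 / (1 - ?w)) - 1)"
      using sums_single[of 0 "\<lambda>_. 1 :: complex"]
      by (intro sums_diff sums_mult geometric_sums w) auto
    also have "(\<lambda>n. 2 * ?w ^ n - (if n = 0 then 1 else 0)) = (\<lambda>n. (if n = 0 then 1 else 2) * ?w ^ n)"
      by auto
    also have "2 * (1 / (1 - ?w)) - 1 = (t + z) / (t - z)"
    proof -
      have "t * cnj t = 1" using t by (simp add: complex_norm_square[symmetric])
      moreover have "t \<noteq> 0" using t by auto
      ultimately have ct: "cnj t = 1 / t" by (simp add: field_simps)
      have "t - z \<noteq> 0" using t z by auto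
      then show ?thesis using \<open>t \<noteq> 0\<close> unfolding ct by (simp add: field_simps)
    qed
    finally show ?thesis by (rule sums_mult2)
  qed
  have sum2: "summable (\<lambda>n. LINT t|circle_measure. norm (?f n t))"
  proof -
    have "(LINT t|circle_measure. norm (?f n t))
        = (if n = 0 then 1 else 2) * cmod z ^ n * (LINT t|circle_measure. \<bar>u t\<bar>)" for n
    proof -
      have "(LINT t|circle_measure. norm (?f n t))
        = (LINT t|circle_measure. (if n = 0 then 1 else 2) * cmod z ^ n * \<bar>u t\<bar>)"
        by (intro Bochner_Integration.integral_cong refl nrm) simp
      then show ?thesis by simp
    qed
    then show ?thesis by (simp only: summ)
  qed
  have "(\<lambda>n. LINT t|circle_measure. ?f n t) sums (LINT t|circle_measure. (\<Sum>n. ?f n t))"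
  proof (rule sums_integral[OF int _ sum2], intro AE_I2)
    fix t assume "t \<in> space circle_measure"
    then show "summable (\<lambda>n. norm (?f n t))"
      by (subst nrm) (auto intro: summ)
  qed
  also have "(LINT t|circle_measure. (\<Sum>n. ?f n t)) = herglotz u z"
    unfolding herglotz_def
    by (intro Bochner_Integration.integral_cong refl sums_unique[symmetric] eq) simp
  also have "(\<lambda>n. LINT t|circle_measure. ?f n t)
      = (\<lambda>n. (if n = 0 then 1 else 2) * (LINT t|circle_measure. cnj t ^ n * of_real (u t)) * z ^ n)"
  proof
    fix n
    have "(LINT t|circle_measure. ?f n t)
        = (LINT t|circle_measure. ((if n = 0 then 1 else 2) * z ^ n) * (cnj t ^ n * of_real (u t)))"
      by (intro Bochner_Integration.integral_cong) (auto simp: power_mult_distrib)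
    also have "\<dots> = ((if n = 0 then 1 else 2) * z ^ n) * (LINT t|circle_measure. cnj t ^ n * of_real (u t))"
      by (rule integral_mult_right_zero)
    finally show "(LINT t|circle_measure. ?f n t)
        = (if n = 0 then 1 else 2) * (LINT t|circle_measure. cnj t ^ n * of_real (u t)) * z ^ n"
      by simp
  qed
  finally show ?thesis .
qed

lemma herglotz_holomorphic:
  assumes "integrable circle_measure u"
  shows "herglotz u holomorphic_on ball 0 1"
  using herglotz_sums[OF assms] by (intro power_series_holomorphic) auto

lemma integrable_herglotz_kernel:
  assumes u: "integrable circle_measure u" and z: "cmod z < 1"
  shows "integrable circle_measure (\<lambda>t. (t + z) / (t - z) * of_real (u t))"
proof (rule Bochner_Integration.integrable_bound)
  show "integrable circle_measure (\<lambda>t. 2 / (1 - cmod z) * \<bar>u t\<bar>)" using u by auto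
  show "(\<lambda>t. (t + z) / (t - z) * of_real (u t)) \<in> borel_measurable circle_measure"
    using u by measurable
  show "AE t in circle_measure. norm ((t + z) / (t - z) * of_real (u t)) \<le> norm (2 / (1 - cmod z) * \<bar>u t\<bar>)"
  proof (intro AE_I2)
    fix t assume "t \<in> space circle_measure"
    then have "cmod t = 1" by simp
    then have "cmod (t + z) / cmod (t - z) \<le> 2 / (1 - cmod z)"
      using z norm_triangle_ineq[of t z] norm_triangle_ineq2[of t z] by (intro frac_le) auto
    then have "cmod (t + z) / cmod (t - z) * \<bar>u t\<bar> \<le> 2 / (1 - cmod z) * \<bar>u t\<bar>"
      by (rule mult_right_mono) simp
    also have "\<dots> \<le> norm (2 / (1 - cmod z) * \<bar>u t\<bar>)" by (simp only: real_norm_def abs_ge_self)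
    finally show "norm ((t + z) / (t - z) * of_real (u t)) \<le> norm (2 / (1 - cmod z) * \<bar>u t\<bar>)"
      by (simp only: norm_mult norm_divide norm_of_real)
  qed
qed

lemma Re_herglotz:
  assumes "integrable circle_measure u" "cmod z < 1"
  shows "Re (herglotz u z) = (LINT t|circle_measure. poisson_kernel z t * u t)"
proof -
  have "Re (w * of_real x) = Re w * x" for w x by simp
  then show ?thesis
    unfolding herglotz_def poisson_kernel_def
    by (subst integral_Re[symmetric, OF integrable_herglotz_kernel[OF assms]]) (simp only:)
qed

lemma herglotz_zero: "herglotz u 0 = of_real (LINT t|circle_measure. u t)"
proof -
  have "herglotz u 0 = (LINT t|circle_measure. of_real (u t))"
    unfolding herglotz_def by (intro Bochner_Integration.integral_cong) auto
  then show ?thesis by simp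
qed

lemma herglotz_bound:
  assumes u: "integrable circle_measure u" and z: "cmod z < 1"
  shows "cmod (herglotz u z) \<le> 2 / (1 - cmod z) * (LINT t|circle_measure. \<bar>u t\<bar>)"
proof -
  have "cmod (herglotz u z) \<le> (LINT t|circle_measure. norm ((t + z) / (t - z) * of_real (u t)))"
    unfolding herglotz_def by (rule integral_norm_bound)
  also have "\<dots> \<le> (LINT t|circle_measure. 2 / (1 - cmod z) * \<bar>u t\<bar>)"
  proof (rule integral_mono)
    fix t assume "t \<in> space circle_measure"
    then have "cmod t = 1" by simp
    then have "cmod (t + z) / cmod (t - z) \<le> 2 / (1 - cmod z)"
      using z norm_triangle_ineq[of t z] norm_triangle_ineq2[of t z] by (intro frac_le) auto
    then have "cmod (t + z) / cmod (t - z) * \<bar>u t\<bar> \<le> 2 / (1 - cmod z) * \<bar>u t\<bar>"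
      by (rule mult_right_mono) simp
    then show "norm ((t + z) / (t - z) * of_real (u t)) \<le> 2 / (1 - cmod z) * \<bar>u t\<bar>"
      by (simp only: norm_mult norm_divide norm_of_real)
  qed (use u integrable_herglotz_kernel[OF assms] in auto)
  finally show ?thesis by simp
qed

section \<open>Trigonometric approximation and Fourier coefficients\<close>

lemma prob_unit_circle [simp]: "measure circle_measure unit_circle = 1"
  by (metis circle.prob_space space_circle_measure)

lemma lebesgue_integral_cnj:
  fixes f :: "'a \<Rightarrow> complex"
  shows "(LINT t|M. cnj (f t)) = cnj (LINT t|M. f t)"
  by (rule integral_bounded_linear'[OF bounded_linear_cnj bounded_linear_cnj]) auto

lemma Re_poly_sum_on_circle:
  assumes "finite A" "\<And>i. i \<in> A \<Longrightarrow> \<exists>p. \<forall>t\<in>unit_circle. f i t = Re (poly p t)"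
  shows "\<exists>p. \<forall>t\<in>unit_circle. (\<Sum>i\<in>A. f i t) = Re (poly p t)"
  using assms
proof (induction A)
  case empty
  show ?case by (intro exI[of _ 0]) auto
next
  case (insert a A)
  obtain p where p: "\<forall>t\<in>unit_circle. (\<Sum>i\<in>A. f i t) = Re (poly p t)"
    using insert.IH insert.prems by auto
  obtain q where q: "\<forall>t\<in>unit_circle. f a t = Re (poly q t)" using insert.prems by auto
  show ?case using p q insert.hyps by (intro exI[of _ "q + p"]) auto
qed

text \<open>Product-to-sum formula: \<open>Re x * Re y = Re (x * y / 2 + cnj x * y / 2)\<close>, and
  on the circle \<open>cnj t ^ i * t ^ j = t ^ (j - i)\<close> for i \<le> j. Thus the real parts of
  polynomials form an algebra on the circle, as the Stone-Weierstrass theorem requires.\<close>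

lemma Re_monom_mult_on_circle:
  fixes a b :: complex
  shows "\<exists>p. \<forall>t\<in>unit_circle. Re (a * t ^ i) * Re (b * t ^ j) = Re (poly p t)"
proof -
  have *: "\<exists>p. \<forall>t\<in>unit_circle. Re (a * t ^ i) * Re (b * t ^ j) = Re (poly p t)" if "i \<le> j"
    for a b :: complex and i j
  proof (intro exI ballI)
    fix t assume "t \<in> unit_circle"
    then have "t * cnj t = 1" by (simp add: complex_norm_square[symmetric])
    then have "cnj t ^ i * t ^ i = 1"
      by (metis mult.commute power_mult_distrib power_one)
    then have e: "cnj t ^ i * t ^ j = t ^ (j - i)"
      using \<open>i \<le> j\<close> by (metis add_diff_inverse_nat mult.assoc mult_1 not_less power_add)
    have "Re (a * t ^ i) * Re (b * t ^ j)
        = Re ((a * t ^ i) * (b * t ^ j) / 2 + cnj (a * t ^ i) * (b * t ^ j) / 2)"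
    proof -
      have "Re x * Re y = Re (x * y / 2 + cnj x * y / 2)" for x y :: complex
        by (simp add: field_simps)
      then show ?thesis .
    qed
    also have "cnj (a * t ^ i) * (b * t ^ j) = cnj a * b * (cnj t ^ i * t ^ j)"
      by simp
    also have "(a * t ^ i) * (b * t ^ j) / 2 + cnj a * b * (cnj t ^ i * t ^ j) / 2
        = poly (monom (a * b / 2) (i + j) + monom (cnj a * b / 2) (j - i)) t"
      unfolding e by (simp add: poly_monom power_add)
    finally show "Re (a * t ^ i) * Re (b * t ^ j)
        = Re (poly (monom (a * b / 2) (i + j) + monom (cnj a * b / 2) (j - i)) t)" .
  qed
  show ?thesis
  proof (cases "i \<le> j")
    case False
    then show ?thesis using *[of j i b a] by (simp add: mult.commute)
  qed (rule *)
qed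

lemma Re_poly_mult_on_circle:
  fixes p q :: "complex poly"
  shows "\<exists>r. \<forall>t\<in>unit_circle. Re (poly p t) * Re (poly q t) = Re (poly r t)"
proof -
  have "\<exists>r. \<forall>t\<in>unit_circle. (\<Sum>i\<le>degree p. \<Sum>j\<le>degree q.
      Re (coeff p i * t ^ i) * Re (coeff q j * t ^ j)) = Re (poly r t)"
    by (intro Re_poly_sum_on_circle Re_monom_mult_on_circle finite_atMost)
  then show ?thesis
    by (simp add: poly_altdef sum_product)
qed

text \<open>Real parts of polynomials on the circle are the real trigonometric polynomials. Written
  in this form, an approximant is at once the real part of an entire function, to which the Poisson
  formula and the maximum principle apply.\<close>

lemma trigonometric_approximation:
  assumes "continuous_on unit_circle \<phi>" "0 < e"
  obtains p :: "complex poly" where "\<And>t. t \<in> unit_circle \<Longrightarrow> \<bar>\<phi> t - Re (poly p t)\<bar> < e"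
proof -
  define P where "P f \<longleftrightarrow> (\<exists>p::complex poly. \<forall>t\<in>unit_circle. f t = Re (poly p t))" for f :: "complex \<Rightarrow> real"
  have "\<exists>g. P g \<and> (\<forall>t\<in>unit_circle. \<bar>\<phi> t - g t\<bar> < e)"
  proof (rule Stone_Weierstrass_HOL)
    show "P (\<lambda>_. c)" for c
      unfolding P_def by (intro exI[of _ "[:of_real c:]"]) auto
    show "continuous_on unit_circle f" if f: "P f" for f
    proof -
      obtain p where p: "\<forall>t\<in>unit_circle. f t = Re (poly p t)"
        using f unfolding P_def by blast
      have "continuous_on unit_circle (\<lambda>t. Re (poly p t))" by (intro continuous_intros)
      then show ?thesis using p by (subst continuous_on_cong[OF refl]) auto
    qed
    show "P (\<lambda>x. f x + g x)" if fg: "P f \<and> P g" for f g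
    proof -
      obtain p q where "\<forall>t\<in>unit_circle. f t = Re (poly p t)" "\<forall>t\<in>unit_circle. g t = Re (poly q t)"
        using fg unfolding P_def by blast
      then show ?thesis unfolding P_def by (intro exI[of _ "p + q"]) simp
    qed
    show "P (\<lambda>x. f x * g x)" if fg: "P f \<and> P g" for f g
    proof -
      obtain p q where "\<forall>t\<in>unit_circle. f t = Re (poly p t)" "\<forall>t\<in>unit_circle. g t = Re (poly q t)"
        using fg unfolding P_def by blast
      then show ?thesis unfolding P_def using Re_poly_mult_on_circle[of p q] by simp
    qed
    show "\<exists>f. P f \<and> f x \<noteq> f y" if "x \<in> unit_circle \<and> y \<in> unit_circle \<and> x \<noteq> y" for x y
    proof (cases "Re x = Re y")
      case True
      then have "Im x \<noteq> Im y" using that by (simp add: complex_eq_iff)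
      moreover have "P Im" unfolding P_def by (intro exI[of _ "[:0, -\<i>:]"]) auto
      ultimately show ?thesis by blast
    next
      case False
      moreover have "P Re" unfolding P_def by (intro exI[of _ "[:0, 1:]"]) auto
      ultimately show ?thesis by blast
    qed
  qed (use assms in auto)
  then obtain g p where "\<forall>t\<in>unit_circle. \<bar>\<phi> t - g t\<bar> < e" "\<forall>t\<in>unit_circle. g t = Re (poly p t)"
    unfolding P_def by blast
  then show ?thesis by (intro that[of p]) metis
qed

text \<open>If \<open>\<phi>\<close> were the real part of a polynomial p, the maximum principle for
  \<open>f * exp (- p)\<close> would give the claim; uniform approximation reduces to that case.
  Taking a continuous majorant \<open>\<phi>\<close> in place of ln|f| itself makes zeros of f on
  the circle harmless.\<close>

lemma norm_le_exp_poisson_integral: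
  assumes f: "continuous_on (cball 0 1) f" "f holomorphic_on ball 0 1"
    and \<phi>: "continuous_on unit_circle \<phi>"
    and le: "\<And>t. t \<in> unit_circle \<Longrightarrow> cmod (f t) \<le> exp (\<phi> t)" and z: "cmod z < 1"
  shows "cmod (f z) \<le> exp (LINT t|circle_measure. poisson_kernel z t * \<phi> t)"
proof (cases "f z = 0")
  case False
  have "ln (cmod (f z)) \<le> (LINT t|circle_measure. poisson_kernel z t * \<phi> t)"
  proof (rule field_le_epsilon)
    fix e :: real assume "0 < e"
    then have "e / 2 > 0" by simp
    then obtain p :: "complex poly" where p: "\<And>t. t \<in> unit_circle \<Longrightarrow> \<bar>\<phi> t - Re (poly p t)\<bar> < e / 2"
      using trigonometric_approximation[OF \<phi>] by blast
    define g where "g w = f w * exp (- poly p w)" for w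
    have bd: "cmod (g t) \<le> exp (e / 2)" if "t \<in> frontier (cball 0 1)" for t
    proof -
      have t: "t \<in> unit_circle" using that by (simp add: frontier_cball)
      have "cmod (g t) \<le> exp (\<phi> t) * exp (- Re (poly p t))"
        unfolding g_def norm_mult norm_exp_eq_Re using le[OF t] by simp
      also have "\<dots> = exp (\<phi> t - Re (poly p t))" by (simp flip: exp_add)
      also have "\<dots> \<le> exp (e / 2)" using p[OF t] by (subst exp_le_cancel_iff) linarith
      finally show ?thesis .
    qed
    have "cmod (g z) \<le> exp (e / 2)"
    proof (rule maximum_modulus_frontier[OF _ _ _ bd])
      show "g holomorphic_on interior (cball 0 1)" "continuous_on (closure (cball 0 1)) g"
        unfolding g_def using f by (auto intro!: holomorphic_intros continuous_intros)
    qed (use z in auto)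
    then have "ln (cmod (g z)) \<le> e / 2"
      using False by (metis g_def exp_not_eq_zero ln_exp ln_le_cancel_iff exp_gt_zero mult_eq_0_iff zero_less_norm_iff)
    moreover have "ln (cmod (g z)) = ln (cmod (f z)) - Re (poly p z)"
      using False by (simp add: g_def norm_mult ln_mult)
    moreover have "Re (poly p z) \<le> (LINT t|circle_measure. poisson_kernel z t * \<phi> t) + e / 2"
    proof -
      have "Re (poly p z) = (LINT t|circle_measure. poisson_kernel z t * Re (poly p t))"
        by (rule poisson_formula_Re[symmetric]) (use z in \<open>auto intro!: continuous_intros holomorphic_intros\<close>)
      also have "\<dots> \<le> (LINT t|circle_measure. poisson_kernel z t * \<phi> t + poisson_kernel z t * (e / 2))"
      proof (rule integral_mono)
        fix t assume "t \<in> space circle_measure"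
        then have t: "t \<in> unit_circle" by simp
        have "poisson_kernel z t * Re (poly p t) \<le> poisson_kernel z t * (\<phi> t + e / 2)"
        proof (rule mult_left_mono)
          show "Re (poly p t) \<le> \<phi> t + e / 2" using p[OF t] by linarith
          show "0 \<le> poisson_kernel z t" using poisson_kernel_bounds(3)[of t z] t z by simp
        qed
        then show "poisson_kernel z t * Re (poly p t)
            \<le> poisson_kernel z t * \<phi> t + poisson_kernel z t * (e / 2)"
          by (simp add: algebra_simps)
      qed (use z \<phi> in \<open>auto intro!: integrable_circle_continuous continuous_intros poisson_kernel_continuous\<close>)
      also have "\<dots> = (LINT t|circle_measure. poisson_kernel z t * \<phi> t) + e / 2"
        using z \<phi> by (subst Bochner_Integration.integral_add)
          (auto intro!: integrable_circle_continuous continuous_intros poisson_kernel_continuous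
            simp: poisson_kernel_integral)
      finally show ?thesis .
    qed
    ultimately show "ln (cmod (f z)) \<le> (LINT t|circle_measure. poisson_kernel z t * \<phi> t) + e"
      by linarith
  qed
  then show ?thesis using False by (metis exp_le_cancel_iff exp_ln zero_less_norm_iff)
qed simp

section \<open>Fourier coefficients and Parseval's identity for power series\<close>

lemma circle_integral_power_cnj_power:
  "(LINT t|circle_measure. t ^ m * cnj t ^ n) = (if m = n then 1 else 0)"
proof -
  have *: "(LINT t|circle_measure. t ^ m * cnj t ^ n) = (if m = n then 1 else 0)" if "n \<le> m" for m n
  proof -
    have "(LINT t|circle_measure. t ^ m * cnj t ^ n) = (LINT t|circle_measure. t ^ (m - n))"
    proof (intro Bochner_Integration.integral_cong refl)
      fix t assume "t \<in> space circle_measure"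
      then have "t * cnj t = 1" by (simp add: complex_norm_square[symmetric])
      then have "t ^ n * cnj t ^ n = 1" by (metis power_mult_distrib power_one)
      then show "t ^ m * cnj t ^ n = t ^ (m - n)"
        using that by (metis le_add_diff_inverse2 mult.assoc mult.right_neutral power_add)
    qed
    also have "\<dots> = 0 ^ (m - n)"
      by (rule circle_integral_holomorphic) (auto intro!: continuous_intros holomorphic_intros)
    finally show ?thesis using that by auto
  qed
  show ?thesis
  proof (cases "n \<le> m")
    case False
    have "(LINT t|circle_measure. t ^ m * cnj t ^ n) = (LINT t|circle_measure. cnj (t ^ n * cnj t ^ m))"
      by (simp add: mult.commute)
    also have "\<dots> = cnj (LINT t|circle_measure. t ^ n * cnj t ^ m)" by (rule lebesgue_integral_cnj)
    finally show ?thesis using False *[of m n] by auto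
  qed (rule *)
qed

lemma power_series_abs_summable:
  fixes a :: "nat \<Rightarrow> complex"
  assumes "\<And>z. cmod z < 1 \<Longrightarrow> (\<lambda>n. a n * z ^ n) sums f z" "0 \<le> r" "r < 1"
  shows "summable (\<lambda>n. cmod (a n) * r ^ n)"
proof -
  \<comment> \<open>Convergence at a point of modulus strictly between r and 1 gives absolute
    convergence at r.\<close>
  have "cmod (of_real ((1 + r) / 2)) = (1 + r) / 2" unfolding norm_of_real using assms by simp
  then have "summable (\<lambda>n. norm (a n * of_real r ^ n))"
    using assms by (intro powser_insidea[of a "of_real ((1 + r) / 2)"] sums_summable[OF assms(1)])
      (auto simp del: of_real_divide of_real_add)
  then show ?thesis using assms by (simp add: norm_mult norm_power)
qed

lemma power_series_continuous:
  fixes a :: "nat \<Rightarrow> complex"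
  assumes "\<And>z. cmod z < 1 \<Longrightarrow> (\<lambda>n. a n * z ^ n) sums f z"
  shows "continuous_on (ball 0 1) f"
  using assms by (intro holomorphic_on_imp_continuous_on power_series_holomorphic[of 0 1 a]) auto

lemma continuous_on_circle_dilation:
  fixes f :: "'a :: real_normed_field \<Rightarrow> 'b :: topological_space"
  assumes "continuous_on (ball 0 1) f" "0 \<le> r" "r < 1"
  shows "continuous_on (cball 0 1) (\<lambda>t. f (of_real r * t))"
proof -
  have sub: "of_real r * t \<in> ball 0 1" if "t \<in> cball 0 1" for t :: 'a
  proof -
    have "norm (of_real r * t) \<le> r * 1"
      using assms(2) that unfolding norm_mult by (intro mult_mono) auto
    then show ?thesis using assms(3) by simp
  qed
  show ?thesis
    by (intro continuous_on_compose2[OF assms(1)] continuous_intros image_subsetI sub)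
qed

lemma power_series_coefficient:
  fixes a :: "nat \<Rightarrow> complex"
  assumes f: "\<And>z. cmod z < 1 \<Longrightarrow> (\<lambda>n. a n * z ^ n) sums f z" and r: "0 \<le> r" "r < 1"
  shows "(LINT t|circle_measure. f (of_real r * t) * cnj t ^ n) = a n * of_real r ^ n"
proof -
  let ?F = "\<lambda>m t. a m * of_real r ^ m * (t ^ m * cnj t ^ n)"
  have int: "integrable circle_measure (?F m)" for m
    by (intro integrable_circle_continuous continuous_intros)
  have nrm: "norm (?F m t) = cmod (a m) * r ^ m" if "cmod t = 1" for m t
    using that r by (simp add: norm_mult norm_power)
  have summ: "summable (\<lambda>n. cmod (a n) * r ^ n)" by (rule power_series_abs_summable[OF f r])
  have "(LINT t|circle_measure. norm (?F m t)) = cmod (a m) * r ^ m" for m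
  proof -
    have "(LINT t|circle_measure. norm (?F m t)) = (LINT t|circle_measure. cmod (a m) * r ^ m)"
      by (intro Bochner_Integration.integral_cong refl nrm) simp
    then show ?thesis by simp
  qed
  then have sum2: "summable (\<lambda>m. LINT t|circle_measure. norm (?F m t))" by (simp only: summ)
  have "(\<lambda>m. LINT t|circle_measure. ?F m t) sums (LINT t|circle_measure. (\<Sum>m. ?F m t))"
  proof (rule sums_integral[OF int _ sum2], intro AE_I2)
    fix t assume "t \<in> space circle_measure"
    then show "summable (\<lambda>m. norm (?F m t))" by (subst nrm) (auto intro: summ)
  qed
  also have "(\<lambda>m. LINT t|circle_measure. ?F m t) = (\<lambda>m. if m = n then a n * of_real r ^ n else 0)"
    by (simp only: integral_mult_right_zero circle_integral_power_cnj_power) auto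
  also have "(LINT t|circle_measure. (\<Sum>m. ?F m t)) = (LINT t|circle_measure. f (of_real r * t) * cnj t ^ n)"
  proof (intro Bochner_Integration.integral_cong refl sums_unique[symmetric])
    fix t assume "t \<in> space circle_measure"
    then have "cmod (of_real r * t) < 1" using r by (simp add: norm_mult)
    from sums_mult2[OF f[OF this], of "cnj t ^ n"]
    show "(\<lambda>m. ?F m t) sums (f (of_real r * t) * cnj t ^ n)"
      by (simp add: power_mult_distrib mult.assoc)
  qed
  finally show ?thesis
    using sums_unique2 sums_single[of n "\<lambda>_. a n * of_real r ^ n"] by blast
qed

text \<open>Only one factor of |f|^2 = f * conj f is expanded. The integral of each term is then the
  conjugate of a coefficient already computed, so no double series arises.\<close>

lemma power_series_Parseval:
  fixes a :: "nat \<Rightarrow> complex"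
  assumes f: "\<And>z. cmod z < 1 \<Longrightarrow> (\<lambda>n. a n * z ^ n) sums f z" and r: "0 \<le> r" "r < 1"
  shows "(\<lambda>n. (cmod (a n) * r ^ n)\<^sup>2) sums (LINT t|circle_measure. (cmod (f (of_real r * t)))\<^sup>2)"
proof -
  let ?F = "\<lambda>m t. a m * of_real r ^ m * (t ^ m * cnj (f (of_real r * t)))"
  have cont: "continuous_on unit_circle (\<lambda>t. f (of_real r * t))"
    using continuous_on_circle_dilation[OF power_series_continuous[OF f] r]
    by (rule continuous_on_subset) auto
  have int: "integrable circle_measure (?F m)" for m
    by (intro integrable_circle_continuous continuous_intros cont)
  have nrm: "norm (?F m t) = cmod (a m) * r ^ m * cmod (f (of_real r * t))" if "cmod t = 1" for m t
    using that r by (simp add: norm_mult norm_power)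
  have summ: "summable (\<lambda>n. cmod (a n) * r ^ n * c)" for c
    by (intro summable_mult2 power_series_abs_summable[OF f r])
  have "(LINT t|circle_measure. norm (?F m t))
      = cmod (a m) * r ^ m * (LINT t|circle_measure. cmod (f (of_real r * t)))" for m
  proof -
    have "(LINT t|circle_measure. norm (?F m t))
        = (LINT t|circle_measure. cmod (a m) * r ^ m * cmod (f (of_real r * t)))"
      by (intro Bochner_Integration.integral_cong refl nrm) simp
    then show ?thesis by (simp only: integral_mult_right_zero)
  qed
  then have sum2: "summable (\<lambda>m. LINT t|circle_measure. norm (?F m t))" by (simp only: summ)
  have "(\<lambda>m. LINT t|circle_measure. ?F m t) sums (LINT t|circle_measure. (\<Sum>m. ?F m t))"
  proof (rule sums_integral[OF int _ sum2], intro AE_I2)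
    fix t assume "t \<in> space circle_measure"
    then show "summable (\<lambda>m. norm (?F m t))" by (subst nrm) (auto intro: summ)
  qed
  also have "(\<lambda>m. LINT t|circle_measure. ?F m t) = (\<lambda>m. of_real ((cmod (a m) * r ^ m)\<^sup>2))"
  proof
    fix m
    have "(LINT t|circle_measure. t ^ m * cnj (f (of_real r * t)))
        = (LINT t|circle_measure. cnj (f (of_real r * t) * cnj t ^ m))"
      by (simp add: mult.commute)
    also have "\<dots> = cnj (a m * of_real r ^ m)"
      by (simp only: lebesgue_integral_cnj power_series_coefficient[OF f r])
    finally have "(LINT t|circle_measure. ?F m t) = (a m * of_real r ^ m) * cnj (a m * of_real r ^ m)"
      by (simp only: integral_mult_right_zero)
    also have "\<dots> = of_real ((cmod (a m * of_real r ^ m))\<^sup>2)"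
      by (simp only: complex_norm_square)
    also have "cmod (a m * of_real r ^ m) = cmod (a m) * r ^ m"
      using r by (simp add: norm_mult norm_power)
    finally show "(LINT t|circle_measure. ?F m t) = of_real ((cmod (a m) * r ^ m)\<^sup>2)" .
  qed
  also have "(LINT t|circle_measure. (\<Sum>m. ?F m t))
      = (LINT t|circle_measure. of_real ((cmod (f (of_real r * t)))\<^sup>2))"
  proof (intro Bochner_Integration.integral_cong refl sums_unique[symmetric])
    fix t assume "t \<in> space circle_measure"
    then have "cmod (of_real r * t) < 1" using r by (simp add: norm_mult)
    from sums_mult2[OF f[OF this], of "cnj (f (of_real r * t))"]
    show "(\<lambda>m. ?F m t) sums of_real ((cmod (f (of_real r * t)))\<^sup>2)"
      unfolding complex_norm_square by (simp add: power_mult_distrib mult.assoc)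
  qed
  finally show ?thesis
    by (simp only: integral_complex_of_real sums_of_real_iff)
qed


text \<open>As \<open>w\<close> is real, its Fourier coefficients of the opposite sign are
  conjugates of the given ones, so \<open>w\<close> is orthogonal to all trigonometric polynomials.
  The test functions are then enlarged to continuous functions, to indicators of open sets and, by a
  Dynkin argument, to indicators of Borel sets.\<close>

lemma circle_integral_zero_imp_AE_zero:
  fixes w :: "complex \<Rightarrow> real"
  assumes w: "integrable circle_measure w"
    and zero: "\<And>n. (LINT t|circle_measure. cnj t ^ n * of_real (w t)) = 0"
  shows "AE t in circle_measure. w t = 0"
proof -
  have [measurable]: "w \<in> borel_measurable circle_measure" using w by auto
  have int_mult: "integrable circle_measure (\<lambda>t. f t * w t)"
    if f: "f \<in> borel_measurable circle_measure" "\<And>t. t \<in> unit_circle \<Longrightarrow> \<bar>f t\<bar> \<le> B" for f B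
  proof (rule Bochner_Integration.integrable_bound)
    show "integrable circle_measure (\<lambda>t. B * \<bar>w t\<bar>)" using w by auto
    show "AE t in circle_measure. norm (f t * w t) \<le> norm (B * \<bar>w t\<bar>)"
    proof (intro AE_I2)
      fix t assume "t \<in> space circle_measure"
      then have "\<bar>f t\<bar> * \<bar>w t\<bar> \<le> B * \<bar>w t\<bar>" using f(2) by (intro mult_right_mono) auto
      also have "\<dots> \<le> norm (B * \<bar>w t\<bar>)" by (simp only: real_norm_def abs_ge_self)
      finally show "norm (f t * w t) \<le> norm (B * \<bar>w t\<bar>)" by (simp only: real_norm_def abs_mult)
    qed
  qed (use f in measurable)
  have poly: "(LINT t|circle_measure. Re (poly p t) * w t) = 0" for p
  proof -
    have i: "integrable circle_measure (\<lambda>t. coeff p i * (t ^ i * of_real (w t)))" for i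
    proof (rule Bochner_Integration.integrable_bound)
      show "integrable circle_measure (\<lambda>t. cmod (coeff p i) * \<bar>w t\<bar>)" using w by auto
      show "AE t in circle_measure. norm (coeff p i * (t ^ i * of_real (w t))) \<le> norm (cmod (coeff p i) * \<bar>w t\<bar>)"
        by (intro AE_I2) (simp add: norm_mult norm_power abs_mult)
    qed measurable
    have z: "(LINT t|circle_measure. t ^ i * of_real (w t)) = 0" for i
    proof -
      have "(LINT t|circle_measure. t ^ i * of_real (w t))
          = (LINT t|circle_measure. cnj (cnj t ^ i * of_real (w t)))" by simp
      also have "\<dots> = 0" by (simp only: lebesgue_integral_cnj zero complex_cnj_zero)
      finally show ?thesis .
    qed
    have "(LINT t|circle_measure. Re (poly p t) * w t)
        = (LINT t|circle_measure. Re (\<Sum>i\<le>degree p. coeff p i * (t ^ i * of_real (w t))))"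
    proof (intro Bochner_Integration.integral_cong refl)
      fix t
      have "Re (poly p t) * w t = Re (poly p t * of_real (w t))" by simp
      also have "poly p t * of_real (w t) = (\<Sum>i\<le>degree p. coeff p i * (t ^ i * of_real (w t)))"
        by (simp add: poly_altdef sum_distrib_right mult.assoc)
      finally show "Re (poly p t) * w t = Re (\<Sum>i\<le>degree p. coeff p i * (t ^ i * of_real (w t)))" .
    qed
    also have "\<dots> = Re (LINT t|circle_measure. (\<Sum>i\<le>degree p. coeff p i * (t ^ i * of_real (w t))))"
      by (intro integral_Re Bochner_Integration.integrable_sum i)
    also have "(LINT t|circle_measure. (\<Sum>i\<le>degree p. coeff p i * (t ^ i * of_real (w t))))
        = (\<Sum>i\<le>degree p. LINT t|circle_measure. coeff p i * (t ^ i * of_real (w t)))"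
      by (intro Bochner_Integration.integral_sum i)
    also have "\<dots> = 0"
      by (simp only: integral_mult_right_zero z) simp
    finally show ?thesis by simp
  qed
  have cont: "(LINT t|circle_measure. \<phi> t * w t) = 0" if \<phi>: "continuous_on unit_circle \<phi>" for \<phi>
  proof -
    have "\<bar>LINT t|circle_measure. \<phi> t * w t\<bar> \<le> 0"
    proof (rule field_le_epsilon)
      fix e :: real assume e: "e > 0"
      define I where "I = (LINT t|circle_measure. \<bar>w t\<bar>)"
      have I: "0 \<le> I" by (simp add: I_def)
      define d where "d = e / (I + 1)"
      have d: "d > 0" "d * I \<le> e" using e I by (auto simp: d_def divide_simps)
      obtain p :: "complex poly" where p: "\<And>t. t \<in> unit_circle \<Longrightarrow> \<bar>\<phi> t - Re (poly p t)\<bar> < d"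
        using trigonometric_approximation[OF \<phi> d(1)] by blast
      have bdd: "\<exists>B. \<forall>t\<in>unit_circle. \<bar>f t\<bar> \<le> B" if "continuous_on unit_circle f" for f :: "complex \<Rightarrow> real"
        using compact_imp_bounded[OF compact_continuous_image[OF that compact_sphere]]
        unfolding bounded_iff by (metis imageI real_norm_def)
      have int: "integrable circle_measure (\<lambda>t. f t * w t)" if "continuous_on unit_circle f" for f
        using int_mult[OF measurable_circle_continuous[OF that]] bdd[OF that] by blast
      have c: "continuous_on unit_circle (\<lambda>t. Re (poly p t))" by (intro continuous_intros)
      have "(LINT t|circle_measure. \<phi> t * w t)
          = (LINT t|circle_measure. \<phi> t * w t) - (LINT t|circle_measure. Re (poly p t) * w t)"
        by (simp add: poly)
      also have "\<dots> = (LINT t|circle_measure. \<phi> t * w t - Re (poly p t) * w t)"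
        by (intro Bochner_Integration.integral_diff[symmetric] int \<phi> c)
      finally have eq: "(LINT t|circle_measure. \<phi> t * w t)
          = (LINT t|circle_measure. \<phi> t * w t - Re (poly p t) * w t)" .
      have "\<bar>LINT t|circle_measure. \<phi> t * w t\<bar> \<le> (LINT t|circle_measure. d * \<bar>w t\<bar>)"
        unfolding eq
      proof (rule integral_abs_bound[THEN order_trans], rule integral_mono)
        fix t assume "t \<in> space circle_measure"
        then have "\<bar>\<phi> t - Re (poly p t)\<bar> * \<bar>w t\<bar> \<le> d * \<bar>w t\<bar>"
          using p[of t] by (intro mult_right_mono) auto
        then show "\<bar>\<phi> t * w t - Re (poly p t) * w t\<bar> \<le> d * \<bar>w t\<bar>"
          by (simp only: abs_mult[symmetric] left_diff_distrib)
      qed (use int[OF \<phi>] int[OF c] w in auto)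
      also have "\<dots> = d * I" by (simp add: I_def)
      finally show "\<bar>LINT t|circle_measure. \<phi> t * w t\<bar> \<le> 0 + e" using d by simp
    qed
    then show ?thesis by simp
  qed
  have opn: "(LINT t|circle_measure. indicator U t * w t) = 0" if U: "open U" for U
  proof (cases "U = UNIV")
    case True
    then show ?thesis using cont[of "\<lambda>_. 1"] by simp
  next
    case False
    \<comment> \<open>Continuous functions increasing to the indicator of \<open>U\<close>. The case
      \<open>U = UNIV\<close> is treated apart because \<open>infdist\<close> to the empty set is
      0.\<close>
    define f where "f n t = min 1 (real n * infdist t (- U))" for n t
    have fc: "continuous_on A (f n)" for n A
      unfolding f_def by (intro continuous_intros)
    have "(\<lambda>n. LINT t|circle_measure. f n t * w t) \<longlonglongrightarrow> (LINT t|circle_measure. indicator U t * w t)"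
    proof (rule integral_dominated_convergence[where w = "\<lambda>t. \<bar>w t\<bar>"])
      show "(\<lambda>t. f n t * w t) \<in> borel_measurable circle_measure" for n
        by (intro borel_measurable_times measurable_circle_continuous[OF fc]) measurable
      have [measurable]: "U \<in> sets borel" using U by auto
      show "(\<lambda>t. indicator U t * w t) \<in> borel_measurable circle_measure" by measurable
      show "AE t in circle_measure. norm (f n t * w t) \<le> \<bar>w t\<bar>" for n
        by (intro AE_I2) (auto simp: f_def abs_mult infdist_nonneg intro!: mult_left_le_one_le)
      show "AE t in circle_measure. (\<lambda>n. f n t * w t) \<longlonglongrightarrow> indicator U t * w t"
      proof (intro AE_I2 tendsto_mult tendsto_const)
        fix t
        show "(\<lambda>n. f n t) \<longlonglongrightarrow> indicator U t"
        proof (cases "t \<in> U")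
          case True
          have "closed (- U)" using U by auto
          then have "infdist t (- U) \<noteq> 0"
            using True False in_closed_iff_infdist_zero[of "- U" t] by auto
          then have pos: "infdist t (- U) > 0" using infdist_nonneg[of t "- U"] by linarith
          obtain n0 :: nat where n0: "1 / infdist t (- U) < n0" using reals_Archimedean2 by blast
          have "f n t = 1" if "n \<ge> n0" for n
          proof -
            have "1 / infdist t (- U) < n" using n0 that by linarith
            then show ?thesis using pos by (simp add: f_def field_simps)
          qed
          then have "\<forall>\<^sub>F n in sequentially. f n t = indicator U t"
            using True by (auto simp: eventually_sequentially)
          then show ?thesis by (rule tendsto_eventually)
        qed (auto simp: f_def)
      qed
    qed (use w in auto)
    moreover have "(LINT t|circle_measure. f n t * w t) = 0" for n
      by (rule cont[OF fc])
    ultimately show ?thesis using LIMSEQ_unique by (simp add: LIMSEQ_const_iff)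
  qed
  have ind: "integrable circle_measure (\<lambda>t. indicator A t * w t)" if "A \<in> sets borel" for A
  proof -
    have [measurable]: "A \<in> sets borel" by fact
    show ?thesis by (rule int_mult[where B = 1]) (auto simp: indicator_def)
  qed
  have all: "(LINT t|circle_measure. indicator A t * w t) = 0" if "A \<in> sets borel" for A
  proof -
    have "Int_stable {S :: complex set. open S}" "{S :: complex set. open S} \<subseteq> Pow UNIV"
      "A \<in> sigma_sets UNIV {S :: complex set. open S}"
      using that by (auto simp: borel_def Int_stable_def)
    then show ?thesis
    proof (induction rule: sigma_sets_induct_disjoint)
      case (basic A)
      then show ?case using opn by auto
    next
      case (compl A)
      then have A: "A \<in> sets borel" by (simp add: borel_def)
      have "(LINT t|circle_measure. indicator (UNIV - A) t * w t)
          = (LINT t|circle_measure. w t - indicator A t * w t)"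
        by (intro Bochner_Integration.integral_cong) (auto simp: indicator_def)
      also have "\<dots> = 0"
        using compl w ind[OF A] opn[of UNIV] by simp
      finally show ?case .
    next
      case (union A)
      then have A: "A i \<in> sets borel" for i by (auto simp: borel_def)
      have m: "A i \<inter> unit_circle \<in> sets circle_measure" for i
        using A by (auto simp: sets_circle_measure sets_restrict_space)
      have eq: "(LINT t|circle_measure. indicator B t * w t) = (LINT t:(B \<inter> unit_circle)|circle_measure. w t)" for B
        unfolding set_lebesgue_integral_def
        by (intro Bochner_Integration.integral_cong) (auto simp: indicator_def)
      have "(LINT t:(\<Union>i. A i \<inter> unit_circle)|circle_measure. w t)
          = (\<Sum>i. LINT t:(A i \<inter> unit_circle)|circle_measure. w t)"
      proof (rule lebesgue_integral_countable_add)
        show "A i \<inter> unit_circle \<inter> (A j \<inter> unit_circle) = {}" if "i \<noteq> j" for i j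
          using union(1) that by (auto simp: disjoint_family_on_def)
        show "set_integrable circle_measure (\<Union>i. A i \<inter> unit_circle) w"
          unfolding set_integrable_def
          by (intro integrable_mult_indicator w sets.countable_UN) (use m in blast)
      qed (rule m)
      then show ?case
        using union(3) unfolding eq by (simp add: UN_extend_simps del: UN_simps)
    qed (auto)
  qed
  have "AE t in circle_measure. w t = 0"
  proof (rule density_unique_real[OF w])
    fix A assume "A \<in> sets circle_measure"
    then obtain B where B: "A = B \<inter> unit_circle" "B \<in> sets borel"
      by (auto simp: sets_circle_measure sets_restrict_space)
    have "(LINT t:A|circle_measure. w t) = (LINT t|circle_measure. indicator B t * w t)"
      unfolding set_lebesgue_integral_def B(1)
      by (intro Bochner_Integration.integral_cong) (auto simp: indicator_def)
    then show "(LINT t:A|circle_measure. w t) = (LINT t:A|circle_measure. 0)"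
      by (simp add: all[OF B(2)])
  qed auto
  then show ?thesis .
qed

section \<open>A weak type inequality for radial maximal functions\<close>

text \<open>The constant is 2 * 4. Numerators: 1 - \<rho>^2 \<le> 1 - r^4 \<le> 2 (1 - r^2).
  Denominators: |v - r| \<le> |v - \<rho>| + (r - \<rho>) \<le> 2 |v - \<rho>|, and this is
  squared.\<close>

lemma poisson_kernel_compare:
  assumes v: "cmod v = 1" and r: "0 \<le> r" "r < 1" and \<rho>: "r\<^sup>2 \<le> \<rho>" "\<rho> \<le> r"
  shows "poisson_kernel (of_real \<rho>) v \<le> 8 * poisson_kernel (of_real r) v"
proof -
  have \<rho>0: "0 \<le> \<rho>" "\<rho> < 1" using r \<rho> zero_le_power2[of r] by linarith+
  have a: "1 - \<rho> \<le> cmod (v - of_real \<rho>)"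
    using v norm_triangle_ineq2[of v "of_real \<rho>"] \<rho>0 by simp
  have "cmod (v - of_real r) \<le> cmod (v - of_real \<rho>) + cmod (of_real (r - \<rho>))"
    using norm_triangle_ineq4[of "v - of_real \<rho>" "of_real (r - \<rho>)"] by (simp add: algebra_simps)
  also have "cmod (of_real (r - \<rho>)) = r - \<rho>" unfolding norm_of_real using \<rho> by simp
  finally have b: "cmod (v - of_real r) \<le> 2 * cmod (v - of_real \<rho>)" using a r by linarith
  have "1 - r \<le> cmod (v - of_real r)"
    using v norm_triangle_ineq2[of v "of_real r"] r by simp
  then have c: "0 < cmod (v - of_real r)" using r by linarith
  have "r\<^sup>2 * r\<^sup>2 \<le> \<rho> * \<rho>" using \<rho> \<rho>0 by (intro mult_mono) auto
  moreover have "(1 - r\<^sup>2) * (1 + r\<^sup>2) \<le> (1 - r\<^sup>2) * 2"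
    using r by (intro mult_left_mono) (auto simp: abs_square_le_1)
  ultimately have d: "1 - \<rho>\<^sup>2 \<le> 2 * (1 - r\<^sup>2)" by (simp add: power2_eq_square algebra_simps)
  have "poisson_kernel (of_real \<rho>) v = (1 - \<rho>\<^sup>2) / (cmod (v - of_real \<rho>))\<^sup>2"
    using \<rho>0 by (subst poisson_kernel_eq[OF v]) auto
  also have "\<dots> \<le> (2 * (1 - r\<^sup>2)) / (cmod (v - of_real r) / 2)\<^sup>2"
    using d b c r by (intro frac_le power_mono) (auto simp: abs_square_le_1)
  also have "\<dots> = 8 * poisson_kernel (of_real r) v"
    using r by (subst poisson_kernel_eq[OF v]) (auto simp: power_divide)
  finally show ?thesis .
qed

lemma poisson_kernel_rotate:
  assumes "cmod t = 1"
  shows "poisson_kernel (of_real r * t) s = poisson_kernel (of_real r) (cnj t * s)"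
proof -
  have "t * cnj t = 1" using assms by (simp add: complex_norm_square[symmetric])
  then have e: "t * (cnj t * s + w) = s + w * t" "t * (cnj t * s - w) = s - w * t" for w
    by (simp_all add: distrib_left right_diff_distrib mult.assoc[symmetric] mult.commute[of w])
  have "t \<noteq> 0" using assms by auto
  then have "(cnj t * s + of_real r) / (cnj t * s - of_real r)
      = (t * (cnj t * s + of_real r)) / (t * (cnj t * s - of_real r))"
    by simp
  then show ?thesis unfolding poisson_kernel_def e by simp
qed

lemma poisson_kernel_cnj: "poisson_kernel (of_real r) (cnj v) = poisson_kernel (of_real r) v"
proof -
  have "(cnj v + of_real r) / (cnj v - of_real r) = cnj ((v + of_real r) / (v - of_real r))" by simp
  then show ?thesis unfolding poisson_kernel_def by (simp only: cnj.sel)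
qed

lemma poisson_kernel_commute:
  assumes "cmod s = 1" "cmod t = 1"
  shows "poisson_kernel (of_real r * t) s = poisson_kernel (of_real r * s) t"
  unfolding poisson_kernel_rotate[OF assms(1)] poisson_kernel_rotate[OF assms(2)]
  using poisson_kernel_cnj[of r "cnj t * s"] by (simp add: mult.commute)

text \<open>The semigroup law of the Poisson kernels. On the circle the kernel with parameter
  \<open>a\<close> is the real part of \<open>F\<close>, which is holomorphic in the disc and
  continuous up to the circle, so the Poisson formula evaluates the integral as the real part of
  \<open>F b\<close>.\<close>

lemma poisson_kernel_product_integral:
  assumes t: "cmod t = 1" "cmod t' = 1" and r: "0 \<le> r" "r < 1" "0 \<le> r'" "r' < 1"
  shows "(LINT s|circle_measure. poisson_kernel (of_real r * t) s * poisson_kernel (of_real r' * t') s)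
      = poisson_kernel (of_real (r * r')) (cnj t * t')"
proof -
  define a b where "a = of_real r * t" and "b = of_real r' * t'"
  have a: "cmod a < 1" "cmod b < 1" using assms by (auto simp: a_def b_def norm_mult)
  define F where "F s = (1 + cnj a * s) / (1 - cnj a * s)" for s
  have nz: "1 - cnj a * s \<noteq> 0" if "cmod s \<le> 1" for s
  proof -
    have "cmod (cnj a * s) < 1"
      using a(1) that by (simp add: norm_mult) (metis mult_left_le norm_ge_zero order_le_less_trans)
    then show ?thesis by auto
  qed
  have F: "continuous_on (cball 0 1) F" "F holomorphic_on ball 0 1"
    unfolding F_def using nz by (auto intro!: continuous_intros holomorphic_intros)
  have ct: "cnj t = 1 / t" "t \<noteq> 0"
  proof -
    have "t * cnj t = 1" using t by (simp add: complex_norm_square[symmetric])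
    moreover show "t \<noteq> 0" using t by auto
    ultimately show "cnj t = 1 / t" by (simp add: field_simps)
  qed
  have eq: "poisson_kernel a s = Re (F s)" if s: "cmod s = 1" for s
  proof -
    have "s * cnj s = 1" using s by (simp add: complex_norm_square[symmetric])
    moreover have "s \<noteq> 0" using s by auto
    ultimately have cs: "s = 1 / cnj s" "cnj s \<noteq> 0" by (auto simp: field_simps)
    have 1: "F s = (cnj s * (1 + cnj a * s)) / (cnj s * (1 - cnj a * s))"
      unfolding F_def using cs(2) by (metis mult_divide_mult_cancel_left)
    have "cnj s * (cnj a * s) = cnj a"
      using \<open>s * cnj s = 1\<close> by (simp add: mult.left_commute mult.commute[of _ s])
    then have "cnj s * (1 + cnj a * s) = cnj s + cnj a" "cnj s * (1 - cnj a * s) = cnj s - cnj a"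
      by (simp_all add: distrib_left right_diff_distrib)
    then have "(cnj s * (1 + cnj a * s)) / (cnj s * (1 - cnj a * s)) = cnj ((s + a) / (s - a))"
      by simp
    then show ?thesis unfolding 1 poisson_kernel_def by (simp only: cnj.sel)
  qed
  have "(LINT s|circle_measure. poisson_kernel a s * poisson_kernel b s)
      = (LINT s|circle_measure. poisson_kernel b s * Re (F s))"
    by (intro Bochner_Integration.integral_cong refl) (simp add: eq mult.commute)
  also have "\<dots> = Re (F b)" by (rule poisson_formula_Re[OF F a(2)])
  also have "F b = (1 + of_real (r * r') * (cnj t * t')) / (1 - of_real (r * r') * (cnj t * t'))"
    unfolding F_def a_def b_def by (simp add: algebra_simps)
  also have "Re \<dots> = poisson_kernel (of_real (r * r')) (cnj t * t')"
  proof -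
    define v where "v = cnj t * t'"
    have "cmod v = 1" using t by (simp add: v_def norm_mult)
    then have "v * cnj v = 1" "cnj v \<noteq> 0" by (auto simp: complex_norm_square[symmetric])
    then have "(1 + of_real (r * r') * v) / (1 - of_real (r * r') * v)
        = (cnj v * (1 + of_real (r * r') * v)) / (cnj v * (1 - of_real (r * r') * v))"
      by (metis mult_divide_mult_cancel_left)
    also have "cnj v * (1 + of_real (r * r') * v) = cnj (v + of_real (r * r'))"
      using \<open>v * cnj v = 1\<close> by (simp add: distrib_left mult.left_commute mult.commute[of _ v])
    also have "cnj v * (1 - of_real (r * r') * v) = cnj (v - of_real (r * r'))"
      using \<open>v * cnj v = 1\<close> by (simp add: right_diff_distrib mult.left_commute mult.commute[of _ v])
    also have "cnj (v + of_real (r * r')) / cnj (v - of_real (r * r'))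
        = cnj ((v + of_real (r * r')) / (v - of_real (r * r')))" by simp
    finally show ?thesis unfolding v_def[symmetric] poisson_kernel_def by (simp only: cnj.sel)
  qed
  finally show ?thesis unfolding a_def b_def .
qed

text \<open>The composition \<open>r r'\<close> of two radii is at least the square of the smaller one, so up to a
  constant the kernel of \<open>T T\<^sup>*\<close>, for a linearised radial maximal operator \<open>T\<close>, is
  dominated by the kernels of \<open>T\<close> and \<open>T\<^sup>*\<close>. Tested on a set this yields the weak type
  inequality below without any covering argument.\<close>

lemma poisson_kernel_product_integral_le:
  assumes t: "cmod t = 1" "cmod t' = 1" and r: "0 \<le> r" "r < 1" "0 \<le> r'" "r' < 1"
  shows "(LINT s|circle_measure. poisson_kernel (of_real r * t) s * poisson_kernel (of_real r' * t') s)
      \<le> 8 * (poisson_kernel (of_real r * t) t' + poisson_kernel (of_real r' * t') t)"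
proof -
  define v where "v = cnj t * t'"
  have v: "cmod v = 1" using t by (simp add: v_def norm_mult)
  have e: "poisson_kernel (of_real r * t) t' = poisson_kernel (of_real r) v"
    "poisson_kernel (of_real r' * t') t = poisson_kernel (of_real r') v"
    using poisson_kernel_rotate[OF t(1)] poisson_kernel_rotate[OF t(2)] poisson_kernel_commute[OF t] by (auto simp: v_def)
  have pos: "0 < poisson_kernel (of_real r) v" "0 < poisson_kernel (of_real r') v"
    using r by (auto intro!: poisson_kernel_bounds(3) v)
  have "poisson_kernel (of_real (r * r')) v
      \<le> 8 * (poisson_kernel (of_real r) v + poisson_kernel (of_real r') v)"
  proof (cases "r \<le> r'")
    case True
    have "poisson_kernel (of_real (r * r')) v \<le> 8 * poisson_kernel (of_real r) v"
      using r True by (intro poisson_kernel_compare v) (auto simp: power2_eq_square mult_left_mono mult_left_le)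
    then show ?thesis using pos by simp
  next
    case False
    have "poisson_kernel (of_real (r * r')) v \<le> 8 * poisson_kernel (of_real r') v"
      using r False by (intro poisson_kernel_compare v) (auto simp: power2_eq_square mult_right_mono mult_left_le_one_le)
    then show ?thesis using pos by simp
  qed
  then show ?thesis
    unfolding poisson_kernel_product_integral[OF assms] e v_def .
qed

interpretation circle2: pair_prob_space circle_measure circle_measure ..

lemma circle_Fubini:
  fixes f :: "complex \<Rightarrow> complex \<Rightarrow> real"
  assumes f: "(\<lambda>(x, y). f x y) \<in> borel_measurable (circle_measure \<Otimes>\<^sub>M circle_measure)"
    and bd: "\<And>x y. x \<in> unit_circle \<Longrightarrow> y \<in> unit_circle \<Longrightarrow> \<bar>f x y\<bar> \<le> B"
  shows "(LINT x|circle_measure. LINT y|circle_measure. f x y)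
       = (LINT y|circle_measure. LINT x|circle_measure. f x y)"
proof -
  have "integrable (circle_measure \<Otimes>\<^sub>M circle_measure) (\<lambda>(x, y). f x y)"
    using f bd by (intro circle2.integrable_const_bound[of _ B] AE_I2) (auto simp: space_pair_measure)
  then show ?thesis by (rule circle2.Fubini_integral[symmetric])
qed

text \<open>A function that is not integrable has integral 0 by convention; there the estimate rests
  on \<open>0 \<le> c\<close>.\<close>

lemma abs_circle_integral_le:
  fixes f :: "complex \<Rightarrow> real"
  assumes "\<And>t. t \<in> unit_circle \<Longrightarrow> \<bar>f t\<bar> \<le> c" "0 \<le> c"
  shows "\<bar>LINT t|circle_measure. f t\<bar> \<le> c"
proof (cases "integrable circle_measure f")
  case True
  then have "(LINT t|circle_measure. \<bar>f t\<bar>) \<le> (LINT t|circle_measure. c)"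
    using assms by (intro integral_mono) auto
  then show ?thesis
    by (intro order_trans[OF integral_abs_bound, of circle_measure f c]) simp
qed (use assms in \<open>simp add: not_integrable_integral_eq\<close>)

text \<open>Selecting one radius \<open>r t\<close> for each boundary point makes the maximal
  operator linear, with kernel \<open>K\<close> once it is restricted to \<open>S\<close>;
  \<open>K0\<close> is the adjoint applied to the constant 1. The bound \<open>q\<close> keeps the
  radii away from 1 and hence all kernels bounded, which justifies every interchange of
  integrals.\<close>

lemma poisson_maximal_weak:
  assumes S[measurable]: "S \<in> sets circle_measure"
    and r[measurable]: "r \<in> borel_measurable circle_measure"
    and rq: "\<And>t. t \<in> unit_circle \<Longrightarrow> 0 \<le> r t \<and> r t \<le> q" and q: "q < 1"
    and g[measurable]: "g \<in> borel_measurable circle_measure"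
    and gB: "\<And>t. t \<in> unit_circle \<Longrightarrow> 0 \<le> g t \<and> g t \<le> B" and lam: "lam > 0"
    and le: "\<And>t. t \<in> S \<Longrightarrow> lam \<le> (LINT s|circle_measure. poisson_kernel (of_real (r t) * t) s * g s)"
  shows "lam\<^sup>2 * measure circle_measure S \<le> 16 * (LINT s|circle_measure. (g s)\<^sup>2)"
proof -
  let ?M = circle_measure
  define K where "K t s = indicator S t * poisson_kernel (of_real (r t) * t) s" for t s
  define K0 where "K0 s = (LINT t|?M. K t s)" for s
  define C where "C = 2 / (1 - q)"
  have q0: "0 \<le> q" using rq[of 1] by auto
  have lt1: "cmod (of_real (r t) * t) < 1" if "t \<in> unit_circle" for t
    using rq[OF that] that q by (simp add: norm_mult)
  have K0': "0 \<le> K t s" if "t \<in> unit_circle" "s \<in> unit_circle" for t s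
    using poisson_kernel_bounds(3)[OF _ lt1[OF that(1)], of s] that by (simp add: K_def)
  have KC: "K t s \<le> C" if "t \<in> unit_circle" "s \<in> unit_circle" for t s
  proof -
    have n: "cmod (of_real (r t) * t) = r t" using rq[OF that(1)] that by (simp add: norm_mult)
    have "K t s \<le> poisson_kernel (of_real (r t) * t) s"
      using poisson_kernel_bounds(3)[OF _ lt1[OF that(1)], of s] that by (simp add: K_def indicator_def)
    also have "\<dots> \<le> (1 + r t) / (1 - r t)"
      using poisson_kernel_bounds(2)[OF _ lt1[OF that(1)], of s] that unfolding n by simp
    also have "\<dots> \<le> C" unfolding C_def using rq[OF that(1)] q by (intro frac_le) auto
    finally show ?thesis .
  qed
  have C0: "0 \<le> C" using q by (simp add: C_def)
  have Km[measurable]: "(\<lambda>x. K (f x) (h x)) \<in> borel_measurable N"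
    if [measurable]: "f \<in> N \<rightarrow>\<^sub>M ?M" "h \<in> N \<rightarrow>\<^sub>M ?M" for f h N
    unfolding K_def by measurable
  have [measurable]: "K0 \<in> borel_measurable ?M"
    unfolding K0_def by measurable
  have K0b: "0 \<le> K0 s \<and> K0 s \<le> C" if "s \<in> unit_circle" for s
  proof
    show "0 \<le> K0 s" unfolding K0_def using that K0' by (intro integral_nonneg_AE AE_I2) auto
    have "K0 s \<le> (LINT t|?M. C)" unfolding K0_def
    proof (rule integral_mono)
      show "integrable ?M (\<lambda>t. K t s)"
        using that K0' KC by (intro circle.integrable_const_bound[of _ C] AE_I2) auto
    qed (use that KC in auto)
    then show "K0 s \<le> C" by simp
  qed
  define m where "m = measure ?M S"
  have intK: "(LINT s|?M. K t s) = indicator S t" if "t \<in> unit_circle" for t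
    unfolding K_def by (simp add: poisson_kernel_integral[OF lt1[OF that]])
  have "S \<inter> unit_circle = S" using sets.sets_into_space[OF S] by auto
  then have Sm: "(LINT t|?M. indicator S t) = m"
    by (simp add: m_def)
  have swapS: "(LINT t|?M. LINT t'|?M. K t t') = m"
  proof -
    have "(LINT t|?M. LINT t'|?M. K t t') = (LINT t|?M. indicator S t)"
      by (intro Bochner_Integration.integral_cong refl intK) simp
    then show ?thesis using Sm by simp
  qed
  have bdd: "\<bar>K t s\<bar> \<le> C" if "t \<in> unit_circle" "s \<in> unit_circle" for t s
    using K0'[OF that] KC[OF that] by simp
  \<comment> \<open>Expanding the square gives a double integral over two boundary points of a
    product of Poisson kernels, and that product integral is dominated by a sum of two single
    kernels with factor 8. Each of the two has total mass \<open>m\<close>, since Poisson kernels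
    have integral 1; hence 8 + 8.\<close>
  have two: "(LINT s|?M. (K0 s)\<^sup>2) \<le> 16 * m"
  proof -
    have "(LINT s|?M. (K0 s)\<^sup>2) = (LINT s|?M. LINT t|?M. K t s * K0 s)"
      by (intro Bochner_Integration.integral_cong refl)
         (simp add: K0_def power2_eq_square)
    also have "\<dots> = (LINT t|?M. LINT s|?M. K t s * K0 s)"
    proof (rule circle_Fubini)
      show "\<bar>K y x * K0 x\<bar> \<le> C * C" if "x \<in> unit_circle" "y \<in> unit_circle" for x y
        unfolding abs_mult using bdd that K0b[OF that(1)] C0 by (intro mult_mono) auto
    qed measurable
    also have "\<dots> = (LINT t|?M. LINT t'|?M. LINT s|?M. K t s * K t' s)"
    proof (rule Bochner_Integration.integral_cong[OF refl])
      fix t assume "t \<in> space ?M"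
      then have t: "t \<in> unit_circle" by simp
      then have [measurable]: "t \<in> space ?M" by simp
      have "(LINT s|?M. K t s * K0 s) = (LINT s|?M. LINT t'|?M. K t s * K t' s)"
        by (intro Bochner_Integration.integral_cong refl) (simp add: K0_def)
      also have "\<dots> = (LINT t'|?M. LINT s|?M. K t s * K t' s)"
      proof (rule circle_Fubini)
        show "\<bar>K t x * K y x\<bar> \<le> C * C" if "x \<in> unit_circle" "y \<in> unit_circle" for x y
          unfolding abs_mult using bdd that t C0 by (intro mult_mono) auto
      qed measurable
      finally show "(LINT s|?M. K t s * K0 s) = (LINT t'|?M. LINT s|?M. K t s * K t' s)" .
    qed
    also have "\<dots> \<le> (LINT t|?M. LINT t'|?M. 8 * K t t' + 8 * K t' t)"
    proof (rule integral_mono)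
      have b: "\<bar>LINT s|?M. K t s * K t' s\<bar> \<le> C * C" if "t \<in> unit_circle" "t' \<in> unit_circle" for t t'
        using bdd that C0 unfolding atLeastAtMost_iff
        by (intro abs_circle_integral_le) (auto simp: abs_mult intro!: mult_mono)
      have i1: "integrable ?M (\<lambda>t'. LINT s|?M. K t s * K t' s)" if "t \<in> unit_circle" for t
      proof -
        have [measurable]: "t \<in> space ?M" using that by auto
        show ?thesis
          using b[OF that] by (intro circle.integrable_const_bound[of _ "C * C"] AE_I2) auto
      qed
      show "integrable ?M (\<lambda>t. LINT t'|?M. LINT s|?M. K t s * K t' s)"
      proof (intro circle.integrable_const_bound[of _ "C * C"] AE_I2)
        fix t assume "t \<in> space ?M"
        then have "\<bar>LINT t'|?M. LINT s|?M. K t s * K t' s\<bar> \<le> C * C"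
          using b C0 by (intro abs_circle_integral_le[of "\<lambda>t'. LINT s|?M. K t s * K t' s"]) auto
        then show "norm (LINT t'|?M. LINT s|?M. K t s * K t' s) \<le> C * C" by simp
      qed measurable
      have b2: "\<bar>8 * K t t' + 8 * K t' t\<bar> \<le> 16 * C" if "t \<in> unit_circle" "t' \<in> unit_circle" for t t'
        using bdd[OF that] bdd[OF that(2,1)] by linarith
      show "integrable ?M (\<lambda>t. LINT t'|?M. 8 * K t t' + 8 * K t' t)"
        using b2 C0 by (intro circle.integrable_const_bound[of _ "16 * C"] AE_I2) (auto intro!: abs_circle_integral_le)
      fix t assume "t \<in> space ?M"
      then have t: "t \<in> unit_circle" and [measurable]: "t \<in> space ?M" by auto
      show "(LINT t'|?M. LINT s|?M. K t s * K t' s) \<le> (LINT t'|?M. 8 * K t t' + 8 * K t' t)"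
      proof (rule integral_mono)
        show "integrable ?M (\<lambda>t'. 8 * K t t' + 8 * K t' t)"
          using b2[OF t] by (intro circle.integrable_const_bound[of _ "16 * C"] AE_I2) auto
        fix t' assume "t' \<in> space ?M"
        then have t': "t' \<in> unit_circle" by simp
        have "(LINT s|?M. K t s * K t' s) = indicator S t * indicator S t' *
          (LINT s|?M. poisson_kernel (of_real (r t) * t) s * poisson_kernel (of_real (r t') * t') s)"
          unfolding K_def by (simp add: mult_ac flip: integral_mult_right_zero)
        also have "\<dots> \<le> indicator S t * indicator S t' *
            (8 * (poisson_kernel (of_real (r t) * t) t' + poisson_kernel (of_real (r t') * t') t))"
          using t t' rq[OF t] rq[OF t'] q
          by (intro mult_left_mono poisson_kernel_product_integral_le) auto
        also have "\<dots> = indicator S t' * (8 * K t t') + indicator S t * (8 * K t' t)"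
          by (simp add: K_def algebra_simps)
        also have "\<dots> \<le> 8 * K t t' + 8 * K t' t"
          using K0'[OF t t'] K0'[OF t' t] by (auto simp: indicator_def)
        finally show "(LINT s|?M. K t s * K t' s) \<le> 8 * K t t' + 8 * K t' t" .
      qed (rule i1[OF t])
    qed
    also have "\<dots> = (LINT t|?M. 8 * (LINT t'|?M. K t t') + 8 * (LINT t'|?M. K t' t))"
    proof (intro Bochner_Integration.integral_cong refl)
      fix t assume "t \<in> space ?M"
      then have t: "t \<in> unit_circle" and [measurable]: "t \<in> space ?M" by auto
      have "integrable ?M (\<lambda>t'. K t t')" "integrable ?M (\<lambda>t'. K t' t)"
        using bdd t by (auto intro!: circle.integrable_const_bound[of _ C] AE_I2)
      then show "(LINT t'|?M. 8 * K t t' + 8 * K t' t) = 8 * (LINT t'|?M. K t t') + 8 * (LINT t'|?M. K t' t)"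
        by simp
    qed
    also have "\<dots> = 8 * (LINT t|?M. LINT t'|?M. K t t') + 8 * (LINT t|?M. K0 t)"
    proof -
      have i: "integrable ?M (\<lambda>t. LINT t'|?M. K t t')"
        using bdd intK by (intro circle.integrable_const_bound[of _ 1] AE_I2) (auto simp: indicator_def)
      have "integrable ?M K0"
        using K0b by (intro circle.integrable_const_bound[of _ C] AE_I2) auto
      with i show ?thesis unfolding K0_def by simp
    qed
    also have "(LINT t|?M. K0 t) = (LINT t|?M. LINT t'|?M. K t t')"
      unfolding K0_def by (rule circle_Fubini[where B = C]) (use bdd in \<open>auto\<close>)
    finally show ?thesis by (simp add: swapS)
  qed
  have "lam * m = (LINT t|?M. indicator S t * lam)" using Sm by simp
  also have "\<dots> \<le> (LINT t|?M. LINT s|?M. K t s * g s)"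
  proof (rule integral_mono)
    have [simp]: "0 \<le> B" using gB[of 1] by auto
    have "\<bar>LINT s|?M. K t s * g s\<bar> \<le> C * B" if "t \<in> unit_circle" for t
    proof -
      have [measurable]: "t \<in> space ?M" using that by auto
      have bb: "\<bar>K t s * g s\<bar> \<le> C * B" if "s \<in> unit_circle" for s
        unfolding abs_mult using bdd[OF \<open>t \<in> unit_circle\<close> that] gB[OF that] C0 by (intro mult_mono) auto
      show ?thesis using bb C0 by (intro abs_circle_integral_le) auto
    qed
    then show "integrable ?M (\<lambda>t. LINT s|?M. K t s * g s)"
      by (intro circle.integrable_const_bound[of _ "C * B"] AE_I2) auto
    show "integrable ?M (\<lambda>t. indicator S t * lam)"
      by (intro circle.integrable_const_bound[of _ "\<bar>lam\<bar>"] AE_I2) (auto simp: indicator_def)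
    show "indicator S t * lam \<le> (LINT s|?M. K t s * g s)" if "t \<in> space ?M" for t
      using le[of t] by (auto simp: K_def indicator_def)
  qed
  also have "\<dots> = (LINT s|?M. LINT t|?M. K t s * g s)"
  proof (rule circle_Fubini)
    show "\<bar>K x y * g y\<bar> \<le> C * B" if "x \<in> unit_circle" "y \<in> unit_circle" for x y
      unfolding abs_mult using bdd[OF that] gB[OF that(2)] C0 by (intro mult_mono) auto
  qed measurable
  also have "\<dots> = (LINT s|?M. K0 s * g s)"
    unfolding K0_def by simp
  \<comment> \<open>Young's inequality, the product of the weights being 1/4. The weight lam / 32
    turns the bound 16 * m into lam * m / 2, which is absorbed by the left-hand side.\<close>
  also have "\<dots> \<le> (LINT s|?M. 8 / lam * (g s)\<^sup>2 + lam / 32 * (K0 s)\<^sup>2)"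
  proof (rule integral_mono)
    have "\<bar>K0 s * g s\<bar> \<le> C * B" if "s \<in> unit_circle" for s
      unfolding abs_mult using K0b[OF that] gB[OF that] C0 by (intro mult_mono) auto
    then show "integrable ?M (\<lambda>s. K0 s * g s)"
      by (intro circle.integrable_const_bound[of _ "C * B"] AE_I2) auto
    show "integrable ?M (\<lambda>s. 8 / lam * (g s)\<^sup>2 + lam / 32 * (K0 s)\<^sup>2)"
      using gB K0b by (intro Bochner_Integration.integrable_add integrable_mult_right
        circle.integrable_const_bound[of _ "B\<^sup>2"] circle.integrable_const_bound[of _ "C\<^sup>2"] AE_I2)
        (auto intro!: power_mono)
    show "K0 s * g s \<le> 8 / lam * (g s)\<^sup>2 + lam / 32 * (K0 s)\<^sup>2" for s
    proof -
      have "0 \<le> (16 * g s - lam * K0 s)\<^sup>2 / (32 * lam)" using lam by simp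
      also have "\<dots> = 8 / lam * (g s)\<^sup>2 + lam / 32 * (K0 s)\<^sup>2 - K0 s * g s"
        using lam by (simp add: power2_eq_square field_simps)
      finally show ?thesis by simp
    qed
  qed
  also have "\<dots> = 8 / lam * (LINT s|?M. (g s)\<^sup>2) + lam / 32 * (LINT s|?M. (K0 s)\<^sup>2)"
  proof -
    have "integrable ?M (\<lambda>s. (g s)\<^sup>2)"
      using gB by (intro circle.integrable_const_bound[of _ "B\<^sup>2"] AE_I2) (auto intro!: power_mono)
    moreover have "integrable ?M (\<lambda>s. (K0 s)\<^sup>2)"
      using K0b by (intro circle.integrable_const_bound[of _ "C\<^sup>2"] AE_I2) (auto intro!: power_mono)
    ultimately show ?thesis by simp
  qed
  also have "\<dots> \<le> 8 / lam * (LINT s|?M. (g s)\<^sup>2) + lam / 32 * (16 * m)"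
    using two lam by (intro add_left_mono mult_left_mono) auto
  finally have "lam * (lam * m) \<le> lam * (8 / lam * (LINT s|?M. (g s)\<^sup>2) + lam / 32 * (16 * m))"
    using lam by (intro mult_left_mono) auto
  then show ?thesis
    using lam unfolding m_def[symmetric] by (simp add: power2_eq_square field_simps)
qed

section \<open>Fatou's theorem\<close>

text \<open>A sequence in [0, 1) starting at 0. It replaces the continuous limit r -> 1 wherever
  measurability or a convergence theorem asks for a sequence.\<close>

definition radius :: "nat \<Rightarrow> real" where
  "radius n = 1 - 1 / (real n + 1)"

lemma radius_bounds: "0 \<le> radius n" "radius n < 1"
  by (auto simp: radius_def field_simps)

lemma filterlim_radius: "filterlim radius (at_left 1) sequentially"
  unfolding radius_def by real_asymp

lemma radius_tendsto: "radius \<longlonglongrightarrow> 1"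
  unfolding radius_def by real_asymp

lemma measurable_dilation:
  assumes "f holomorphic_on ball 0 1" "0 \<le> r" "r < 1"
  shows "(\<lambda>t. f (of_real r * t)) \<in> borel_measurable circle_measure"
  by (intro measurable_circle_continuous continuous_on_subset[OF continuous_on_circle_dilation
        [OF holomorphic_on_imp_continuous_on[OF assms(1)] assms(2,3)]]) auto

lemma holomorphic_dilation:
  assumes f: "f holomorphic_on ball 0 1" and r: "0 \<le> r" "r < 1"
  shows "(\<lambda>z. f (of_real r * z)) holomorphic_on ball 0 1"
proof -
  have "(f \<circ> (\<lambda>s. of_real r * s)) holomorphic_on ball 0 1"
  proof (rule holomorphic_on_compose_gen[OF _ f])
    show "(\<lambda>s::complex. of_real r * s) ` ball 0 1 \<subseteq> ball 0 1"
    proof (rule image_subsetI)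
      fix s :: complex assume "s \<in> ball 0 1"
      then have "r * cmod s < 1 * 1" using r by (intro mult_strict_mono') auto
      then show "of_real r * s \<in> ball 0 1" using r by (simp add: norm_mult)
    qed
  qed (intro holomorphic_intros)
  then show ?thesis by (simp add: o_def)
qed

text \<open>By continuity along the radius, the supremum over all radii is one over rational radii,
  and the corresponding set is an increasing union over finitely many of them. For finitely many
  radii a measurable selection exists, and the linearised inequality applies with a constant
  independent of their number.\<close>

lemma radial_maximal_weak:
  fixes d :: "complex \<Rightarrow> complex"
  assumes d: "d holomorphic_on ball 0 1"
    and D: "\<And>R. 0 \<le> R \<Longrightarrow> R < 1 \<Longrightarrow> (LINT t|circle_measure. (cmod (d (of_real R * t)))\<^sup>2) \<le> D"
    and c: "c > 0"
  shows "{t \<in> unit_circle. \<exists>r\<in>{0..<1}. c < cmod (d (of_real r * t))} \<in> sets circle_measure" (is "?A \<in> _")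
    and "c\<^sup>2 * measure circle_measure {t \<in> unit_circle. \<exists>r\<in>{0..<1}. c < cmod (d (of_real r * t))} \<le> 16 * D"
proof -
  let ?M = circle_measure
  have dc: "continuous_on (ball 0 1) d" by (rule holomorphic_on_imp_continuous_on[OF d])
  define Q where "Q = \<rat> \<inter> {0..<1::real}"
  have "countable Q" "0 \<in> Q" by (auto simp: Q_def countable_rat)
  then have "Q \<noteq> {}" by auto
  define q where "q = from_nat_into Q"
  have qQ: "q n \<in> Q" for n unfolding q_def using \<open>Q \<noteq> {}\<close> by (rule from_nat_into)
  then have q01: "0 \<le> q n" "q n < 1" for n by (auto simp: Q_def)
  have rq: "range q = Q" unfolding q_def using \<open>Q \<noteq> {}\<close> \<open>countable Q\<close> by (rule range_from_nat_into)
  have cont: "continuous_on (cball 0 1) (\<lambda>t. d (of_real (q n) * t))" for n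
    by (rule continuous_on_circle_dilation[OF dc q01])
  have mq[measurable]: "(\<lambda>t. d (of_real (q n) * t)) \<in> borel_measurable ?M" for n
    by (intro measurable_circle_continuous continuous_on_subset[OF cont]) auto
  define A where "A n = {t \<in> space ?M. \<exists>i\<le>n. c < cmod (d (of_real (q i) * t))}" for n :: nat
  have Am[measurable]: "A n \<in> sets ?M" for n unfolding A_def by measurable
  have Aeq: "?A = (\<Union>n. A n)"
  proof (intro equalityI subsetI)
    fix t assume t: "t \<in> ?A"
    then obtain r where r: "0 \<le> r" "r < 1" "c < cmod (d (of_real r * t))" and t1: "cmod t = 1" by auto
    have "continuous_on {0..<1} (\<lambda>r. cmod (d (of_real r * t)))"
      using t1 by (intro continuous_intros continuous_on_compose2[OF dc]) (auto simp: norm_mult)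
    then have "((\<lambda>r. cmod (d (of_real r * t))) \<longlongrightarrow> cmod (d (of_real r * t))) (at r within {0..<1})"
      using r by (auto simp: continuous_on_def)
    then have "\<forall>\<^sub>F s in at r within {0..<1}. c < cmod (d (of_real s * t))"
      using r(3) by (rule order_tendstoD)
    then obtain e where e: "e > 0" "\<And>s. s \<in> {0..<1} \<Longrightarrow> s \<noteq> r \<Longrightarrow> dist s r < e \<Longrightarrow> c < cmod (d (of_real s * t))"
      by (auto simp: eventually_at)
    obtain s where s: "s \<in> \<rat>" "r < s" "s < min 1 (r + e)"
      using Rats_dense_in_real[of r "min 1 (r + e)"] r e by auto
    then have "s \<in> Q" using r by (auto simp: Q_def)
    then obtain i where i: "s = q i" using rq by blast
    have "c < cmod (d (of_real s * t))" using s r by (intro e) (auto simp: dist_real_def)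
    then have "t \<in> A i" using t1 by (auto simp: A_def i)
    then show "t \<in> (\<Union>n. A n)" by blast
  next
    fix t assume "t \<in> (\<Union>n. A n)"
    then obtain n i where "t \<in> unit_circle" "c < cmod (d (of_real (q i) * t))" by (auto simp: A_def)
    then show "t \<in> ?A" using q01[of i] by auto
  qed
  then show "?A \<in> sets ?M" by simp
  have bound: "c\<^sup>2 * measure ?M (A n) \<le> 16 * D" for n
  proof -
    define mx where "mx = Max (q ` {..n})"
    have mx: "q i \<le> mx" if "i \<le> n" for i unfolding mx_def using that by (intro Max_ge) auto
    have "mx \<in> q ` {..n}" unfolding mx_def by (intro Max_in) auto
    then have mx01: "0 \<le> mx" "mx < 1" using q01 by auto
    \<comment> \<open>A radius strictly between the finitely many radii and 1. The dilation of
      \<open>d\<close> by \<open>R\<close> is continuous on the closed disc, and the radii stay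
      below 1 after division by \<open>R\<close>.\<close>
    define R where "R = (1 + mx) / 2"
    have R: "mx < R" "0 < R" "R < 1" using mx01 by (auto simp: R_def)
    \<comment> \<open>The first radius at which \<open>c\<close> is exceeded; taking the least index
      makes the selection measurable.\<close>
    define idx where "idx t = (LEAST i. c < cmod (d (of_real (q i) * t)))" for t
    have [measurable]: "idx \<in> ?M \<rightarrow>\<^sub>M count_space UNIV" unfolding idx_def by measurable
    have idx: "idx t \<le> n" "c < cmod (d (of_real (q (idx t)) * t))" if t: "t \<in> A n" for t
    proof -
      obtain i where i: "i \<le> n" "c < cmod (d (of_real (q i) * t))" using t by (auto simp: A_def)
      show "c < cmod (d (of_real (q (idx t)) * t))" unfolding idx_def using i(2) by (rule LeastI)
      have "idx t \<le> i" unfolding idx_def using i(2) by (rule Least_le)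
      then show "idx t \<le> n" using i by simp
    qed
    define r where "r t = (if t \<in> A n then q (idx t) / R else 0)" for t
    have "(\<lambda>t. q (idx t)) \<in> borel_measurable ?M"
      by (rule measurable_compose[of idx _ "count_space UNIV"]) auto
    then have rm: "r \<in> borel_measurable ?M" unfolding r_def by measurable
    define g where "g t = cmod (d (of_real R * t))" for t
    have gc: "continuous_on unit_circle g"
      unfolding g_def using R
      by (intro continuous_intros continuous_on_subset[OF continuous_on_circle_dilation[OF dc]]) auto
    obtain B where B: "\<And>t. t \<in> unit_circle \<Longrightarrow> g t \<le> B"
      using continuous_attains_sup[OF compact_sphere _ gc] by fastforce
    have "c\<^sup>2 * measure ?M (A n) \<le> 16 * (LINT s|?M. (g s)\<^sup>2)"
    proof (rule poisson_maximal_weak[OF Am rm])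
      show "0 \<le> r t \<and> r t \<le> mx / R" for t
        using R q01[of "idx t"] idx[of t] mx[of "idx t"] mx01 by (auto simp: r_def divide_right_mono)
      show "mx / R < 1" using R by simp
      show "g \<in> borel_measurable ?M" by (rule measurable_circle_continuous[OF gc])
      show "0 \<le> g t \<and> g t \<le> B" if "t \<in> unit_circle" for t using B[OF that] by (simp add: g_def)
      fix t assume t: "t \<in> A n"
      then have t1: "cmod t = 1" by (simp add: A_def)
      have z: "cmod (of_real (r t) * t) < 1"
      proof -
        have "cmod (of_real (r t) * t) = q (idx t) / R"
          using t t1 R q01[of "idx t"] unfolding norm_mult norm_of_real by (simp add: r_def)
        also have "\<dots> < 1" using R mx[of "idx t"] idx(1)[OF t] by simp
        finally show ?thesis .
      qed
      have F: "continuous_on (cball 0 1) (\<lambda>s. d (of_real R * s))"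
        using R by (intro continuous_on_circle_dilation[OF dc]) auto
      have h: "(\<lambda>s. d (of_real R * s)) holomorphic_on ball 0 1"
        using R by (intro holomorphic_dilation[OF d]) auto
      have "c \<le> cmod (d (of_real R * (of_real (r t) * t)))"
        using idx(2)[OF t] t R by (simp add: r_def)
      also have "\<dots> = cmod (LINT s|?M. of_real (poisson_kernel (of_real (r t) * t) s) * d (of_real R * s))"
        by (simp only: poisson_formula[OF F h z])
      also have "\<dots> \<le> (LINT s|?M. norm (of_real (poisson_kernel (of_real (r t) * t) s) * d (of_real R * s)))"
        by (rule integral_norm_bound)
      also have "\<dots> = (LINT s|?M. poisson_kernel (of_real (r t) * t) s * g s)"
        using poisson_kernel_bounds(3)[OF _ z]
        by (intro Bochner_Integration.integral_cong refl) (simp add: norm_mult g_def less_imp_le)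
      finally show "c \<le> (LINT s|?M. poisson_kernel (of_real (r t) * t) s * g s)" .
    qed (fact c)
    also have "\<dots> \<le> 16 * D" using D[of R] R by (simp add: g_def)
    finally show ?thesis .
  qed
  have "(\<lambda>n. c\<^sup>2 * measure ?M (A n)) \<longlonglongrightarrow> c\<^sup>2 * measure ?M (\<Union>n. A n)"
  proof (intro tendsto_mult tendsto_const circle.finite_Lim_measure_incseq)
    show "range A \<subseteq> sets ?M" using Am by blast
    show "incseq A" by (auto simp: incseq_def A_def intro: order_trans)
  qed
  then have "c\<^sup>2 * measure ?M (\<Union>n. A n) \<le> 16 * D"
    by (rule LIMSEQ_le_const2) (use bound in auto)
  then show "c\<^sup>2 * measure ?M ?A \<le> 16 * D" unfolding Aeq .
qed

lemma convergent_at_left_if_Cauchy: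
  fixes f :: "real \<Rightarrow> 'a :: banach"
  assumes "\<And>e. e > 0 \<Longrightarrow> \<exists>s<a. \<forall>r\<in>{s..<a}. \<forall>r'\<in>{s..<a}. norm (f r - f r') \<le> e"
  shows "\<exists>l. (f \<longlongrightarrow> l) (at_left a)"
proof -
  define x where "x n = a - 1 / (real n + 1)" for n :: nat
  have xa: "x n < a" for n by (simp add: x_def)
  have x_ge: "\<exists>N. \<forall>n\<ge>N. s \<le> x n" if s: "s < a" for s
  proof -
    obtain N :: nat where "1 / (a - s) < N" using reals_Archimedean2 by blast
    then have "1 < N * (a - s)" using s by (simp add: field_simps)
    have "s \<le> x n" if "n \<ge> N" for n
    proof -
      have "N * (a - s) \<le> (real n + 1) * (a - s)" using that s by (intro mult_right_mono) auto
      then have "1 \<le> (real n + 1) * (a - s)" using \<open>1 < N * (a - s)\<close> by linarith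
      then show ?thesis by (simp add: x_def field_simps)
    qed
    then show ?thesis by blast
  qed
  have "Cauchy (\<lambda>n. f (x n))"
  proof (rule CauchyI)
    fix e :: real assume "0 < e"
    then obtain s where s: "s < a" "\<forall>r\<in>{s..<a}. \<forall>r'\<in>{s..<a}. norm (f r - f r') \<le> e / 2"
      using assms[of "e / 2"] by auto
    obtain N where "\<forall>n\<ge>N. s \<le> x n" using x_ge[OF s(1)] by blast
    then have "norm (f (x m) - f (x n)) < e" if "m \<ge> N" "n \<ge> N" for m n
      using s(2)[rule_format, of "x m" "x n"] that xa \<open>0 < e\<close> by auto
    then show "\<exists>N. \<forall>m\<ge>N. \<forall>n\<ge>N. norm (f (x m) - f (x n)) < e" by blast
  qed
  then obtain l where l: "(\<lambda>n. f (x n)) \<longlonglongrightarrow> l" using Cauchy_convergent_iff convergent_def by blast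
  have "(f \<longlongrightarrow> l) (at_left a)"
  proof (rule tendstoI)
    fix e :: real assume "0 < e"
    then obtain s where s: "s < a" "\<forall>r\<in>{s..<a}. \<forall>r'\<in>{s..<a}. norm (f r - f r') \<le> e / 2"
      using assms[of "e / 2"] by auto
    obtain N where N: "\<forall>n\<ge>N. s \<le> x n" using x_ge[OF s(1)] by blast
    have "norm (f r - l) \<le> e / 2" if "r \<in> {s..<a}" for r
    proof (rule LIMSEQ_le_const2)
      show "(\<lambda>n. norm (f r - f (x n))) \<longlonglongrightarrow> norm (f r - l)" by (intro tendsto_intros l)
      show "\<exists>N. \<forall>n\<ge>N. norm (f r - f (x n)) \<le> e / 2"
        using s(2) that N xa by (intro exI[of _ N]) auto
    qed
    then have "dist (f r) l < e" if "r \<in> {s..<a}" for r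
      using that \<open>0 < e\<close> by (fastforce simp: dist_norm)
    then show "\<forall>\<^sub>F r in at_left a. dist (f r) l < e"
      unfolding eventually_at_left_field using s(1) by (intro exI[of _ s]) auto
  qed
  then show ?thesis by blast
qed

text \<open>The dilation of f by \<rho> < 1 is continuous up to the circle, so it has no radial
  oscillation there. The oscillation of f is therefore controlled by the radial maximal function of
  f minus its dilation, which by the weak type inequality is small outside a set of small measure,
  because the L2 norm of this difference tends to 0 as \<rho> tends to 1.\<close>

theorem Fatou_radial_limits:
  fixes f :: "complex \<Rightarrow> complex"
  assumes hol: "f holomorphic_on ball 0 1" and bd: "\<And>z. cmod z < 1 \<Longrightarrow> cmod (f z) \<le> B"
  shows "AE t in circle_measure. \<exists>l. ((\<lambda>r. f (of_real r * t)) \<longlongrightarrow> l) (at_left 1)"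
proof -
  let ?M = circle_measure
  define a where "a n = (deriv ^^ n) f 0 / fact n" for n
  have f: "(\<lambda>n. a n * z ^ n) sums f z" if "cmod z < 1" for z
    using holomorphic_power_series[OF hol, of z] that by (simp add: a_def)
  have fc: "continuous_on (ball 0 1) f" by (rule holomorphic_on_imp_continuous_on[OF hol])
  \<comment> \<open>Parseval on the circle of radius \<open>R\<close> bounds every partial sum by
    the square of \<open>B\<close>; in a finite sum \<open>R\<close> may tend to 1.\<close>
  have summ: "summable (\<lambda>n. (cmod (a n))\<^sup>2)"
  proof (rule bounded_imp_summable)
    fix N
    have "(\<Sum>n\<le>N. (cmod (a n) * R ^ n)\<^sup>2) \<le> B\<^sup>2" if R: "0 \<le> R" "R < 1" for R
    proof -
      have s: "(\<lambda>n. (cmod (a n) * R ^ n)\<^sup>2) sums (LINT t|?M. (cmod (f (of_real R * t)))\<^sup>2)"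
        by (rule power_series_Parseval[OF f R])
      have "(\<Sum>n\<le>N. (cmod (a n) * R ^ n)\<^sup>2) \<le> (LINT t|?M. (cmod (f (of_real R * t)))\<^sup>2)"
        using sum_le_suminf[OF sums_summable[OF s], of "{..N}"] by (simp add: sums_unique[OF s])
      also have "\<dots> \<le> \<bar>LINT t|?M. (cmod (f (of_real R * t)))\<^sup>2\<bar>" by simp
      also have "\<dots> \<le> B\<^sup>2"
      proof (rule abs_circle_integral_le)
        fix t :: complex assume "t \<in> unit_circle"
        then have "cmod (f (of_real R * t)) \<le> B" using R by (intro bd) (simp add: norm_mult)
        then show "\<bar>(cmod (f (of_real R * t)))\<^sup>2\<bar> \<le> B\<^sup>2" by (simp add: power_mono)
      qed simp
      finally show ?thesis .
    qed
    then have ev: "\<forall>\<^sub>F R in at_left 1. (\<Sum>n\<le>N. (cmod (a n) * R ^ n)\<^sup>2) \<le> B\<^sup>2"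
      unfolding eventually_at_left_field by (intro exI[of _ 0]) auto
    have "((\<lambda>R. \<Sum>n\<le>N. (cmod (a n) * R ^ n)\<^sup>2) \<longlongrightarrow> (\<Sum>n\<le>N. (cmod (a n) * 1 ^ n)\<^sup>2)) (at_left 1)"
      by (intro tendsto_intros)
    from tendsto_upperbound[OF this ev] show "(\<Sum>n\<le>N. (cmod (a n))\<^sup>2) \<le> B\<^sup>2" by simp
  qed simp
  \<comment> \<open>The squared L2 norm of f minus its dilation by \<open>\<rho>\<close>, written
    through coefficients; Tannery's theorem gives its limit 0.\<close>
  define D where "D \<rho> = (\<Sum>n. (cmod (a n) * (1 - \<rho> ^ n))\<^sup>2)" for \<rho> :: real
  have Dbd: "(cmod (a n) * (1 - \<rho> ^ n))\<^sup>2 \<le> (cmod (a n))\<^sup>2" if "0 \<le> \<rho>" "\<rho> \<le> 1" for \<rho> n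
  proof -
    have "0 \<le> 1 - \<rho> ^ n" "1 - \<rho> ^ n \<le> 1" using that by (auto simp: power_le_one)
    then have "cmod (a n) * (1 - \<rho> ^ n) \<le> cmod (a n)" by (intro mult_left_le) auto
    then show ?thesis using \<open>0 \<le> 1 - \<rho> ^ n\<close> by (intro power_mono mult_nonneg_nonneg) auto
  qed
  have "((\<lambda>\<rho>. \<Sum>n. (cmod (a n) * (1 - \<rho> ^ n))\<^sup>2) \<longlongrightarrow> (\<Sum>n. (cmod (a n) * (1 - 1 ^ n))\<^sup>2)) (at_left 1)"
  proof (rule tannerys_theorem[THEN conjunct2, THEN conjunct2, OF _ _ summ])
    show "((\<lambda>\<rho>. (cmod (a n) * (1 - \<rho> ^ n))\<^sup>2) \<longlongrightarrow> (cmod (a n) * (1 - 1 ^ n))\<^sup>2) (at_left 1)" for n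
      by (intro tendsto_intros)
    have "\<forall>\<^sub>F \<rho> in at_left (1::real). \<forall>n. norm ((cmod (a n) * (1 - \<rho> ^ n))\<^sup>2) \<le> (cmod (a n))\<^sup>2"
      unfolding eventually_at_left_field using Dbd by (intro exI[of _ 0]) auto
    then show "\<forall>\<^sub>F (n, \<rho>) in at_top \<times>\<^sub>F at_left 1. norm ((cmod (a n) * (1 - \<rho> ^ n))\<^sup>2) \<le> (cmod (a n))\<^sup>2"
      by (rule eventually_mono[OF eventually_prodI[OF eventually_True]]) auto
  qed simp
  then have Dlim: "(D \<longlongrightarrow> 0) (at_left 1)" by (simp add: D_def[abs_def])
  have key: "AE t in ?M. \<exists>s<1. \<forall>r\<in>{s..<1}. \<forall>r'\<in>{s..<1}. cmod (f (of_real r * t) - f (of_real r' * t)) \<le> 3 * c"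
    if c: "c > 0" for c :: real
  proof -
    define A where "A \<rho> = {t \<in> unit_circle. \<exists>r\<in>{0..<1}. c < cmod (f (of_real r * t) - f (of_real \<rho> * (of_real r * t)))}" for \<rho> :: real
    have A: "A \<rho> \<in> sets ?M" "c\<^sup>2 * measure ?M (A \<rho>) \<le> 16 * D \<rho>" if \<rho>: "0 \<le> \<rho>" "\<rho> < 1" for \<rho>
    proof -
      define d where "d z = f z - f (of_real \<rho> * z)" for z
      have ds: "(\<lambda>n. (a n * (1 - of_real \<rho> ^ n)) * z ^ n) sums d z" if z: "cmod z < 1" for z
      proof -
        have "cmod (of_real \<rho> * z) < 1 * 1" unfolding norm_mult using z \<rho> by (intro mult_strict_mono') auto
        then have "(\<lambda>n. a n * z ^ n - a n * (of_real \<rho> * z) ^ n) sums d z"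
          unfolding d_def using z by (intro sums_diff f) auto
        then show ?thesis by (simp add: algebra_simps power_mult_distrib)
      qed
      have dh: "d holomorphic_on ball 0 1"
        by (rule power_series_holomorphic[of 0 1 "\<lambda>n. a n * (1 - of_real \<rho> ^ n)"]) (use ds in auto)
      have na: "cmod (a n * (1 - of_real \<rho> ^ n)) = cmod (a n) * (1 - \<rho> ^ n)" for n
      proof -
        have "(1 - of_real \<rho> ^ n :: complex) = of_real (1 - \<rho> ^ n)" by simp
        moreover have "0 \<le> 1 - \<rho> ^ n" using \<rho> by (simp add: power_le_one)
        ultimately show ?thesis by (simp only: norm_mult norm_of_real abs_of_nonneg)
      qed
      have dD: "(LINT t|?M. (cmod (d (of_real R * t)))\<^sup>2) \<le> D \<rho>" if R: "0 \<le> R" "R < 1" for R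
      proof -
        have s: "(\<lambda>n. (cmod (a n) * (1 - \<rho> ^ n) * R ^ n)\<^sup>2) sums (LINT t|?M. (cmod (d (of_real R * t)))\<^sup>2)"
          using power_series_Parseval[OF ds R] by (simp only: na)
        have s2: "summable (\<lambda>n. (cmod (a n) * (1 - \<rho> ^ n))\<^sup>2)"
          by (rule summable_comparison_test'[OF summ]) (use Dbd \<rho> in auto)
        show ?thesis
          unfolding D_def sums_unique[OF s]
        proof (rule suminf_le[OF _ sums_summable[OF s] s2])
          fix n
          have "0 \<le> 1 - \<rho> ^ n" using \<rho> by (simp add: power_le_one)
          then have "0 \<le> cmod (a n) * (1 - \<rho> ^ n)" by simp
          then show "(cmod (a n) * (1 - \<rho> ^ n) * R ^ n)\<^sup>2 \<le> (cmod (a n) * (1 - \<rho> ^ n))\<^sup>2"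
            using R by (intro power_mono mult_left_le mult_nonneg_nonneg[of "_ * _"]) (auto simp: power_le_one)
        qed
      qed
      show "A \<rho> \<in> sets ?M" "c\<^sup>2 * measure ?M (A \<rho>) \<le> 16 * D \<rho>"
        using radial_maximal_weak[OF dh dD c] by (auto simp: A_def d_def)
    qed
    have Dx: "(\<lambda>n. D (radius n)) \<longlonglongrightarrow> 0" by (rule filterlim_compose[OF Dlim filterlim_radius])
    \<comment> \<open>The points that are bad for every dilation. Their measure is at most 16 * D
      (radius n) divided by the square of c, for each n, hence 0.\<close>
    define N where "N = (\<Inter>n. A (radius n))"
    have [measurable]: "N \<in> sets ?M" unfolding N_def using A(1) radius_bounds by auto
    have "c\<^sup>2 * measure ?M N \<le> 0"
    proof (rule LIMSEQ_le_const)
      show "(\<lambda>n. 16 * D (radius n)) \<longlonglongrightarrow> 0" using tendsto_mult[OF tendsto_const[of 16] Dx] by simp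
      have "c\<^sup>2 * measure ?M N \<le> 16 * D (radius n)" for n
      proof -
        have "measure ?M N \<le> measure ?M (A (radius n))"
          by (rule circle.finite_measure_mono) (use A(1) radius_bounds in \<open>auto simp: N_def\<close>)
        then have "c\<^sup>2 * measure ?M N \<le> c\<^sup>2 * measure ?M (A (radius n))" by (rule mult_left_mono) simp
        then show ?thesis using A(2)[OF radius_bounds, of n] by linarith
      qed
      then show "\<exists>N'. \<forall>n\<ge>N'. c\<^sup>2 * measure ?M N \<le> 16 * D (radius n)" by blast
    qed
    then have "measure ?M N = 0"
      using c by (metis measure_nonneg mult_le_0_iff zero_less_power not_less order_antisym)
    then have "N \<in> null_sets ?M" by (simp add: null_sets_def circle.emeasure_eq_measure)
    then have "AE t in ?M. t \<notin> N" by (rule AE_not_in)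
    with AE_space show ?thesis
    proof eventually_elim
      fix t assume "t \<in> space ?M" "t \<notin> N"
      then obtain n where n: "t \<notin> A (radius n)" and t: "cmod t = 1" by (auto simp: N_def)
      \<comment> \<open>The dilated function along the radius, which is continuous up to r = 1. Four
        comparisons, two with error c and two with error c / 2, give 3 * c.\<close>
      define h where "h r = f (of_real (radius n) * (of_real r * t))" for r
      have le: "cmod (f (of_real r * t) - h r) \<le> c" if "0 \<le> r" "r < 1" for r
        using n t that by (auto simp: A_def h_def not_less)
      have "continuous_on {0..1} h"
        unfolding h_def
      proof (rule continuous_on_compose2[OF fc])
        show "(\<lambda>r. of_real (radius n) * (of_real r * t)) ` {0..1} \<subseteq> ball 0 1"
        proof (rule image_subsetI)
          fix r :: real assume r: "r \<in> {0..1}"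
          have "radius n * r \<le> radius n" using radius_bounds[of n] r by (intro mult_left_le) auto
          then show "of_real (radius n) * (of_real r * t) \<in> ball 0 1"
            using radius_bounds[of n] r t by (simp add: norm_mult)
        qed
      qed (intro continuous_intros)
      then have "(h \<longlongrightarrow> h 1) (at 1 within {0..1})" by (auto simp: continuous_on_def)
      then have "\<forall>\<^sub>F r in at 1 within {0..1}. dist (h r) (h 1) < c / 2"
        by (rule tendstoD) (use c in simp)
      then obtain e where e: "e > 0" "\<And>r. r \<in> {0..1} \<Longrightarrow> r \<noteq> 1 \<Longrightarrow> dist r 1 < e \<Longrightarrow> dist (h r) (h 1) < c / 2"
        by (auto simp: eventually_at)
      define s where "s = max 0 (1 - e / 2)"
      have s: "s < 1" "0 \<le> s" using e by (auto simp: s_def)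
      have hs: "cmod (h r - h 1) < c / 2" if "r \<in> {s..<1}" for r
        using e(2)[of r] e(1) that by (auto simp: s_def dist_norm)
      have "cmod (f (of_real r * t) - f (of_real r' * t)) \<le> 3 * c" if "r \<in> {s..<1}" "r' \<in> {s..<1}" for r r'
      proof -
        have "f (of_real r * t) - f (of_real r' * t)
            = (f (of_real r * t) - h r) - (f (of_real r' * t) - h r') + (h r - h 1) - (h r' - h 1)"
          by simp
        also have "cmod \<dots> \<le> cmod (f (of_real r * t) - h r) + cmod (f (of_real r' * t) - h r')
            + cmod (h r - h 1) + cmod (h r' - h 1)"
          by (intro order_trans[OF norm_triangle_ineq4] order_trans[OF norm_triangle_ineq] add_mono order_refl)
        also have "\<dots> \<le> 3 * c"
          using le[of r] le[of r'] hs[OF that(1)] hs[OF that(2)] that s by auto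
        finally show ?thesis .
      qed
      then show "\<exists>s<1. \<forall>r\<in>{s..<1}. \<forall>r'\<in>{s..<1}. cmod (f (of_real r * t) - f (of_real r' * t)) \<le> 3 * c"
        using s by blast
    qed
  qed
  have "AE t in ?M. \<forall>j::nat. \<exists>s<1. \<forall>r\<in>{s..<1}. \<forall>r'\<in>{s..<1}.
      cmod (f (of_real r * t) - f (of_real r' * t)) \<le> 3 * (1 / (real j + 1))"
    unfolding AE_all_countable by (intro allI key) auto
  then show ?thesis
  proof eventually_elim
    fix t assume *: "\<forall>j::nat. \<exists>s<1. \<forall>r\<in>{s..<1}. \<forall>r'\<in>{s..<1}.
      cmod (f (of_real r * t) - f (of_real r' * t)) \<le> 3 * (1 / (real j + 1))"
    show "\<exists>l. ((\<lambda>r. f (of_real r * t)) \<longlongrightarrow> l) (at_left 1)"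
    proof (rule convergent_at_left_if_Cauchy)
      fix e :: real assume "e > 0"
      obtain j :: nat where "3 / e < j" using reals_Archimedean2 by blast
      then have "3 * (1 / (real j + 1)) \<le> e" using \<open>e > 0\<close> by (simp add: field_simps)
      then show "\<exists>s<1. \<forall>r\<in>{s..<1}. \<forall>r'\<in>{s..<1}. cmod (f (of_real r * t) - f (of_real r' * t)) \<le> e"
        using *[rule_format, of j] by (meson order_trans)
    qed
  qed
qed

section \<open>Boundary values in the Smirnov class\<close>

lemma ln_plus_nonneg [simp]: "0 \<le> ln_plus x"
  by (simp add: ln_plus_def)

lemma ln_plus_pos_eq: "0 < x \<Longrightarrow> ln_plus x = max 0 (ln x)"
  by (auto simp: ln_plus_def max_def)

lemma exp_ln_plus: "exp (ln_plus x) = max 1 x"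
  by (simp add: ln_plus_def)

lemma ln_plus_mono: "x \<le> y \<Longrightarrow> ln_plus x \<le> ln_plus y"
  by (simp add: ln_plus_def)

lemma ln_le_ln_plus: "0 < x \<Longrightarrow> ln x \<le> ln_plus x"
  by (simp add: ln_plus_pos_eq)

lemma ln_plus_mult: "0 \<le> x \<Longrightarrow> 0 \<le> y \<Longrightarrow> ln_plus (x * y) \<le> ln_plus x + ln_plus y"
proof -
  assume "0 \<le> x" "0 \<le> y"
  then have "x * y \<le> max 1 x * max 1 y" by (intro mult_mono) auto
  moreover have "1 * 1 \<le> max 1 x * max 1 y" by (intro mult_mono) auto
  ultimately have "max 1 (x * y) \<le> max 1 x * max 1 y" by simp
  then have "ln (max 1 (x * y)) \<le> ln (max 1 x * max 1 y)" by (simp add: less_max_iff_disj)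
  also have "\<dots> = ln (max 1 x) + ln (max 1 y)" by (intro ln_mult_pos) (auto simp: less_max_iff_disj)
  finally show ?thesis by (simp add: ln_plus_def)
qed

lemma ln_plus_power: "ln_plus (x ^ n) \<le> real n * ln_plus x" if "0 \<le> x"
proof (induction n)
  case (Suc n)
  have "ln_plus (x * x ^ n) \<le> ln_plus x + ln_plus (x ^ n)" by (rule ln_plus_mult) (use that in auto)
  then show ?case using Suc by (simp add: algebra_simps)
qed (simp add: ln_plus_def)

lemma continuous_on_ln_plus [continuous_intros]:
  "continuous_on S f \<Longrightarrow> continuous_on S (\<lambda>x. ln_plus (f x))"
  unfolding ln_plus_def by (intro continuous_on_ln continuous_on_max continuous_on_const) (auto simp: max_def)

lemma tendsto_ln_plus [tendsto_intros]: "(f \<longlongrightarrow> l) F \<Longrightarrow> ((\<lambda>x. ln_plus (f x)) \<longlongrightarrow> ln_plus l) F"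
  unfolding ln_plus_def by (intro tendsto_ln tendsto_max tendsto_const) auto

lemma borel_measurable_ln_plus [measurable]: "ln_plus \<in> borel_measurable borel"
  unfolding ln_plus_def[abs_def] by measurable

definition scalar_smirnov :: "(complex \<Rightarrow> complex) \<Rightarrow> bool" where
  "scalar_smirnov f \<longleftrightarrow> f holomorphic_on ball 0 1 \<and>
     uniformly_integrable circle_measure {0..<1} (\<lambda>r t. ln_plus (cmod (f (of_real r * t))))"

text \<open>Boundary functions are determined only almost everywhere, so they enter as a relation;
  measurability is part of it because null-set changes could destroy it.\<close>

definition has_boundary_function :: "(complex \<Rightarrow> complex) \<Rightarrow> (complex \<Rightarrow> complex) \<Rightarrow> bool" where
  "has_boundary_function f fb \<longleftrightarrow> fb \<in> borel_measurable circle_measure \<and>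
     (AE t in circle_measure. ((\<lambda>r. f (of_real r * t)) \<longlongrightarrow> fb t) (at_left 1))"

lemma has_boundary_functionI:
  assumes f: "f holomorphic_on ball 0 1"
    and lim: "AE t in circle_measure. \<exists>l. ((\<lambda>r. f (of_real r * t)) \<longlongrightarrow> l) (at_left 1)"
  obtains fb where "has_boundary_function f fb"
proof -
  have m: "(\<lambda>t. f (of_real (radius n) * t)) \<in> borel_measurable circle_measure" for n
    by (rule measurable_dilation[OF f radius_bounds])
  \<comment> \<open>The limit along a sequence is measurable on the whole circle, whatever it
    returns at points of divergence, and it agrees with the radial limit where that exists.\<close>
  define fb where "fb t = lim (\<lambda>n. f (of_real (radius n) * t))" for t
  have "fb \<in> borel_measurable circle_measure"
    unfolding fb_def by (rule borel_measurable_lim_metric[OF m])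
  moreover have "AE t in circle_measure. ((\<lambda>r. f (of_real r * t)) \<longlongrightarrow> fb t) (at_left 1)"
    using lim
  proof eventually_elim
    fix t assume "\<exists>l. ((\<lambda>r. f (of_real r * t)) \<longlongrightarrow> l) (at_left 1)"
    then obtain l where l: "((\<lambda>r. f (of_real r * t)) \<longlongrightarrow> l) (at_left 1)" ..
    then have "(\<lambda>n. f (of_real (radius n) * t)) \<longlonglongrightarrow> l" using filterlim_radius by (rule filterlim_compose)
    then have "fb t = l" unfolding fb_def by (rule limI)
    then show "((\<lambda>r. f (of_real r * t)) \<longlongrightarrow> fb t) (at_left 1)" using l by simp
  qed
  ultimately show ?thesis using that unfolding has_boundary_function_def by blast
qed

lemma scalar_smirnov_bounded:
  assumes f: "f holomorphic_on ball 0 1" and bd: "\<And>z. cmod z < 1 \<Longrightarrow> cmod (f z) \<le> B"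
  shows "scalar_smirnov f"
  unfolding scalar_smirnov_def
proof
  show "uniformly_integrable circle_measure {0..<1} (\<lambda>r t. ln_plus (cmod (f (of_real r * t))))"
  proof (rule uniformly_integrable_bound[where h = id and c = "ln_plus B" and k = 0 and f = "\<lambda>_ _. 0"])
    show "uniformly_integrable circle_measure {0..<1} (\<lambda>_ _. 0)"
      by (intro uniformly_integrable_const) (auto intro: circle.finite_measure)
    show "AE t in circle_measure. \<bar>ln_plus (cmod (f (of_real r * t)))\<bar> \<le> ln_plus B + 0 * \<bar>0\<bar>"
      if "r \<in> {0..<1}" for r
      using that bd by (intro AE_I2) (auto simp: norm_mult intro!: ln_plus_mono)
    show "(\<lambda>t. ln_plus (cmod (f (of_real r * t)))) \<in> borel_measurable circle_measure" if "r \<in> {0..<1}" for r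
    proof -
      have [measurable]: "(\<lambda>t. f (of_real r * t)) \<in> borel_measurable circle_measure"
        by (rule measurable_dilation[OF f]) (use that in auto)
      show ?thesis by measurable
    qed
  qed (auto intro: circle.finite_measure_axioms)
qed (fact f)

lemma poisson_integral_tendsto:
  fixes u :: "nat \<Rightarrow> complex \<Rightarrow> real"
  assumes u: "\<And>n. integrable circle_measure (u n)" "integrable circle_measure v"
    and L1: "(\<lambda>n. LINT t|circle_measure. \<bar>u n t - v t\<bar>) \<longlonglongrightarrow> 0" and z: "cmod z < 1"
  shows "(\<lambda>n. LINT t|circle_measure. poisson_kernel z t * u n t)
           \<longlonglongrightarrow> (LINT t|circle_measure. poisson_kernel z t * v t)"
proof -
  let ?c = "(1 + cmod z) / (1 - cmod z)"
  have int: "integrable circle_measure (\<lambda>t. poisson_kernel z t * w t)"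
    if "integrable circle_measure w" for w
    using integrable_poisson_kernel_mult[OF that z] by simp
  have "(\<lambda>n. (LINT t|circle_measure. poisson_kernel z t * u n t) - (LINT t|circle_measure. poisson_kernel z t * v t)) \<longlonglongrightarrow> 0"
  proof (rule Lim_null_comparison)
    show "(\<lambda>n. ?c * (LINT t|circle_measure. \<bar>u n t - v t\<bar>)) \<longlonglongrightarrow> 0"
      using tendsto_mult[OF tendsto_const[of ?c] L1] by simp
    show "\<forall>\<^sub>F n in sequentially. norm ((LINT t|circle_measure. poisson_kernel z t * u n t)
        - (LINT t|circle_measure. poisson_kernel z t * v t)) \<le> ?c * (LINT t|circle_measure. \<bar>u n t - v t\<bar>)"
    proof (intro always_eventually allI)
      fix n
      have "(LINT t|circle_measure. poisson_kernel z t * u n t) - (LINT t|circle_measure. poisson_kernel z t * v t)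
          = (LINT t|circle_measure. poisson_kernel z t * (u n t - v t))"
        using int[OF u(1), of n] int[OF u(2)] by (simp add: right_diff_distrib)
      also have "norm \<dots> \<le> (LINT t|circle_measure. norm (poisson_kernel z t * (u n t - v t)))"
        by (rule integral_norm_bound)
      also have "\<dots> \<le> (LINT t|circle_measure. ?c * \<bar>u n t - v t\<bar>)"
      proof (rule integral_mono)
        show "integrable circle_measure (\<lambda>t. norm (poisson_kernel z t * (u n t - v t)))"
          by (intro integrable_norm int Bochner_Integration.integrable_diff u)
        show "integrable circle_measure (\<lambda>t. ?c * \<bar>u n t - v t\<bar>)"
          by (intro integrable_mult_right integrable_abs Bochner_Integration.integrable_diff u)
        fix t assume "t \<in> space circle_measure"
        then have t: "cmod t = 1" by simp
        have "\<bar>poisson_kernel z t\<bar> \<le> ?c"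
          using poisson_kernel_bounds(2,3)[OF t z] by simp
        then have "\<bar>poisson_kernel z t\<bar> * \<bar>u n t - v t\<bar> \<le> ?c * \<bar>u n t - v t\<bar>"
          by (rule mult_right_mono) simp
        then show "norm (poisson_kernel z t * (u n t - v t)) \<le> ?c * \<bar>u n t - v t\<bar>"
          by (simp only: real_norm_def abs_mult)
      qed
      also have "\<dots> = ?c * (LINT t|circle_measure. \<bar>u n t - v t\<bar>)" by (rule integral_mult_right_zero)
      finally show "norm ((LINT t|circle_measure. poisson_kernel z t * u n t)
        - (LINT t|circle_measure. poisson_kernel z t * v t)) \<le> ?c * (LINT t|circle_measure. \<bar>u n t - v t\<bar>)" .
    qed
  qed
  then show ?thesis by (rule LIM_zero_cancel)
qed

lemma tendsto_dilation:
  assumes f: "f holomorphic_on ball 0 1" and z: "cmod z < 1"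
  shows "(\<lambda>n. f (of_real (radius n) * z)) \<longlonglongrightarrow> f z"
proof -
  have "isCont f z"
    using holomorphic_on_imp_continuous_on[OF f] z by (simp add: continuous_on_eq_continuous_at)
  moreover have "(\<lambda>n. of_real (radius n) * z) \<longlonglongrightarrow> of_real 1 * z"
    by (intro tendsto_intros radius_tendsto)
  ultimately show ?thesis by (intro isCont_tendsto_compose[of z f]) auto
qed

lemma smirnov_boundary_ln_plus_integrable:
  assumes f: "scalar_smirnov f" and fb: "has_boundary_function f fb"
  shows "integrable circle_measure (\<lambda>t. ln_plus (cmod (fb t)))"
proof -
  have [measurable]: "fb \<in> borel_measurable circle_measure" using fb by (simp add: has_boundary_function_def)
  have hol: "f holomorphic_on ball 0 1" using f by (simp add: scalar_smirnov_def)
  show ?thesis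
  proof (rule uniformly_integrable_Vitali(1)[where f = "\<lambda>n t. ln_plus (cmod (f (of_real (radius n) * t)))"])
    show "uniformly_integrable circle_measure UNIV (\<lambda>n t. ln_plus (cmod (f (of_real (radius n) * t))))"
    proof (rule uniformly_integrable_bound[where h = radius and c = 0 and k = 1])
      show "uniformly_integrable circle_measure {0..<1} (\<lambda>r t. ln_plus (cmod (f (of_real r * t))))"
        using f by (simp add: scalar_smirnov_def)
      show "(\<lambda>t. ln_plus (cmod (f (of_real (radius n) * t)))) \<in> borel_measurable circle_measure" for n
        using measurable_dilation[OF hol radius_bounds] by measurable
    qed (auto simp: radius_bounds intro: circle.finite_measure_axioms)
    show "AE t in circle_measure. (\<lambda>n. ln_plus (cmod (f (of_real (radius n) * t)))) \<longlonglongrightarrow> ln_plus (cmod (fb t))"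
      using fb unfolding has_boundary_function_def
      by (auto elim!: eventually_mono intro!: tendsto_intros filterlim_compose[OF _ filterlim_radius])
  qed (auto intro: circle.finite_measure_axioms)
qed

text \<open>Replacing \<open>ln \<bar>f\<bar>\<close> by \<open>ln (\<bar>f\<bar> + \<epsilon>)\<close> makes the boundary data continuous on
  interior circles and uniformly integrable, so that Vitali's theorem applies.\<close>

lemma smirnov_poisson_inequality_aux:
  assumes f: "scalar_smirnov f" and fb: "has_boundary_function f fb"
    and z: "cmod z < 1" "f z \<noteq> 0" and e: "0 < e" "e \<le> 1"
  shows "integrable circle_measure (\<lambda>t. ln (cmod (fb t) + e))"
    and "ln (cmod (f z)) \<le> (LINT t|circle_measure. poisson_kernel z t * ln (cmod (fb t) + e))"
proof -
  have [measurable]: "fb \<in> borel_measurable circle_measure" using fb by (simp add: has_boundary_function_def)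
  have hol: "f holomorphic_on ball 0 1" using f by (simp add: scalar_smirnov_def)
  have [measurable]: "(\<lambda>t. f (of_real (radius n) * t)) \<in> borel_measurable circle_measure" for n
    by (rule measurable_dilation[OF hol radius_bounds])
  let ?u = "\<lambda>n t. ln (cmod (f (of_real (radius n) * t)) + e)"
  have ui: "uniformly_integrable circle_measure UNIV ?u"
  proof (rule uniformly_integrable_bound[where h = radius and c = "- ln e + ln 2" and k = 1])
    show "uniformly_integrable circle_measure {0..<1} (\<lambda>r t. ln_plus (cmod (f (of_real r * t))))"
      using f by (simp add: scalar_smirnov_def)
    \<comment> \<open>From below by ln e; from above by ln 2 + \<open>ln_plus x\<close>, since e
      \<le> 1 gives x + e \<le> 2 * max 1 x.\<close>
    have le: "\<bar>ln (x + e)\<bar> \<le> - ln e + ln 2 + 1 * \<bar>ln_plus x\<bar>" if "0 \<le> x" for x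
    proof -
      have "ln e \<le> 0" using e by (simp add: ln_le_zero_iff)
      have "ln e \<le> ln (x + e)" using that e by simp
      have "x + e \<le> 2 * max 1 x" using e by auto
      then have "ln (x + e) \<le> ln (2 * max 1 x)" using that e by (subst ln_le_cancel_iff) auto
      also have "\<dots> = ln 2 + ln_plus x" unfolding ln_plus_def by (rule ln_mult_pos) auto
      finally have "ln (x + e) \<le> ln 2 + ln_plus x" .
      moreover have "0 \<le> ln (2::real)" "0 \<le> ln_plus x" by auto
      ultimately show ?thesis
        using \<open>ln e \<le> 0\<close> \<open>ln e \<le> ln (x + e)\<close> unfolding abs_of_nonneg[OF \<open>0 \<le> ln_plus x\<close>] abs_le_iff by linarith
    qed
    show "AE t in circle_measure. \<bar>?u n t\<bar> \<le> - ln e + ln 2 + 1 * \<bar>ln_plus (cmod (f (of_real (radius n) * t)))\<bar>" for n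
      by (intro AE_I2 le) simp
    show "0 \<le> - ln e + ln 2" using e by (simp add: add_nonneg_nonneg ln_le_zero_iff)
  qed (auto simp: radius_bounds intro: circle.finite_measure_axioms)
  have lim: "AE t in circle_measure. (\<lambda>n. ?u n t) \<longlonglongrightarrow> ln (cmod (fb t) + e)"
    using fb[unfolded has_boundary_function_def, THEN conjunct2]
  proof eventually_elim
    fix t assume "((\<lambda>r. f (of_real r * t)) \<longlongrightarrow> fb t) (at_left 1)"
    then have "(\<lambda>n. f (of_real (radius n) * t)) \<longlonglongrightarrow> fb t" using filterlim_radius by (rule filterlim_compose)
    moreover have "cmod (fb t) + e \<noteq> 0" using e norm_ge_zero[of "fb t"] by linarith
    ultimately show "(\<lambda>n. ?u n t) \<longlonglongrightarrow> ln (cmod (fb t) + e)" by (intro tendsto_intros) auto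
  qed
  note V = uniformly_integrable_Vitali[OF circle.finite_measure_axioms ui _ lim]
  show int: "integrable circle_measure (\<lambda>t. ln (cmod (fb t) + e))" by (rule V(1)) measurable
  have L1: "(\<lambda>n. LINT t|circle_measure. \<bar>?u n t - ln (cmod (fb t) + e)\<bar>) \<longlonglongrightarrow> 0" by (rule V(2)) measurable
  have int_u: "integrable circle_measure (?u n)" for n using ui by (auto simp: uniformly_integrable_def)
  have P: "(\<lambda>n. LINT t|circle_measure. poisson_kernel z t * ?u n t)
      \<longlonglongrightarrow> (LINT t|circle_measure. poisson_kernel z t * ln (cmod (fb t) + e))"
    by (rule poisson_integral_tendsto[OF int_u int L1 z(1)])
  have fz: "(\<lambda>n. f (of_real (radius n) * z)) \<longlonglongrightarrow> f z" by (rule tendsto_dilation[OF hol z(1)])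
  then have ln: "(\<lambda>n. ln (cmod (f (of_real (radius n) * z)))) \<longlonglongrightarrow> ln (cmod (f z))"
    using z(2) by (intro tendsto_intros) auto
  have "\<forall>\<^sub>F n in sequentially. f (of_real (radius n) * z) \<noteq> 0"
    using tendsto_imp_eventually_ne[OF fz z(2)] .
  then have "\<forall>\<^sub>F n in sequentially. ln (cmod (f (of_real (radius n) * z)))
      \<le> (LINT t|circle_measure. poisson_kernel z t * ?u n t)"
  proof eventually_elim
    fix n assume nz: "f (of_real (radius n) * z) \<noteq> 0"
    have cont: "continuous_on (cball 0 1) (\<lambda>t. f (of_real (radius n) * t))"
      by (rule continuous_on_circle_dilation[OF holomorphic_on_imp_continuous_on[OF hol] radius_bounds])
    have "cmod (f (of_real (radius n) * z)) \<le> exp (LINT t|circle_measure. poisson_kernel z t * ?u n t)"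
    proof (rule norm_le_exp_poisson_integral[OF cont holomorphic_dilation[OF hol radius_bounds] _ _ z(1)])
      have pos: "0 < cmod w + e" for w using e norm_ge_zero[of w] by linarith
      show "continuous_on unit_circle (?u n)"
        using pos by (intro continuous_intros continuous_on_subset[OF cont]) (auto simp: less_imp_neq[symmetric])
      show "cmod (f (of_real (radius n) * t)) \<le> exp (?u n t)" for t
        using pos e by (simp add: less_imp_le)
    qed
    then show "ln (cmod (f (of_real (radius n) * z))) \<le> (LINT t|circle_measure. poisson_kernel z t * ?u n t)"
      using nz by (metis exp_le_cancel_iff exp_ln zero_less_norm_iff)
  qed
  from tendsto_le[OF sequentially_bot P ln this]
  show "ln (cmod (f z)) \<le> (LINT t|circle_measure. poisson_kernel z t * ln (cmod (fb t) + e))" .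
qed

text \<open>The regularised inequality is applied with e = 1 / (k + 1). The functions
  \<open>X k\<close> are nonnegative and increase with k, and a single point with
  \<open>f z \<noteq> 0\<close> bounds their integrals. Monotone convergence then gives
  integrability of ln|fb| together with the inequality.\<close>

lemma smirnov_poisson_inequality:
  assumes f: "scalar_smirnov f" and fb: "has_boundary_function f fb"
    and z: "cmod z < 1" "f z \<noteq> 0"
  shows "AE t in circle_measure. fb t \<noteq> 0"
    and "integrable circle_measure (\<lambda>t. ln (cmod (fb t)))"
    and "ln (cmod (f z)) \<le> (LINT t|circle_measure. poisson_kernel z t * ln (cmod (fb t)))"
proof -
  let ?M = circle_measure
  have [measurable]: "fb \<in> borel_measurable ?M" using fb by (simp add: has_boundary_function_def)
  define u where "u k t = ln (cmod (fb t) + 1 / (real k + 1))" for k :: nat and t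
  have eps: "0 < 1 / (real k + 1)" "1 / (real k + 1) \<le> 1" for k by (auto simp: field_simps)
  have u: "integrable ?M (u k)" "ln (cmod (f z)) \<le> (LINT t|?M. poisson_kernel z t * u k t)" for k
    using smirnov_poisson_inequality_aux[OF f fb z eps] unfolding u_def[abs_def] by auto
  have intP: "integrable ?M (\<lambda>t. poisson_kernel z t * w t)" if "integrable ?M w" for w
    using integrable_poisson_kernel_mult[OF that z(1)] by simp
  define X where "X k t = poisson_kernel z t * (u 0 t - u k t)" for k t
  define B where "B = (LINT t|?M. poisson_kernel z t * u 0 t) - ln (cmod (f z))"
  have intX: "integrable ?M (X k)" for k
    unfolding X_def by (intro intP Bochner_Integration.integrable_diff u)
  have XB: "(LINT t|?M. X k t) \<le> B" for k
  proof -
    have "(LINT t|?M. X k t) = (LINT t|?M. poisson_kernel z t * u 0 t) - (LINT t|?M. poisson_kernel z t * u k t)"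
      unfolding X_def right_diff_distrib by (intro Bochner_Integration.integral_diff intP u)
    then show ?thesis using u(2)[of k] by (simp add: B_def)
  qed
  define c where "c = (1 - cmod z) / (1 + cmod z)"
  have c: "0 < c" unfolding c_def using z by (intro divide_pos_pos) (auto simp: add_pos_nonneg)
  have Pc: "c \<le> poisson_kernel z t" if "cmod t = 1" for t
    unfolding c_def by (rule poisson_kernel_bounds(1)[OF that z(1)])
  have umono: "u l t \<le> u k t" if "k \<le> l" for k l t
  proof -
    have "0 < 1 / (real l + 1)" by simp
    then have "0 < cmod (fb t) + 1 / (real l + 1)" by (intro add_nonneg_pos) auto
    moreover have "1 / (real l + 1) \<le> 1 / (real k + 1)" using that by (simp add: frac_le)
    ultimately show ?thesis unfolding u_def by (subst ln_le_cancel_iff) linarith+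
  qed
  have Xmono: "X k t \<le> X l t" if "k \<le> l" "cmod t = 1" for k l t
    unfolding X_def using umono[OF that(1)] Pc[OF that(2)] c by (intro mult_left_mono) auto
  have X0: "0 \<le> X k t" if "cmod t = 1" for k t
    using Xmono[of 0 k t] that by (simp add: X_def)
  define Z where "Z = {t \<in> space ?M. fb t = 0}"
  have [measurable]: "Z \<in> sets ?M" unfolding Z_def by measurable
  \<comment> \<open>Zeros of \<open>fb\<close> are dealt with before the limit: there
    \<open>u k\<close> tends to minus infinity, whereas \<open>ln 0\<close> is a real number. On
    \<open>Z\<close> one has u 0 = 0 and u k = - ln (k + 1), so \<open>X k\<close> is at least c *
    ln (k + 1), and the fixed bound \<open>B\<close> forces \<open>Z\<close> to be null.\<close>
  have ZB: "measure ?M Z * (c * ln (real k + 1)) \<le> B" for k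
  proof -
    have "measure ?M Z * (c * ln (real k + 1)) = (LINT t|?M. indicator Z t * (c * ln (real k + 1)))"
      using sets.sets_into_space[of Z ?M] by (simp add: Int_absorb2)
    also have "\<dots> \<le> (LINT t|?M. X k t)"
    proof (rule integral_mono[OF _ intX])
      show "integrable ?M (\<lambda>t. indicator Z t * (c * ln (real k + 1)))"
        by (intro circle.integrable_const_bound[of _ "\<bar>c * ln (real k + 1)\<bar>"] AE_I2) (auto simp: indicator_def)
      fix t assume "t \<in> space ?M"
      then have t: "cmod t = 1" by simp
      show "indicator Z t * (c * ln (real k + 1)) \<le> X k t"
      proof (cases "t \<in> Z")
        case True
        then have "X k t = poisson_kernel z t * ln (real k + 1)"
          by (simp add: X_def u_def Z_def ln_div)
        moreover have "c * ln (real k + 1) \<le> poisson_kernel z t * ln (real k + 1)"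
          using Pc[OF t] by (intro mult_right_mono) auto
        ultimately show ?thesis using True by simp
      qed (use X0[OF t] in auto)
    qed
    also have "\<dots> \<le> B" by (rule XB)
    finally show ?thesis .
  qed
  have "measure ?M Z = 0"
  proof (rule ccontr)
    assume "measure ?M Z \<noteq> 0"
    then have p: "0 < measure ?M Z * c" using c by (simp add: zero_less_measure_iff)
    have "filterlim (\<lambda>k. ln (real k + 1)) at_top sequentially" by real_asymp
    then have "\<forall>\<^sub>F k in sequentially. ln (real k + 1) > B / (measure ?M Z * c)"
      by (rule filterlim_at_top_dense[THEN iffD1, rule_format])
    then obtain k :: nat where "ln (real k + 1) > B / (measure ?M Z * c)"
      using eventually_happens'[OF sequentially_bot] by blast
    then have "ln (real k + 1) * (measure ?M Z * c) > B" using p by (simp only: pos_divide_less_eq)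
    then show False using ZB[of k] by (simp add: mult_ac)
  qed
  then have "Z \<in> null_sets ?M" by (simp add: null_sets_def circle.emeasure_eq_measure)
  then have "AE t in ?M. t \<notin> Z" by (rule AE_not_in)
  with AE_space show nz: "AE t in ?M. fb t \<noteq> 0" by eventually_elim (auto simp: Z_def)
  have "incseq (\<lambda>k. LINT t|?M. X k t)"
    unfolding incseq_def by (intro allI impI integral_mono intX) (auto intro: Xmono)
  then obtain L where L: "(\<lambda>k. LINT t|?M. X k t) \<longlonglongrightarrow> L"
    using incseq_convergent[of "\<lambda>k. LINT t|?M. X k t" B] XB by blast
  have LB: "L \<le> B" by (rule LIMSEQ_le_const2[OF L]) (use XB in blast)
  define Y where "Y t = poisson_kernel z t * (u 0 t - ln (cmod (fb t)))" for t
  have lim: "AE t in ?M. (\<lambda>k. X k t) \<longlonglongrightarrow> Y t"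
    using nz
  proof eventually_elim
    fix t assume "fb t \<noteq> 0"
    have "(\<lambda>k. 1 / (real k + 1)) \<longlonglongrightarrow> 0" by real_asymp
    then have "(\<lambda>k. cmod (fb t) + 1 / (real k + 1)) \<longlonglongrightarrow> cmod (fb t) + 0" by (intro tendsto_intros)
    then have "(\<lambda>k. u k t) \<longlonglongrightarrow> ln (cmod (fb t))"
      unfolding u_def using \<open>fb t \<noteq> 0\<close> by (intro tendsto_ln) auto
    then show "(\<lambda>k. X k t) \<longlonglongrightarrow> Y t" unfolding X_def Y_def by (intro tendsto_intros)
  qed
  have Ym: "Y \<in> borel_measurable ?M" unfolding Y_def u_def by measurable
  have monoX: "AE t in ?M. mono (\<lambda>k. X k t)"
    by (intro AE_I2 monoI Xmono) auto
  have posX: "AE t in ?M. 0 \<le> X k t" for k by (intro AE_I2 X0) auto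
  note mc = integral_monotone_convergence_nonneg[OF intX monoX posX lim L Ym]
  have Y0: "AE t in ?M. 0 \<le> u 0 t - ln (cmod (fb t))"
    using nz
  proof eventually_elim
    fix t assume "fb t \<noteq> 0"
    then have "ln (cmod (fb t)) \<le> ln (cmod (fb t) + 1)"
      by (subst ln_le_cancel_iff) (auto intro: add_pos_pos)
    then show "0 \<le> u 0 t - ln (cmod (fb t))" by (simp add: u_def)
  qed
  \<comment> \<open>The lower Harnack bound \<open>c\<close> removes the Poisson kernel from the
    integrable function \<open>Y\<close>.\<close>
  have "integrable ?M (\<lambda>t. u 0 t - ln (cmod (fb t)))"
  proof (rule Bochner_Integration.integrable_bound)
    show "integrable ?M (\<lambda>t. Y t / c)" using mc(1) by simp
    show "AE t in ?M. norm (u 0 t - ln (cmod (fb t))) \<le> norm (Y t / c)"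
      using AE_space Y0
    proof eventually_elim
      fix t assume "t \<in> space ?M" and 0: "0 \<le> u 0 t - ln (cmod (fb t))"
      then have "c * (u 0 t - ln (cmod (fb t))) \<le> Y t"
        unfolding Y_def using Pc[of t] by (intro mult_right_mono) auto
      then have "u 0 t - ln (cmod (fb t)) \<le> Y t / c" using c by (simp add: field_simps)
      then show "norm (u 0 t - ln (cmod (fb t))) \<le> norm (Y t / c)"
        using 0 by (simp only: real_norm_def abs_of_nonneg)
    qed
  qed (simp add: u_def)
  then have "integrable ?M (\<lambda>t. u 0 t - (u 0 t - ln (cmod (fb t))))"
    by (rule Bochner_Integration.integrable_diff[OF u(1)])
  moreover have "(\<lambda>t. u 0 t - (u 0 t - ln (cmod (fb t)))) = (\<lambda>t. ln (cmod (fb t)))" by (rule ext) simp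
  ultimately show int: "integrable ?M (\<lambda>t. ln (cmod (fb t)))" by (simp only:)
  have "(LINT t|?M. Y t) = (LINT t|?M. poisson_kernel z t * u 0 t) - (LINT t|?M. poisson_kernel z t * ln (cmod (fb t)))"
    unfolding Y_def right_diff_distrib by (intro Bochner_Integration.integral_diff intP u int)
  then show "ln (cmod (f z)) \<le> (LINT t|?M. poisson_kernel z t * ln (cmod (fb t)))"
    using mc(2) LB by (simp add: B_def)
qed


lemma bounded_holomorphic_boundary:
  assumes f: "f holomorphic_on ball 0 1" and bd: "\<And>z. cmod z < 1 \<Longrightarrow> cmod (f z) \<le> B"
  obtains fb where "has_boundary_function f fb"
  using has_boundary_functionI[OF f Fatou_radial_limits[OF f bd]] by blast

lemma boundary_function_bound:
  assumes fb: "has_boundary_function f fb" and bd: "\<And>z. cmod z < 1 \<Longrightarrow> cmod (f z) \<le> B"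
  shows "AE t in circle_measure. cmod (fb t) \<le> B"
  using AE_space fb[unfolded has_boundary_function_def, THEN conjunct2]
proof eventually_elim
  fix t assume t: "t \<in> space circle_measure" and l: "((\<lambda>r. f (of_real r * t)) \<longlongrightarrow> fb t) (at_left 1)"
  have "\<forall>\<^sub>F r in at_left (1::real). cmod (f (of_real r * t)) \<le> B"
    unfolding eventually_at_left_field
    by (intro exI[of _ 0]) (use t bd in \<open>auto simp: norm_mult\<close>)
  then show "cmod (fb t) \<le> B"
    by (rule tendsto_upperbound[OF tendsto_norm[OF l]]) simp
qed

text \<open>Dominated convergence along the dilations. This is what later turns bounded convergence
  on the circle into convergence in the disc.\<close>

lemma bounded_poisson_representation:
  assumes f: "f holomorphic_on ball 0 1" and bd: "\<And>z. cmod z < 1 \<Longrightarrow> cmod (f z) \<le> B"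
    and fb: "has_boundary_function f fb" and z: "cmod z < 1"
  shows "(LINT t|circle_measure. of_real (poisson_kernel z t) * fb t) = f z"
proof -
  let ?c = "(1 + cmod z) / (1 - cmod z)"
  have [measurable]: "fb \<in> borel_measurable circle_measure" using fb by (simp add: has_boundary_function_def)
  have "(\<lambda>n. LINT t|circle_measure. of_real (poisson_kernel z t) * f (of_real (radius n) * t))
      \<longlonglongrightarrow> (LINT t|circle_measure. of_real (poisson_kernel z t) * fb t)"
  proof (rule integral_dominated_convergence[where w = "\<lambda>_. ?c * B"])
    have [measurable]: "(\<lambda>t. f (of_real (radius n) * t)) \<in> borel_measurable circle_measure" for n
      by (rule measurable_dilation[OF f radius_bounds])
    show "(\<lambda>t. of_real (poisson_kernel z t) * f (of_real (radius n) * t)) \<in> borel_measurable circle_measure" for n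
      by measurable
    show "AE t in circle_measure. (\<lambda>n. of_real (poisson_kernel z t) * f (of_real (radius n) * t))
        \<longlonglongrightarrow> of_real (poisson_kernel z t) * fb t"
      using fb unfolding has_boundary_function_def
      by (auto elim!: eventually_mono intro!: tendsto_intros filterlim_compose[OF _ filterlim_radius])
    show "AE t in circle_measure. norm (of_real (poisson_kernel z t) * f (of_real (radius n) * t)) \<le> ?c * B" for n
    proof (intro AE_I2)
      fix t assume "t \<in> space circle_measure"
      then have t: "cmod t = 1" by simp
      have "poisson_kernel z t * cmod (f (of_real (radius n) * t)) \<le> ?c * B"
        using t radius_bounds[of n] poisson_kernel_bounds[OF t z]
        by (intro mult_mono bd) (auto simp: norm_mult)
      then show "norm (of_real (poisson_kernel z t) * f (of_real (radius n) * t)) \<le> ?c * B"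
        using poisson_kernel_bounds(3)[OF t z] by (simp add: norm_mult)
    qed
  qed measurable
  moreover have "(LINT t|circle_measure. of_real (poisson_kernel z t) * f (of_real (radius n) * t))
      = f (of_real (radius n) * z)" for n
    by (rule poisson_formula[OF continuous_on_circle_dilation[OF holomorphic_on_imp_continuous_on[OF f] radius_bounds]
        holomorphic_dilation[OF f radius_bounds] z])
  ultimately show ?thesis
    using tendsto_dilation[OF f z] LIMSEQ_unique by fastforce
qed

text \<open>\<open>exp (- herglotz u z)\<close> is the outer function with boundary modulus exp (-
  u). For u \<ge> 0 it is a damping factor bounded by 1 that cancels a Poisson majorant exp (P[u])
  exactly.\<close>

lemma exp_herglotz:
  assumes u: "integrable circle_measure u" and u0: "\<And>t. t \<in> unit_circle \<Longrightarrow> 0 \<le> u t"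
  shows "(\<lambda>z. exp (- herglotz u z)) holomorphic_on ball 0 1"
    and "cmod z < 1 \<Longrightarrow> cmod (exp (- herglotz u z)) \<le> 1"
    and "cmod z < 1 \<Longrightarrow> cmod (exp (- herglotz u z)) = exp (- (LINT t|circle_measure. poisson_kernel z t * u t))"
proof -
  show "(\<lambda>z. exp (- herglotz u z)) holomorphic_on ball 0 1"
    by (intro holomorphic_intros herglotz_holomorphic u)
  assume z: "cmod z < 1"
  show eq: "cmod (exp (- herglotz u z)) = exp (- (LINT t|circle_measure. poisson_kernel z t * u t))"
    by (simp add: Re_herglotz[OF u z])
  have "0 \<le> (LINT t|circle_measure. poisson_kernel z t * u t)"
    using poisson_kernel_bounds(3)[OF _ z] u0 by (intro integral_nonneg_AE AE_I2 mult_nonneg_nonneg) (auto simp: less_imp_le)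
  then show "cmod (exp (- herglotz u z)) \<le> 1" unfolding eq by simp
qed

text \<open>The functions \<open>exp (- herglotz u)\<close> for the boundary data \<open>u\<close> of \<open>ln\<^sup>+ \<bar>f\<bar>\<close> on
  interior circles form a normal family; a limit \<open>h\<close> does not vanish at \<open>0\<close> and
  satisfies \<open>\<bar>f h\<bar> \<le> 1\<close>, so \<open>f\<close> is a quotient of bounded functions.\<close>

lemma smirnov_boundary:
  assumes f: "scalar_smirnov f"
  obtains fb where "has_boundary_function f fb"
proof -
  have hol: "f holomorphic_on ball 0 1" using f by (simp add: scalar_smirnov_def)
  define u where "u n t = ln_plus (cmod (f (of_real (radius n) * t)))" for n t
  have cont: "continuous_on (cball 0 1) (\<lambda>t. f (of_real (radius n) * t))" for n
    by (rule continuous_on_circle_dilation[OF holomorphic_on_imp_continuous_on[OF hol] radius_bounds])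
  have uc: "continuous_on unit_circle (u n)" for n
    unfolding u_def by (intro continuous_intros continuous_on_subset[OF cont]) auto
  have ui: "integrable circle_measure (u n)" for n by (rule integrable_circle_continuous[OF uc])
  have u0: "0 \<le> u n t" for n t by (simp add: u_def)
  have "\<exists>C. \<forall>r\<in>{0..<1}. (LINT t|circle_measure. \<bar>ln_plus (cmod (f (of_real r * t)))\<bar>) \<le> C"
    using f by (simp add: scalar_smirnov_def uniformly_integrable_def)
  then obtain C where C: "\<And>r. r \<in> {0..<1} \<Longrightarrow> (LINT t|circle_measure. \<bar>ln_plus (cmod (f (of_real r * t)))\<bar>) \<le> C"
    by blast
  have uC: "(LINT t|circle_measure. u n t) \<le> C" for n
    using C[of "radius n"] radius_bounds[of n] by (simp add: u_def)
  define H where "H n z = exp (- herglotz (u n) z)" for n z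
  have H: "H n holomorphic_on ball 0 1" "cmod z < 1 \<Longrightarrow> cmod (H n z) \<le> 1"
    "cmod z < 1 \<Longrightarrow> cmod (H n z) = exp (- (LINT t|circle_measure. poisson_kernel z t * u n t))" for n z
    using exp_herglotz[OF ui u0] by (auto simp: H_def[abs_def])
  define \<H> where "\<H> = {h. h holomorphic_on ball 0 1 \<and> (\<forall>z\<in>ball 0 1. cmod (h z) \<le> 1)}"
  obtain h r where h: "h holomorphic_on ball 0 1" and r: "strict_mono (r :: nat \<Rightarrow> nat)"
    and lim: "\<And>z. z \<in> ball 0 1 \<Longrightarrow> (\<lambda>n. H (r n) z) \<longlonglongrightarrow> h z"
  proof (rule Montel[of "ball 0 1" \<H> H])
    show "\<exists>B. \<forall>h\<in>\<H>. \<forall>z\<in>K. cmod (h z) \<le> B" if "compact K" "K \<subseteq> ball 0 1" for K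
      using that unfolding \<H>_def by blast
    show "range H \<subseteq> \<H>" using H by (auto simp: \<H>_def)
  qed (auto simp: \<H>_def)
  have h1: "cmod (h z) \<le> 1" if "cmod z < 1" for z
    by (rule LIMSEQ_le_const2[OF tendsto_norm[OF lim]]) (use that H(2) in auto)
  \<comment> \<open>The uniform L1 bound \<open>C\<close> enters here: it prevents the damping
    factors from tending to 0 at the origin.\<close>
  have "exp (- C) \<le> cmod (h 0)"
  proof (rule LIMSEQ_le_const[OF tendsto_norm[OF lim]])
    have "exp (- C) \<le> cmod (H n 0)" for n
      using uC[of n] by (simp add: H_def herglotz_zero)
    then show "\<exists>N. \<forall>n\<ge>N. exp (- C) \<le> cmod (H (r n) 0)" by blast
  qed simp
  then have h0: "h 0 \<noteq> 0" by (metis exp_gt_zero norm_zero not_less)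
  have fh: "cmod (f z * h z) \<le> 1" if z: "cmod z < 1" for z
  proof -
    have "cmod (f (of_real (radius n) * z)) \<le> exp (LINT t|circle_measure. poisson_kernel z t * u n t)" for n
    proof (rule norm_le_exp_poisson_integral[OF cont holomorphic_dilation[OF hol radius_bounds] uc _ z])
      show "cmod (f (of_real (radius n) * t)) \<le> exp (u n t)" for t by (simp add: u_def exp_ln_plus)
    qed
    then have "cmod (f (of_real (radius n) * z)) * cmod (H n z)
        \<le> exp (LINT t|circle_measure. poisson_kernel z t * u n t) * exp (- (LINT t|circle_measure. poisson_kernel z t * u n t))" for n
      unfolding H(3)[OF z] by (rule mult_right_mono) simp
    then have le: "cmod (f (of_real (radius n) * z) * H n z) \<le> 1" for n
      by (simp add: norm_mult flip: exp_add)
    have "(\<lambda>n. f (of_real (radius (r n)) * z) * H (r n) z) \<longlonglongrightarrow> f z * h z"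
      using LIMSEQ_subseq_LIMSEQ[OF tendsto_dilation[OF hol z] r] lim[of z] z
      by (intro tendsto_mult) (auto simp: o_def)
    from LIMSEQ_le_const2[OF tendsto_norm[OF this]] show ?thesis using le by blast
  qed
  have gh: "(\<lambda>z. f z * h z) holomorphic_on ball 0 1" by (intro holomorphic_intros hol h)
  obtain gb where gb: "has_boundary_function (\<lambda>z. f z * h z) gb"
    using bounded_holomorphic_boundary[OF gh fh] by blast
  obtain hb where hb: "has_boundary_function h hb"
    using bounded_holomorphic_boundary[OF h h1] by blast
  \<comment> \<open>A bounded function that does not vanish at 0 has nonzero boundary values almost
    everywhere, so the limits of f * h and h can be divided.\<close>
  have "AE t in circle_measure. hb t \<noteq> 0"
    using smirnov_poisson_inequality(1)[OF scalar_smirnov_bounded[OF h h1] hb, of 0] h0 by simp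
  then have "AE t in circle_measure. \<exists>l. ((\<lambda>r. f (of_real r * t)) \<longlongrightarrow> l) (at_left 1)"
    using gb[unfolded has_boundary_function_def, THEN conjunct2] hb[unfolded has_boundary_function_def, THEN conjunct2]
  proof eventually_elim
    fix t assume nz: "hb t \<noteq> 0" and g: "((\<lambda>r. f (of_real r * t) * h (of_real r * t)) \<longlongrightarrow> gb t) (at_left 1)"
      and h: "((\<lambda>r. h (of_real r * t)) \<longlongrightarrow> hb t) (at_left 1)"
    have "((\<lambda>r. f (of_real r * t) * h (of_real r * t) / h (of_real r * t)) \<longlongrightarrow> gb t / hb t) (at_left 1)"
      by (intro tendsto_divide g h nz)
    moreover have "\<forall>\<^sub>F r in at_left 1. f (of_real r * t) * h (of_real r * t) / h (of_real r * t) = f (of_real r * t)"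
      using tendsto_imp_eventually_ne[OF h nz] by eventually_elim simp
    ultimately have "((\<lambda>r. f (of_real r * t)) \<longlongrightarrow> gb t / hb t) (at_left 1)"
      by (rule Lim_transform_eventually)
    then show "\<exists>l. ((\<lambda>r. f (of_real r * t)) \<longlongrightarrow> l) (at_left 1)" ..
  qed
  then show ?thesis using has_boundary_functionI[OF hol] that by blast
qed

text \<open>The Herglotz integral of \<open>w\<close> has real part 0, so conjugation changes only
  its sign. On the circle of radius 1/2 its n-th Fourier coefficient, n > 0, thereby equals the
  negative of a conjugated coefficient of index -n, and those vanish for a holomorphic function. So
  all coefficients of \<open>w\<close> vanish.\<close>

lemma poisson_integral_zero_imp_AE_zero:
  assumes w: "integrable circle_measure w"
    and zero: "\<And>z. cmod z < 1 \<Longrightarrow> (LINT t|circle_measure. poisson_kernel z t * w t) = 0"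
  shows "AE t in circle_measure. w t = 0"
proof (rule circle_integral_zero_imp_AE_zero[OF w])
  fix n
  define a where "a n = (if n = 0 then 1 else 2) * (LINT t|circle_measure. cnj t ^ n * of_real (w t))" for n :: nat
  have s: "(\<lambda>n. a n * z ^ n) sums herglotz w z" if "cmod z < 1" for z
    unfolding a_def by (rule herglotz_sums[OF w that])
  have hol: "herglotz w holomorphic_on ball 0 1" by (rule herglotz_holomorphic[OF w])
  have re: "cnj (herglotz w z) = - herglotz w z" if "cmod z < 1" for z
    using zero[OF that] Re_herglotz[OF w that] by (simp add: complex_eq_iff)
  have h: "0 \<le> (1/2 :: real)" "(1/2 :: real) < 1" by auto
  let ?F = "\<lambda>t. herglotz w (of_real (1/2) * t)"
  show "(LINT t|circle_measure. cnj t ^ n * of_real (w t)) = 0"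
  proof (cases "n = 0")
    case True
    have "(LINT t|circle_measure. w t) = 0"
      using zero[of 0] Re_herglotz[OF w, of 0] by (simp add: herglotz_zero)
    then show ?thesis using True by simp
  next
    case False
    have "a n * of_real (1/2) ^ n = (LINT t|circle_measure. ?F t * cnj t ^ n)"
      by (rule power_series_coefficient[OF s h, symmetric])
    also have "\<dots> = (LINT t|circle_measure. cnj (- (?F t * t ^ n)))"
    proof (intro Bochner_Integration.integral_cong refl)
      fix t assume "t \<in> space circle_measure"
      then have "cmod (of_real (1/2) * t) < 1" by (simp add: norm_mult)
      from re[OF this] show "?F t * cnj t ^ n = cnj (- (?F t * t ^ n))" by simp
    qed
    also have "\<dots> = cnj (- (LINT t|circle_measure. ?F t * t ^ n))"
      by (simp only: lebesgue_integral_cnj Bochner_Integration.integral_minus)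
    also have "(LINT t|circle_measure. ?F t * t ^ n) = ?F 0 * 0 ^ n"
      using False
      by (intro circle_integral_holomorphic continuous_intros holomorphic_intros holomorphic_dilation[OF hol h]
          continuous_on_circle_dilation[OF holomorphic_on_imp_continuous_on[OF hol] h])
    finally have "a n * of_real (1/2) ^ n = 0" using False by simp
    then have "a n = 0" by simp
    then show ?thesis using False by (simp add: a_def)
  qed
qed

section \<open>Boundary behaviour of Herglotz integrals\<close>

text \<open>For bounded \<open>u\<close> both \<open>e\<close> and its reciprocal are bounded, and
  the Poisson inequality holds for each. Together they are an equality of Poisson integrals at every
  point of the disc, and uniqueness identifies ln|e| on the circle with - u.\<close>

lemma herglotz_radial_limit_bounded:
  assumes m: "u \<in> borel_measurable circle_measure" and B: "\<And>t. t \<in> unit_circle \<Longrightarrow> \<bar>u t\<bar> \<le> B"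
  shows "AE t in circle_measure. ((\<lambda>r. Re (herglotz u (of_real r * t))) \<longlongrightarrow> u t) (at_left 1)"
proof -
  let ?M = circle_measure
  have u: "integrable ?M u" using B by (intro circle.integrable_const_bound[of _ B] AE_I2 m) auto
  have intP: "integrable ?M (\<lambda>t. poisson_kernel z t * w t)" if "integrable ?M w" "cmod z < 1" for w z
    using integrable_poisson_kernel_mult[OF that] by simp
  have hol: "herglotz u holomorphic_on ball 0 1" by (rule herglotz_holomorphic[OF u])
  have ReB: "\<bar>Re (herglotz u z)\<bar> \<le> B" if z: "cmod z < 1" for z
  proof -
    have "\<bar>Re (herglotz u z)\<bar> \<le> (LINT t|?M. \<bar>poisson_kernel z t * u t\<bar>)"
      unfolding Re_herglotz[OF u z] by (rule integral_abs_bound)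
    also have "\<dots> \<le> (LINT t|?M. poisson_kernel z t * B)"
    proof (rule integral_mono)
      show "integrable ?M (\<lambda>t. \<bar>poisson_kernel z t * u t\<bar>)" by (intro integrable_abs intP u z)
      show "integrable ?M (\<lambda>t. poisson_kernel z t * B)" by (intro intP z) auto
      fix t assume "t \<in> space ?M"
      then show "\<bar>poisson_kernel z t * u t\<bar> \<le> poisson_kernel z t * B"
        using poisson_kernel_bounds(3)[OF _ z, of t] B[of t] by (simp add: abs_mult mult_left_mono)
    qed
    also have "\<dots> = B" by (simp add: poisson_kernel_integral[OF z])
    finally show ?thesis .
  qed
  define e where "e z = exp (- herglotz u z)" for z
  have e: "e holomorphic_on ball 0 1" and e': "(\<lambda>z. 1 / e z) holomorphic_on ball 0 1"
    unfolding e_def by (intro holomorphic_intros hol; simp)+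
  have eB: "cmod (e z) \<le> exp B" "cmod (1 / e z) \<le> exp B" if "cmod z < 1" for z
  proof -
    show "cmod (e z) \<le> exp B" using ReB[OF that] by (simp add: e_def)
    have "1 / e z = exp (herglotz u z)" unfolding e_def exp_minus by (simp add: divide_inverse)
    then show "cmod (1 / e z) \<le> exp B" using ReB[OF that] by simp
  qed
  have ln_e: "ln (cmod (e z)) = - Re (herglotz u z)" for z by (simp add: e_def)
  obtain eb where eb: "has_boundary_function e eb"
    using bounded_holomorphic_boundary[OF e eB(1)] by blast
  have "scalar_smirnov e" "scalar_smirnov (\<lambda>z. 1 / e z)"
    by (rule scalar_smirnov_bounded[OF e eB(1)] scalar_smirnov_bounded[OF e' eB(2)]; assumption)+
  note S = smirnov_poisson_inequality[OF this(1) eb] and sm' = this(2)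
  have nz: "AE t in ?M. eb t \<noteq> 0" using S(1)[of 0] by (simp add: e_def)
  have int: "integrable ?M (\<lambda>t. ln (cmod (eb t)))" using S(2)[of 0] by (simp add: e_def)
  have eb': "has_boundary_function (\<lambda>z. 1 / e z) (\<lambda>t. 1 / eb t)"
    unfolding has_boundary_function_def
  proof
    have "eb \<in> borel_measurable ?M" using eb by (simp add: has_boundary_function_def)
    then show "(\<lambda>t. 1 / eb t) \<in> borel_measurable ?M" by measurable
    show "AE t in ?M. ((\<lambda>r. 1 / e (of_real r * t)) \<longlongrightarrow> 1 / eb t) (at_left 1)"
      using nz eb[unfolded has_boundary_function_def, THEN conjunct2]
      by eventually_elim (intro tendsto_intros)
  qed
  note S' = smirnov_poisson_inequality[OF sm' eb']
  have "(LINT t|?M. poisson_kernel z t * (u t + ln (cmod (eb t)))) = 0" if z: "cmod z < 1" for z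
  proof -
    have "- Re (herglotz u z) \<le> (LINT t|?M. poisson_kernel z t * ln (cmod (eb t)))"
      using S(3)[OF z] by (simp add: ln_e) (simp add: e_def)
    moreover have "Re (herglotz u z) \<le> (LINT t|?M. poisson_kernel z t * ln (cmod (1 / eb t)))"
    proof -
      have "1 / e z \<noteq> 0" by (simp add: e_def)
      have "ln (cmod (1 / e z)) = Re (herglotz u z)"
        using ln_e[of z] by (simp add: norm_divide ln_div e_def)
      then show ?thesis using S'(3)[OF z \<open>1 / e z \<noteq> 0\<close>] by simp
    qed
    moreover have "(LINT t|?M. poisson_kernel z t * ln (cmod (1 / eb t)))
        = (LINT t|?M. - (poisson_kernel z t * ln (cmod (eb t))))"
    proof (rule integral_cong_AE)
      show "AE t in ?M. poisson_kernel z t * ln (cmod (1 / eb t)) = - (poisson_kernel z t * ln (cmod (eb t)))"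
        using nz by eventually_elim (simp add: norm_divide ln_div)
      have [measurable]: "eb \<in> borel_measurable ?M" using eb by (simp add: has_boundary_function_def)
      show "(\<lambda>t. poisson_kernel z t * ln (cmod (1 / eb t))) \<in> borel_measurable ?M"
        "(\<lambda>t. - (poisson_kernel z t * ln (cmod (eb t)))) \<in> borel_measurable ?M" by measurable
    qed
    moreover have "(LINT t|?M. poisson_kernel z t * (u t + ln (cmod (eb t))))
        = Re (herglotz u z) + (LINT t|?M. poisson_kernel z t * ln (cmod (eb t)))"
      unfolding Re_herglotz[OF u z] distrib_left by (intro Bochner_Integration.integral_add intP u int z)
    ultimately show ?thesis by simp
  qed
  then have "AE t in ?M. u t + ln (cmod (eb t)) = 0"
    by (intro poisson_integral_zero_imp_AE_zero Bochner_Integration.integrable_add u int)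
  then show ?thesis
    using nz eb[unfolded has_boundary_function_def, THEN conjunct2]
  proof eventually_elim
    fix t assume 0: "u t + ln (cmod (eb t)) = 0" and nz: "eb t \<noteq> 0"
      and l: "((\<lambda>r. e (of_real r * t)) \<longlongrightarrow> eb t) (at_left 1)"
    have "((\<lambda>r. - ln (cmod (e (of_real r * t)))) \<longlongrightarrow> - ln (cmod (eb t))) (at_left 1)"
      using nz by (intro tendsto_intros l) auto
    moreover have "- ln (cmod (eb t)) = u t" using 0 by simp
    ultimately show "((\<lambda>r. Re (herglotz u (of_real r * t))) \<longlongrightarrow> u t) (at_left 1)"
      by (simp add: ln_e)
  qed
qed

lemma Re_herglotz_mono:
  assumes u: "integrable circle_measure u" "integrable circle_measure v"
    and le: "AE t in circle_measure. u t \<le> v t" and z: "cmod z < 1"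
  shows "Re (herglotz u z) \<le> Re (herglotz v z)"
  unfolding Re_herglotz[OF u(1) z] Re_herglotz[OF u(2) z]
proof (rule integral_mono_AE)
  show "integrable circle_measure (\<lambda>t. poisson_kernel z t * u t)" "integrable circle_measure (\<lambda>t. poisson_kernel z t * v t)"
    using integrable_poisson_kernel_mult[OF u(1) z] integrable_poisson_kernel_mult[OF u(2) z] by auto
  show "AE t in circle_measure. poisson_kernel z t * u t \<le> poisson_kernel z t * v t"
    using AE_space le
  proof eventually_elim
    fix t assume "t \<in> space circle_measure" "u t \<le> v t"
    then show "poisson_kernel z t * u t \<le> poisson_kernel z t * v t"
      using poisson_kernel_bounds(3)[of t z] z by (intro mult_left_mono) auto
  qed
qed

text \<open>The reciprocal of \<open>e\<close> may be unbounded, so only one Poisson inequality is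
  at hand. It exists at 0 and says that the radial limit has integral at most that of
  \<open>u\<close>. Comparison with the truncations \<open>min (u t) k\<close> shows that the limit
  is at least \<open>u\<close>. Both can hold only with equality almost everywhere.\<close>

lemma herglotz_radial_limit_nonneg:
  assumes u: "integrable circle_measure u" and u0: "\<And>t. t \<in> unit_circle \<Longrightarrow> 0 \<le> u t"
  shows "AE t in circle_measure. ((\<lambda>r. Re (herglotz u (of_real r * t))) \<longlongrightarrow> u t) (at_left 1)"
proof -
  let ?M = circle_measure
  have [measurable]: "u \<in> borel_measurable ?M" using u by auto
  define e where "e z = exp (- herglotz u z)" for z
  have e: "e holomorphic_on ball 0 1" and e1: "cmod z < 1 \<Longrightarrow> cmod (e z) \<le> 1" for z
    unfolding e_def using exp_herglotz[OF u u0] by auto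
  have ln_e: "ln (cmod (e z)) = - Re (herglotz u z)" for z by (simp add: e_def)
  obtain eb where eb: "has_boundary_function e eb"
    using bounded_holomorphic_boundary[OF e e1] by blast
  have "scalar_smirnov e" by (rule scalar_smirnov_bounded[OF e e1])
  note S = smirnov_poisson_inequality[OF this eb]
  have e0: "e 0 \<noteq> 0" by (simp add: e_def)
  have nz: "AE t in ?M. eb t \<noteq> 0" using S(1)[OF _ e0] by simp
  have int: "integrable ?M (\<lambda>t. ln (cmod (eb t)))" using S(2)[OF _ e0] by simp
  have lim: "AE t in ?M. ((\<lambda>r. Re (herglotz u (of_real r * t))) \<longlongrightarrow> - ln (cmod (eb t))) (at_left 1)"
    using nz eb[unfolded has_boundary_function_def, THEN conjunct2]
  proof eventually_elim
    fix t assume nz: "eb t \<noteq> 0" and l: "((\<lambda>r. e (of_real r * t)) \<longlongrightarrow> eb t) (at_left 1)"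
    have "((\<lambda>r. - ln (cmod (e (of_real r * t)))) \<longlongrightarrow> - ln (cmod (eb t))) (at_left 1)"
      using nz by (intro tendsto_intros l) auto
    then show "((\<lambda>r. Re (herglotz u (of_real r * t))) \<longlongrightarrow> - ln (cmod (eb t))) (at_left 1)"
      by (simp add: ln_e)
  qed
  define v where "v k t = min (u t) (real k)" for k :: nat and t
  have "AE t in ?M. ((\<lambda>r. Re (herglotz (v k) (of_real r * t))) \<longlongrightarrow> v k t) (at_left 1)" for k
  proof (rule herglotz_radial_limit_bounded)
    show "v k \<in> borel_measurable ?M" unfolding v_def[abs_def] by measurable
    show "\<bar>v k t\<bar> \<le> real k" if "t \<in> unit_circle" for t using u0[OF that] by (auto simp: v_def)
  qed
  then have vlim: "AE t in ?M. \<forall>k. ((\<lambda>r. Re (herglotz (v k) (of_real r * t))) \<longlongrightarrow> v k t) (at_left 1)"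
    by (simp add: AE_all_countable)
  have vint: "integrable ?M (v k)" for k
    using u0 by (intro circle.integrable_const_bound[of _ "real k"] AE_I2) (auto simp: v_def[abs_def])
  have ge: "AE t in ?M. 0 \<le> - ln (cmod (eb t)) - u t"
    using AE_space lim vlim
  proof eventually_elim
    fix t assume t: "t \<in> space ?M"
      and l: "((\<lambda>r. Re (herglotz u (of_real r * t))) \<longlongrightarrow> - ln (cmod (eb t))) (at_left 1)"
      and vl: "\<forall>k. ((\<lambda>r. Re (herglotz (v k) (of_real r * t))) \<longlongrightarrow> v k t) (at_left 1)"
    obtain k :: nat where k: "u t \<le> k" using real_arch_simple by blast
    have "\<forall>\<^sub>F r in at_left (1::real). Re (herglotz (v k) (of_real r * t)) \<le> Re (herglotz u (of_real r * t))"
      unfolding eventually_at_left_field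
      by (intro exI[of _ 0])
         (use t in \<open>auto simp: norm_mult v_def[abs_def] intro!: Re_herglotz_mono u vint[unfolded v_def[abs_def]]\<close>)
    then have "v k t \<le> - ln (cmod (eb t))"
      by (rule tendsto_le[OF _ l vl[rule_format, of k], rotated]) simp
    then show "0 \<le> - ln (cmod (eb t)) - u t" using k by (simp add: v_def)
  qed
  have i: "integrable ?M (\<lambda>t. - ln (cmod (eb t)) - u t)"
    by (intro Bochner_Integration.integrable_diff integrable_minus int u)
  have "(LINT t|?M. - ln (cmod (eb t)) - u t) \<le> 0"
  proof -
    have P0: "poisson_kernel 0 t = 1" if "cmod t = 1" for t
      using that by (auto simp: poisson_kernel_def)
    have "- (LINT t|?M. u t) = ln (cmod (e 0))"
      by (simp add: ln_e herglotz_zero)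
    also have "\<dots> \<le> (LINT t|?M. poisson_kernel 0 t * ln (cmod (eb t)))" using S(3)[OF _ e0] by simp
    also have "\<dots> = (LINT t|?M. ln (cmod (eb t)))"
      by (intro Bochner_Integration.integral_cong refl) (simp add: P0)
    finally show ?thesis using int u by simp
  qed
  then have "(LINT t|?M. - ln (cmod (eb t)) - u t) = 0"
    using integral_nonneg_AE[OF ge] by simp
  then have "AE t in ?M. - ln (cmod (eb t)) - u t = 0"
    using integral_nonneg_eq_0_iff_AE[OF i ge] by simp
  then show ?thesis using lim by eventually_elim simp
qed

lemma herglotz_radial_limit:
  assumes u: "integrable circle_measure u"
  shows "AE t in circle_measure. ((\<lambda>r. Re (herglotz u (of_real r * t))) \<longlongrightarrow> u t) (at_left 1)"
proof -
  let ?M = circle_measure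
  define p q where "p t = max 0 (u t)" and "q t = max 0 (- u t)" for t
  have int: "integrable ?M p" "integrable ?M q" unfolding p_def[abs_def] q_def[abs_def] using u by auto
  have pq: "u t = p t - q t" for t by (auto simp: p_def q_def)
  have eq: "Re (herglotz u z) = Re (herglotz p z) - Re (herglotz q z)" if z: "cmod z < 1" for z
  proof -
    have "Re (herglotz u z) = (LINT t|?M. poisson_kernel z t * p t - poisson_kernel z t * q t)"
      unfolding Re_herglotz[OF u z] by (simp only: pq right_diff_distrib)
    then show ?thesis
      using integrable_poisson_kernel_mult[OF int(1) z] integrable_poisson_kernel_mult[OF int(2) z]
      by (simp add: Re_herglotz int z)
  qed
  have "AE t in ?M. ((\<lambda>r. Re (herglotz p (of_real r * t))) \<longlongrightarrow> p t) (at_left 1)"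
    "AE t in ?M. ((\<lambda>r. Re (herglotz q (of_real r * t))) \<longlongrightarrow> q t) (at_left 1)"
    by (intro herglotz_radial_limit_nonneg int; simp add: p_def q_def)+
  with AE_space show ?thesis
  proof eventually_elim
    fix t assume t: "t \<in> space ?M"
      and "((\<lambda>r. Re (herglotz p (of_real r * t))) \<longlongrightarrow> p t) (at_left 1)"
      "((\<lambda>r. Re (herglotz q (of_real r * t))) \<longlongrightarrow> q t) (at_left 1)"
    then have l: "((\<lambda>r. Re (herglotz p (of_real r * t)) - Re (herglotz q (of_real r * t))) \<longlongrightarrow> u t) (at_left 1)"
      unfolding pq by (intro tendsto_diff)
    have "\<forall>\<^sub>F r in at_left (1::real). Re (herglotz p (of_real r * t)) - Re (herglotz q (of_real r * t))
        = Re (herglotz u (of_real r * t))"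
      unfolding eventually_at_left_field
      by (intro exI[of _ 0]) (use t in \<open>auto simp: norm_mult eq\<close>)
    with l show "((\<lambda>r. Re (herglotz u (of_real r * t))) \<longlongrightarrow> u t) (at_left 1)"
      by (rule Lim_transform_eventually)
  qed
qed

text \<open>Since \<open>\<bar>\<phi>\<bar> \<le> 1\<close>, one has \<open>\<integral> \<bar>\<phi> - 1\<bar>\<^sup>2 \<le> 2 - 2 Re \<phi>(0)\<close> on the circle.\<close>

lemma exp_herglotz_boundary_subseq:
  fixes v :: "nat \<Rightarrow> complex \<Rightarrow> real"
  assumes v: "\<And>k. integrable circle_measure (v k)" "\<And>k t. t \<in> unit_circle \<Longrightarrow> 0 \<le> v k t"
    and lim: "(\<lambda>k. LINT t|circle_measure. v k t) \<longlonglongrightarrow> 0"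
    and b: "\<And>k. has_boundary_function (\<lambda>z. exp (- herglotz (v k) z)) (b k)"
  obtains s :: "nat \<Rightarrow> nat" where "strict_mono s" "AE t in circle_measure. (\<lambda>k. b (s k) t) \<longlonglongrightarrow> 1"
proof -
  let ?M = circle_measure
  note E = exp_herglotz[OF v]
  have [measurable]: "b k \<in> borel_measurable ?M" for k using b[of k] by (simp add: has_boundary_function_def)
  have b1: "AE t in ?M. cmod (b k t) \<le> 1" for k
    by (rule boundary_function_bound[OF b E(2)])
  have intb: "integrable ?M (b k)" for k
    by (rule circle.integrable_const_bound[OF b1]) simp
  have mean: "(LINT t|?M. b k t) = exp (- of_real (LINT t|?M. v k t))" for k
  proof -
    have "(LINT t|?M. b k t) = (LINT t|?M. of_real (poisson_kernel 0 t) * b k t)"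
      by (intro Bochner_Integration.integral_cong refl) (auto simp: poisson_kernel_def)
    also have "\<dots> = exp (- herglotz (v k) 0)"
      by (rule bounded_poisson_representation[OF E(1) E(2) b]) auto
    finally show ?thesis by (simp add: herglotz_zero)
  qed
  have int2: "integrable ?M (\<lambda>t. (cmod (b k t - 1))\<^sup>2)" for k
  proof (rule circle.integrable_const_bound[of _ 4])
    show "AE t in ?M. norm ((cmod (b k t - 1))\<^sup>2) \<le> 4"
      using b1[of k]
    proof eventually_elim
      fix t assume "cmod (b k t) \<le> 1"
      then have "cmod (b k t - 1) \<le> 2" using norm_triangle_ineq4[of "b k t" 1] by simp
      then have "(cmod (b k t - 1))\<^sup>2 \<le> 2\<^sup>2" by (intro power_mono) auto
      then show "norm ((cmod (b k t - 1))\<^sup>2) \<le> 4" by simp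
    qed
  qed measurable
  have le: "(LINT t|?M. (cmod (b k t - 1))\<^sup>2) \<le> 2 - 2 * exp (- (LINT t|?M. v k t))" for k
  proof -
    have "(LINT t|?M. (cmod (b k t - 1))\<^sup>2) \<le> (LINT t|?M. 2 - 2 * Re (b k t))"
    proof (rule integral_mono_AE[OF int2])
      show "integrable ?M (\<lambda>t. 2 - 2 * Re (b k t))"
        by (intro Bochner_Integration.integrable_diff integrable_mult_right integrable_Re intb) auto
      show "AE t in ?M. (cmod (b k t - 1))\<^sup>2 \<le> 2 - 2 * Re (b k t)"
        using b1[of k]
      proof eventually_elim
        fix t assume "cmod (b k t) \<le> 1"
        then have "(cmod (b k t))\<^sup>2 \<le> 1" by (simp add: abs_square_le_1)
        then show "(cmod (b k t - 1))\<^sup>2 \<le> 2 - 2 * Re (b k t)"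
        proof -
          have "(cmod (b k t - 1))\<^sup>2 = (cmod (b k t))\<^sup>2 + 1 - 2 * Re (b k t)"
            unfolding cmod_power2 by (simp add: power2_eq_square algebra_simps)
          with \<open>(cmod (b k t))\<^sup>2 \<le> 1\<close> show ?thesis by simp
        qed
      qed
    qed
    also have "\<dots> = 2 - 2 * Re (LINT t|?M. b k t)"
      using intb[of k] by simp
    also have "Re (LINT t|?M. b k t) = exp (- (LINT t|?M. v k t))"
      unfolding mean by (simp only: of_real_minus[symmetric] exp_of_real Re_complex_of_real)
    finally show ?thesis .
  qed
  have "(\<lambda>k. 2 - 2 * exp (- (LINT t|?M. v k t))) \<longlonglongrightarrow> 2 - 2 * exp (- 0)"
    by (intro tendsto_intros lim)
  then have up: "(\<lambda>k. 2 - 2 * exp (- (LINT t|?M. v k t))) \<longlonglongrightarrow> 0" by simp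
  have "(\<lambda>k. LINT t|?M. (cmod (b k t - 1))\<^sup>2) \<longlonglongrightarrow> 0"
  proof (rule tendsto_sandwich[OF _ _ tendsto_const up])
    show "\<forall>\<^sub>F k in sequentially. 0 \<le> (LINT t|?M. (cmod (b k t - 1))\<^sup>2)" by simp
    show "\<forall>\<^sub>F k in sequentially. (LINT t|?M. (cmod (b k t - 1))\<^sup>2) \<le> 2 - 2 * exp (- (LINT t|?M. v k t))"
      using le by simp
  qed
  then have "(\<lambda>k. LINT t|?M. norm ((cmod (b k t - 1))\<^sup>2)) \<longlonglongrightarrow> 0" by simp
  from tendsto_L1_AE_subseq[OF int2 this] obtain s :: "nat \<Rightarrow> nat" where s: "strict_mono s"
    and AE: "AE t in ?M. (\<lambda>k. (cmod (b (s k) t - 1))\<^sup>2) \<longlonglongrightarrow> 0" by blast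
  have "AE t in ?M. (\<lambda>k. b (s k) t) \<longlonglongrightarrow> 1"
    using AE
  proof eventually_elim
    fix t assume "(\<lambda>k. (cmod (b (s k) t - 1))\<^sup>2) \<longlonglongrightarrow> 0"
    from tendsto_real_sqrt[OF this] have "(\<lambda>k. cmod (b (s k) t - 1)) \<longlonglongrightarrow> 0" by simp
    then show "(\<lambda>k. b (s k) t) \<longlonglongrightarrow> 1" by (simp add: tendsto_norm_zero_iff LIM_zero_iff)
  qed
  then show ?thesis using s that by blast
qed

section \<open>A criterion for outer functions\<close>

lemma holomorphic_unit_modulus_constant:
  assumes f: "f holomorphic_on ball 0 1" and one: "\<And>z. cmod z < 1 \<Longrightarrow> cmod (f z) = 1"
  obtains C where "cmod C = 1" "\<And>z. cmod z < 1 \<Longrightarrow> f z = C"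
proof -
  have "f constant_on ball 0 1"
    by (rule maximum_modulus_principle[OF f, of "ball 0 1" 0]) (auto simp: one)
  then obtain C where C: "\<And>z. z \<in> ball 0 1 \<Longrightarrow> f z = C" unfolding constant_on_def by blast
  show ?thesis using C one[of 0] by (intro that[of C]) auto
qed

lemma has_boundary_function_mult:
  assumes "has_boundary_function f fb" "has_boundary_function g gb"
  shows "has_boundary_function (\<lambda>z. f z * g z) (\<lambda>t. fb t * gb t)"
  unfolding has_boundary_function_def
proof
  show "(\<lambda>t. fb t * gb t) \<in> borel_measurable circle_measure"
    using assms by (intro borel_measurable_times) (auto simp: has_boundary_function_def)
  show "AE t in circle_measure. ((\<lambda>r. f (of_real r * t) * g (of_real r * t)) \<longlongrightarrow> fb t * gb t) (at_left 1)"
    using assms[unfolded has_boundary_function_def] by (auto intro: tendsto_mult elim: AE_mp)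
qed

text \<open>Dividing \<open>d\<close> by the exponential of the Herglotz integral of ln|D| leaves a
  holomorphic function of modulus 1. Its constant value is the unimodular \<open>C\<close> in the
  definition of \<open>outer\<close>, and |D| is the weight.\<close>

lemma outer_if_poisson_representation:
  assumes d: "d holomorphic_on ball 0 1" and D: "integrable circle_measure (\<lambda>t. ln (cmod (D t)))"
    and D0: "AE t in circle_measure. D t \<noteq> 0"
    and nz: "\<And>z. cmod z < 1 \<Longrightarrow> d z \<noteq> 0"
    and eq: "\<And>z. cmod z < 1 \<Longrightarrow> ln (cmod (d z)) = (LINT t|circle_measure. poisson_kernel z t * ln (cmod (D t)))"
  shows "outer d"
proof -
  let ?H = "herglotz (\<lambda>t. ln (cmod (D t)))"
  define q where "q z = d z * exp (- ?H z)" for z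
  have q: "q holomorphic_on ball 0 1"
    unfolding q_def by (intro holomorphic_intros d herglotz_holomorphic D)
  have "cmod (q z) = 1" if z: "cmod z < 1" for z
  proof -
    have "cmod (q z) = cmod (d z) * exp (- ln (cmod (d z)))"
      unfolding q_def norm_mult norm_exp_eq_Re uminus_complex.sel Re_herglotz[OF D z] eq[OF z] ..
    also have "\<dots> = 1" using nz[OF z] by (simp add: exp_minus)
    finally show ?thesis .
  qed
  then obtain C where C: "cmod C = 1" "\<And>z. cmod z < 1 \<Longrightarrow> q z = C"
    using holomorphic_unit_modulus_constant[OF q] by blast
  have "d z = C * exp (LINT t|circle_measure. (t + z) / (t - z) * of_real (ln (cmod (D t))))"
    if "cmod z < 1" for z
    using C(2)[OF that] unfolding q_def herglotz_def by (auto simp: exp_minus field_simps)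
  then show ?thesis
    unfolding outer_def using C(1) D D0 by (intro exI[of _ C] exI[of _ "\<lambda>t. cmod (D t)"]) auto
qed

text \<open>Multiplying \<open>g\<^sub>k d\<close> by an outer function of modulus \<open>1 / max 1 \<bar>g\<^sub>k d\<bar>\<close> on the
  circle gives functions bounded by \<open>1\<close> with boundary values tending to \<open>1\<close> along a subsequence,
  hence \<open>g\<^sub>k d\<close> tends to \<open>1\<close> in the disc. Comparing with the Poisson inequalities for
  \<open>g\<^sub>k\<close> and \<open>d\<close> forces equality in the latter.\<close>

lemma outer_if_approximately_invertible:
  fixes g G :: "nat \<Rightarrow> complex \<Rightarrow> complex"
  assumes d: "scalar_smirnov d" and D: "has_boundary_function d D"
    and g: "\<And>k. g k holomorphic_on ball 0 1" "\<And>k z. cmod z < 1 \<Longrightarrow> cmod (g k z) \<le> B k"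
    and G: "\<And>k. has_boundary_function (g k) (G k)"
    and lim: "AE t in circle_measure. (\<lambda>k. G k t * D t) \<longlonglongrightarrow> 1"
    and ui: "uniformly_integrable circle_measure UNIV (\<lambda>k t. ln_plus (cmod (G k t)))"
  shows "outer d"
proof -
  let ?M = circle_measure
  have fm: "finite_measure ?M" by (rule circle.finite_measure_axioms)
  have hol: "d holomorphic_on ball 0 1" using d by (simp add: scalar_smirnov_def)
  have [measurable]: "D \<in> borel_measurable ?M" using D by (simp add: has_boundary_function_def)
  have [measurable]: "G k \<in> borel_measurable ?M" for k using G[of k] by (simp add: has_boundary_function_def)
  have gs: "scalar_smirnov (g k)" for k by (rule scalar_smirnov_bounded[OF g])
  have intP: "integrable ?M (\<lambda>t. poisson_kernel z t * w t)" if "integrable ?M w" "cmod z < 1" for w z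
    using integrable_poisson_kernel_mult[OF that] by simp
  define h where "h k z = g k z * d z" for k z
  have hh: "h k holomorphic_on ball 0 1" for k unfolding h_def[abs_def] by (intro holomorphic_intros g hol)
  have hs: "scalar_smirnov (h k)" for k
    unfolding scalar_smirnov_def
  proof
    show "uniformly_integrable ?M {0..<1} (\<lambda>r t. ln_plus (cmod (h k (of_real r * t))))"
    proof (rule uniformly_integrable_bound[where h = id and c = "ln_plus (B k)" and k = 1])
      show "uniformly_integrable ?M {0..<1} (\<lambda>r t. ln_plus (cmod (d (of_real r * t))))"
        using d by (simp add: scalar_smirnov_def)
      fix r :: real assume r: "r \<in> {0..<1}"
      have "(\<lambda>t. h k (of_real r * t)) \<in> borel_measurable ?M"
        by (rule measurable_dilation[OF hh]) (use r in auto)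
      then show "(\<lambda>t. ln_plus (cmod (h k (of_real r * t)))) \<in> borel_measurable ?M" by measurable
      show "AE t in ?M. \<bar>ln_plus (cmod (h k (of_real r * t)))\<bar>
          \<le> ln_plus (B k) + 1 * \<bar>ln_plus (cmod (d (of_real (id r) * t)))\<bar>"
      proof (intro AE_I2)
        fix t assume "t \<in> space ?M"
        then have t: "cmod (of_real r * t) < 1" using r by (simp add: norm_mult)
        have "ln_plus (cmod (h k (of_real r * t)))
            \<le> ln_plus (cmod (g k (of_real r * t))) + ln_plus (cmod (d (of_real r * t)))"
          unfolding h_def norm_mult by (intro ln_plus_mult) auto
        then show "\<bar>ln_plus (cmod (h k (of_real r * t)))\<bar>
          \<le> ln_plus (B k) + 1 * \<bar>ln_plus (cmod (d (of_real (id r) * t)))\<bar>"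
          using ln_plus_mono[OF g(2)[OF t, of k]] by simp
      qed
    qed (auto intro: fm)
  qed (rule hh)
  define hb where "hb k t = G k t * D t" for k t
  have [measurable]: "hb k \<in> borel_measurable ?M" for k unfolding hb_def[abs_def] by measurable
  have hb: "has_boundary_function (h k) (hb k)" for k
    unfolding h_def[abs_def] hb_def[abs_def] by (rule has_boundary_function_mult[OF G D])
  define v where "v k t = ln_plus (cmod (hb k t))" for k t
  have intD: "integrable ?M (\<lambda>t. ln_plus (cmod (D t)))"
    by (rule smirnov_boundary_ln_plus_integrable[OF d D])
  \<comment> \<open>The given family dominates \<open>v\<close> up to the fixed integrable function
    ln+|D|. As \<open>v k\<close> tends to 0 almost everywhere, Vitali's theorem gives convergence
    to 0 in L1.\<close>
  have ui_v: "uniformly_integrable ?M UNIV v"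
  proof (rule uniformly_integrable_bound[where h = id and c = 0 and k = 1,
        OF fm uniformly_integrable_add[OF fm ui uniformly_integrable_const[OF fm intD]]])
    show "v k \<in> borel_measurable ?M" for k unfolding v_def[abs_def] by measurable
    show "AE t in ?M. \<bar>v k t\<bar> \<le> 0 + 1 * \<bar>\<bar>ln_plus (cmod (G (id k) t))\<bar> + \<bar>ln_plus (cmod (D t))\<bar>\<bar>" for k
      using ln_plus_mult[of "cmod (G k t)" "cmod (D t)" for t]
      by (intro AE_I2) (simp add: v_def hb_def norm_mult)
  qed auto
  have vint: "integrable ?M (v k)" for k using ui_v by (auto simp: uniformly_integrable_def)
  have v0: "0 \<le> v k t" for k t by (simp add: v_def)
  have "AE t in ?M. (\<lambda>k. v k t) \<longlonglongrightarrow> 0"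
    using lim
  proof eventually_elim
    fix t assume "(\<lambda>k. G k t * D t) \<longlonglongrightarrow> 1"
    then have "(\<lambda>k. v k t) \<longlonglongrightarrow> ln_plus (cmod 1)"
      unfolding v_def hb_def by (intro tendsto_intros)
    then show "(\<lambda>k. v k t) \<longlonglongrightarrow> 0" by (simp add: ln_plus_def)
  qed
  from uniformly_integrable_Vitali(2)[OF fm ui_v _ this]
  have v_lim: "(\<lambda>k. LINT t|?M. v k t) \<longlonglongrightarrow> 0" by (simp add: v0)
  define p where "p k z = exp (- herglotz (v k) z)" for k z
  note P = exp_herglotz[OF vint v0, folded p_def]
  have ph: "p k holomorphic_on ball 0 1" for k using P(1)[of k] by (simp add: p_def[abs_def])
  have "\<exists>b. has_boundary_function (p k) b" for k
    using bounded_holomorphic_boundary[OF ph P(2)] by blast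
  then obtain pb where pb: "\<And>k. has_boundary_function (p k) (pb k)" by metis
  obtain s :: "nat \<Rightarrow> nat" where s: "strict_mono s" and pb1: "AE t in ?M. (\<lambda>k. pb (s k) t) \<longlonglongrightarrow> 1"
    using exp_herglotz_boundary_subseq[OF vint v0 v_lim] pb unfolding p_def[abs_def] by blast
  define f where "f k z = h k z * p k z" for k z
  \<comment> \<open>The Poisson inequality bounds |h k| by exp (P[v k]), and |p k| is the reciprocal
    of that bound.\<close>
  have f1: "cmod (f k z) \<le> 1" if z: "cmod z < 1" for k z
  proof (cases "h k z = 0")
    case False
    note S = smirnov_poisson_inequality[OF hs hb z False]
    have "ln (cmod (h k z)) \<le> (LINT t|?M. poisson_kernel z t * v k t)"
    proof (rule order_trans[OF S(3)], rule integral_mono_AE)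
      show "integrable ?M (\<lambda>t. poisson_kernel z t * ln (cmod (hb k t)))"
        "integrable ?M (\<lambda>t. poisson_kernel z t * v k t)" by (intro intP S(2) vint z)+
      show "AE t in ?M. poisson_kernel z t * ln (cmod (hb k t)) \<le> poisson_kernel z t * v k t"
        using AE_space S(1)
      proof eventually_elim
        fix t assume "t \<in> space ?M" "hb k t \<noteq> 0"
        then show "poisson_kernel z t * ln (cmod (hb k t)) \<le> poisson_kernel z t * v k t"
          using poisson_kernel_bounds(3)[of t z] z unfolding v_def
          by (intro mult_left_mono ln_le_ln_plus) auto
      qed
    qed
    then have "cmod (h k z) \<le> exp (LINT t|?M. poisson_kernel z t * v k t)"
      using False by (metis exp_le_cancel_iff exp_ln zero_less_norm_iff)
    then have "cmod (h k z) * cmod (p k z)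
        \<le> exp (LINT t|?M. poisson_kernel z t * v k t) * exp (- (LINT t|?M. poisson_kernel z t * v k t))"
      unfolding P(3)[OF z] by (rule mult_right_mono) simp
    then show ?thesis by (simp add: f_def norm_mult flip: exp_add)
  qed (simp add: f_def)
  have fh: "f k holomorphic_on ball 0 1" for k unfolding f_def[abs_def] by (intro holomorphic_intros hh ph)
  have fb: "has_boundary_function (f k) (\<lambda>t. hb k t * pb k t)" for k
    unfolding f_def[abs_def] by (rule has_boundary_function_mult[OF hb pb])
  have fb1: "AE t in ?M. cmod (hb k t * pb k t) \<le> 1" for k
    by (rule boundary_function_bound[OF fb f1])
  have [measurable]: "pb k \<in> borel_measurable ?M" for k using pb[of k] by (simp add: has_boundary_function_def)
  \<comment> \<open>The boundary values of \<open>f (s k)\<close> are bounded by 1 and tend to 1, so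
    the Poisson representation gives the limit 1 in the disc. The factor \<open>p (s k)\<close> also
    tends to 1 there, its exponent being bounded by a multiple of the L1 norm of
    \<open>v (s k)\<close>, and can be divided out.\<close>
  have h_lim: "(\<lambda>k. h (s k) z) \<longlonglongrightarrow> 1" if z: "cmod z < 1" for z
  proof -
    let ?c = "(1 + cmod z) / (1 - cmod z)"
    have "(\<lambda>k. LINT t|?M. of_real (poisson_kernel z t) * (hb (s k) t * pb (s k) t))
        \<longlonglongrightarrow> (LINT t|?M. of_real (poisson_kernel z t) * 1)"
    proof (rule integral_dominated_convergence[where w = "\<lambda>_. ?c"])
      show "AE t in ?M. (\<lambda>k. of_real (poisson_kernel z t) * (hb (s k) t * pb (s k) t))
          \<longlonglongrightarrow> of_real (poisson_kernel z t) * 1"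
        using lim pb1
      proof eventually_elim
        fix t assume l: "(\<lambda>k. G k t * D t) \<longlonglongrightarrow> 1" and "(\<lambda>k. pb (s k) t) \<longlonglongrightarrow> 1"
        moreover have "(\<lambda>k. hb (s k) t) \<longlonglongrightarrow> 1"
          using LIMSEQ_subseq_LIMSEQ[OF l s] by (simp add: hb_def o_def)
        ultimately have "(\<lambda>k. of_real (poisson_kernel z t) * (hb (s k) t * pb (s k) t))
          \<longlonglongrightarrow> of_real (poisson_kernel z t) * (1 * 1)" by (intro tendsto_intros)
        then show "(\<lambda>k. of_real (poisson_kernel z t) * (hb (s k) t * pb (s k) t))
          \<longlonglongrightarrow> of_real (poisson_kernel z t) * 1" by simp
      qed
      show "AE t in ?M. norm (of_real (poisson_kernel z t) * (hb (s k) t * pb (s k) t)) \<le> ?c" for k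
        using AE_space fb1[of "s k"]
      proof eventually_elim
        fix t assume "t \<in> space ?M" and 1: "cmod (hb (s k) t * pb (s k) t) \<le> 1"
        then have t: "cmod t = 1" by simp
        have "poisson_kernel z t * cmod (hb (s k) t * pb (s k) t) \<le> ?c * 1"
          using poisson_kernel_bounds[OF t z] 1 by (intro mult_mono) auto
        then show "norm (of_real (poisson_kernel z t) * (hb (s k) t * pb (s k) t)) \<le> ?c"
          using poisson_kernel_bounds(3)[OF t z] by (simp add: norm_mult)
      qed
    qed measurable
    moreover have "(LINT t|?M. of_real (poisson_kernel z t) * (hb k t * pb k t)) = f k z" for k
      by (rule bounded_poisson_representation[OF fh f1 fb z])
    moreover have "(LINT t|?M. complex_of_real (poisson_kernel z t) * 1) = 1"
      using poisson_kernel_integral[OF z] by simp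
    ultimately have fl: "(\<lambda>k. f (s k) z) \<longlonglongrightarrow> 1" by simp
    have "(\<lambda>k. herglotz (v k) z) \<longlonglongrightarrow> 0"
    proof (rule Lim_null_comparison)
      show "(\<lambda>k. 2 / (1 - cmod z) * (LINT t|?M. v k t)) \<longlonglongrightarrow> 0"
        using tendsto_mult[OF tendsto_const[of "2 / (1 - cmod z)"] v_lim] by simp
      show "\<forall>\<^sub>F k in sequentially. norm (herglotz (v k) z) \<le> 2 / (1 - cmod z) * (LINT t|?M. v k t)"
        using herglotz_bound[OF vint z] by (simp add: v0)
    qed
    then have "(\<lambda>k. p k z) \<longlonglongrightarrow> exp (- 0)" unfolding p_def by (intro tendsto_intros)
    then have pl: "(\<lambda>k. p (s k) z) \<longlonglongrightarrow> 1" using LIMSEQ_subseq_LIMSEQ[OF _ s] by (auto simp: o_def)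
    have "(\<lambda>k. f (s k) z / p (s k) z) \<longlonglongrightarrow> 1 / 1" by (intro tendsto_divide fl pl) simp
    then show ?thesis by (simp add: f_def p_def)
  qed
  have dnz: "d z \<noteq> 0" if z: "cmod z < 1" for z
  proof
    assume "d z = 0"
    then have "(\<lambda>k. h (s k) z) = (\<lambda>_. 0)" by (simp add: h_def)
    with h_lim[OF z] show False by (simp add: LIMSEQ_const_iff)
  qed
  note SD = smirnov_poisson_inequality[OF d D]
  have D0: "AE t in ?M. D t \<noteq> 0" and lnD: "integrable ?M (\<lambda>t. ln (cmod (D t)))"
    using SD(1,2)[of 0] dnz[of 0] by auto
  show ?thesis
  proof (rule outer_if_poisson_representation[OF hol lnD D0 dnz])
    fix z :: complex assume z: "cmod z < 1"
    let ?I = "LINT t|?M. poisson_kernel z t * ln (cmod (D t))"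
    have Pv: "(\<lambda>k. LINT t|?M. poisson_kernel z t * v (s k) t) \<longlonglongrightarrow> 0"
    proof -
      have "(\<lambda>k. LINT t|?M. \<bar>v k t - 0\<bar>) \<longlonglongrightarrow> 0" using v_lim by (simp add: v0)
      from poisson_integral_tendsto[OF vint _ this z]
      have "(\<lambda>k. LINT t|?M. poisson_kernel z t * v k t) \<longlonglongrightarrow> 0" by simp
      from LIMSEQ_subseq_LIMSEQ[OF this s] show ?thesis by (simp add: o_def)
    qed
    have "\<forall>\<^sub>F k in sequentially. h (s k) z \<noteq> 0"
      using tendsto_imp_eventually_ne[OF h_lim[OF z]] by simp
    \<comment> \<open>On the circle ln|G| = ln|hb| - ln|D| \<le> v - ln|D|, so the Poisson
      inequality for g yields this upper bound. In the limit it reads 0 \<le> - ?I + ln|d z|, the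
      reverse of the Poisson inequality for \<open>d\<close>.\<close>
    then have ev: "\<forall>\<^sub>F k in sequentially. ln (cmod (h (s k) z))
        \<le> (LINT t|?M. poisson_kernel z t * v (s k) t) - ?I + ln (cmod (d z))"
    proof eventually_elim
      fix k assume "h (s k) z \<noteq> 0"
      then have gnz: "g (s k) z \<noteq> 0" by (simp add: h_def)
      note SG = smirnov_poisson_inequality[OF gs G z gnz]
      have "ln (cmod (g (s k) z)) \<le> (LINT t|?M. poisson_kernel z t * v (s k) t - poisson_kernel z t * ln (cmod (D t)))"
      proof (rule order_trans[OF SG(3)], rule integral_mono_AE)
        show "integrable ?M (\<lambda>t. poisson_kernel z t * ln (cmod (G (s k) t)))" by (intro intP SG(2) z)
        show "integrable ?M (\<lambda>t. poisson_kernel z t * v (s k) t - poisson_kernel z t * ln (cmod (D t)))"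
          by (intro Bochner_Integration.integrable_diff intP vint lnD z)
        show "AE t in ?M. poisson_kernel z t * ln (cmod (G (s k) t))
            \<le> poisson_kernel z t * v (s k) t - poisson_kernel z t * ln (cmod (D t))"
          using AE_space SG(1) D0
        proof eventually_elim
          fix t assume "t \<in> space ?M" and nz: "G (s k) t \<noteq> 0" "D t \<noteq> 0"
          then have t: "cmod t = 1" by simp
          have "ln (cmod (hb (s k) t)) = ln (cmod (G (s k) t)) + ln (cmod (D t))"
            using nz by (simp add: hb_def norm_mult ln_mult)
          moreover have "ln (cmod (hb (s k) t)) \<le> v (s k) t"
            unfolding v_def using nz by (intro ln_le_ln_plus) (simp add: hb_def)
          ultimately have "poisson_kernel z t * ln (cmod (G (s k) t))
              \<le> poisson_kernel z t * (v (s k) t - ln (cmod (D t)))"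
            using poisson_kernel_bounds(3)[OF t z] by (intro mult_left_mono) auto
          then show "poisson_kernel z t * ln (cmod (G (s k) t))
            \<le> poisson_kernel z t * v (s k) t - poisson_kernel z t * ln (cmod (D t))"
            by (simp add: right_diff_distrib)
        qed
      qed
      also have "\<dots> = (LINT t|?M. poisson_kernel z t * v (s k) t) - ?I"
        by (intro Bochner_Integration.integral_diff intP vint lnD z)
      finally show "ln (cmod (h (s k) z)) \<le> (LINT t|?M. poisson_kernel z t * v (s k) t) - ?I + ln (cmod (d z))"
        using gnz dnz[OF z] by (simp add: h_def norm_mult ln_mult)
    qed
    have "(\<lambda>k. ln (cmod (h (s k) z))) \<longlonglongrightarrow> ln (cmod 1)"
      by (intro tendsto_intros h_lim z) auto
    moreover have "(\<lambda>k. (LINT t|?M. poisson_kernel z t * v (s k) t) - ?I + ln (cmod (d z)))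
        \<longlonglongrightarrow> 0 - ?I + ln (cmod (d z))"
      by (intro tendsto_intros Pv)
    ultimately have "ln (cmod 1) \<le> 0 - ?I + ln (cmod (d z))"
      using ev by (intro tendsto_le[OF sequentially_bot])
    then show "ln (cmod (d z)) = ?I" using SD(3)[OF z dnz[OF z]] by simp
  qed
qed

section \<open>Operator norm, determinants and Cramer's rule\<close>

lemma cmod_entry_le_op_norm: "cmod (A $ i $ j) \<le> op_norm A"
proof -
  have "cmod (A $ i $ j) = cmod ((A *v axis j 1) $ i)"
    by (simp add: matrix_vector_mult_def axis_def if_distrib cong: if_cong)
  also have "\<dots> \<le> norm (A *v axis j 1)" by (rule Finite_Cartesian_Product.norm_nth_le)
  also have "\<dots> \<le> onorm (\<lambda>v. A *v v) * norm (axis j (1::complex))"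
    by (rule onorm) (rule matrix_vector_mul_bounded_linear)
  also have "norm (axis j (1::complex)) = 1"
    by (simp add: norm_vec_def L2_set_def axis_def if_distrib[of norm] if_distrib[of "\<lambda>x. x\<^sup>2"] cong: if_cong)
  finally show ?thesis by (simp add: op_norm_def)
qed

lemma op_norm_le_sum: "op_norm A \<le> (\<Sum>i\<in>UNIV. \<Sum>j\<in>UNIV. cmod (A $ i $ j))"
  unfolding op_norm_def
proof (rule onorm_bound)
  fix x :: "complex ^ 'a"
  have "norm (A *v x) \<le> (\<Sum>i\<in>UNIV. cmod ((A *v x) $ i))"
    unfolding norm_vec_def by (rule L2_set_le_sum) simp
  also have "\<dots> \<le> (\<Sum>i\<in>UNIV. \<Sum>j\<in>UNIV. cmod (A $ i $ j) * norm x)"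
  proof (rule sum_mono)
    fix i
    have "cmod ((A *v x) $ i) \<le> (\<Sum>j\<in>UNIV. cmod (A $ i $ j * x $ j))"
      unfolding matrix_vector_mult_def by (simp add: norm_sum)
    also have "\<dots> \<le> (\<Sum>j\<in>UNIV. cmod (A $ i $ j) * norm x)"
      unfolding norm_mult by (intro sum_mono mult_left_mono Finite_Cartesian_Product.norm_nth_le) auto
    finally show "cmod ((A *v x) $ i) \<le> (\<Sum>j\<in>UNIV. cmod (A $ i $ j) * norm x)" .
  qed
  also have "\<dots> = (\<Sum>i\<in>UNIV. \<Sum>j\<in>UNIV. cmod (A $ i $ j)) * norm x"
    by (simp add: sum_distrib_right)
  finally show "norm (A *v x) \<le> (\<Sum>i\<in>UNIV. \<Sum>j\<in>UNIV. cmod (A $ i $ j)) * norm x" .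
qed (intro sum_nonneg, simp)

lemma op_norm_triangle: "op_norm A \<le> op_norm B + op_norm (A - B)"
proof -
  have "op_norm A = onorm (\<lambda>v. B *v v + (A - B) *v v)"
    unfolding op_norm_def by (simp add: matrix_vector_mult_diff_rdistrib)
  also have "\<dots> \<le> op_norm B + op_norm (A - B)"
    unfolding op_norm_def by (intro onorm_triangle matrix_vector_mul_bounded_linear)
  finally show ?thesis .
qed

text \<open>Convergence in the type \<open>complex ^ 'n ^ 'n\<close> refers to another norm, so it
  is passed through the entries: operator norms of two matrices differ by at most the sum of the
  moduli of the entries of their difference.\<close>

lemma tendsto_op_norm:
  fixes A :: "'a \<Rightarrow> complex ^ 'n ^ 'n"
  assumes A: "(A \<longlongrightarrow> L) F"
  shows "((\<lambda>x. op_norm (A x)) \<longlongrightarrow> op_norm L) F"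
proof -
  have 0: "((\<lambda>x. \<Sum>i\<in>UNIV. \<Sum>j\<in>UNIV. cmod (A x $ i $ j - L $ i $ j)) \<longlongrightarrow> (\<Sum>i\<in>UNIV. \<Sum>j\<in>UNIV. cmod (L $ i $ j - L $ i $ j))) F"
    by (intro tendsto_intros A)
  have "((\<lambda>x. op_norm (A x) - op_norm L) \<longlongrightarrow> 0) F"
  proof (rule Lim_null_comparison)
    show "((\<lambda>x. \<Sum>i\<in>UNIV. \<Sum>j\<in>UNIV. cmod (A x $ i $ j - L $ i $ j)) \<longlongrightarrow> 0) F"
      using 0 by simp
    have "norm (op_norm (A x) - op_norm L) \<le> (\<Sum>i\<in>UNIV. \<Sum>j\<in>UNIV. cmod (A x $ i $ j - L $ i $ j))" for x
    proof -
      have "op_norm (A x) - op_norm L \<le> (\<Sum>i\<in>UNIV. \<Sum>j\<in>UNIV. cmod (A x $ i $ j - L $ i $ j))"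
        using op_norm_triangle[of "A x" L] op_norm_le_sum[of "A x - L"] by simp
      moreover have "op_norm L - op_norm (A x) \<le> (\<Sum>i\<in>UNIV. \<Sum>j\<in>UNIV. cmod (A x $ i $ j - L $ i $ j))"
        using op_norm_triangle[of L "A x"] op_norm_le_sum[of "L - A x"] by (simp add: norm_minus_commute)
      ultimately show ?thesis by (simp add: abs_le_iff)
    qed
    then show "\<forall>\<^sub>F x in F. norm (op_norm (A x) - op_norm L) \<le> (\<Sum>i\<in>UNIV. \<Sum>j\<in>UNIV. cmod (A x $ i $ j - L $ i $ j))"
      by simp
  qed
  then show ?thesis by (rule LIM_zero_cancel)
qed

lemma borel_measurable_op_norm [measurable]: "op_norm \<in> borel_measurable borel"
  by (intro borel_measurable_continuous_onI)
     (simp add: continuous_on_def tendsto_op_norm)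

lemma tendsto_det:
  fixes A :: "'a \<Rightarrow> complex ^ 'n ^ 'n"
  assumes "\<And>i j. ((\<lambda>x. A x $ i $ j) \<longlongrightarrow> L $ i $ j) F"
  shows "((\<lambda>x. det (A x)) \<longlongrightarrow> det L) F"
  unfolding det_def by (intro tendsto_intros assms)

lemma holomorphic_on_det:
  fixes A :: "complex \<Rightarrow> complex ^ 'n ^ 'n"
  assumes "\<And>i j. (\<lambda>x. A x $ i $ j) holomorphic_on S"
  shows "(\<lambda>x. det (A x)) holomorphic_on S"
  unfolding det_def by (intro holomorphic_intros assms)

lemma cmod_det_le:
  fixes A :: "complex ^ 'n ^ 'n"
  assumes "\<And>i j. cmod (A $ i $ j) \<le> K"
  shows "cmod (det A) \<le> fact CARD('n) * K ^ CARD('n)"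
proof -
  have "cmod (det A) \<le> (\<Sum>p\<in>{p. p permutes (UNIV :: 'n set)}. cmod (of_int (sign p) * (\<Prod>i\<in>UNIV. A $ i $ p i)))"
    unfolding det_def by (rule norm_sum)
  also have "\<dots> \<le> (\<Sum>p\<in>{p. p permutes (UNIV :: 'n set)}. K ^ CARD('n))"
  proof (rule sum_mono)
    fix p :: "'n \<Rightarrow> 'n"
    have "cmod (of_int (sign p) * (\<Prod>i\<in>UNIV. A $ i $ p i)) = (\<Prod>i\<in>UNIV. cmod (A $ i $ p i))"
      by (simp add: norm_mult sign_def flip: prod_norm)
    also have "\<dots> \<le> (\<Prod>i\<in>(UNIV :: 'n set). K)" by (intro prod_mono) (use assms in auto)
    finally show "cmod (of_int (sign p) * (\<Prod>i\<in>UNIV. A $ i $ p i)) \<le> K ^ CARD('n)" by simp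
  qed
  also have "\<dots> = fact CARD('n) * K ^ CARD('n)"
    using card_permutations[of "UNIV :: 'n set" "CARD('n)"] by simp
  finally show ?thesis .
qed

text \<open>Cramer's rule: entry \<open>(k, j)\<close> of the adjugate is the determinant of the matrix with column
  \<open>k\<close> replaced by the \<open>j\<close>-th unit vector.\<close>

definition replace_column :: "complex ^ 'n ^ 'n \<Rightarrow> 'n \<Rightarrow> 'n \<Rightarrow> complex ^ 'n ^ 'n" where
  "replace_column A k j = (\<chi> i l. if l = k then axis j 1 $ i else A $ i $ l)"

text \<open>Cramer's rule solves for each unit vector and so produces a right inverse, which for
  square matrices is also a left inverse.\<close>

lemma adjugate_left_inverse:
  fixes A :: "complex ^ 'n ^ 'n"
  assumes "det A \<noteq> 0"
  shows "(\<chi> k j. det (replace_column A k j) / det A) ** A = mat 1" (is "?B ** A = _")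
proof -
  have "A *v (\<chi> k. det (replace_column A k j) / det A) = axis j 1" for j
    by (subst cramer[OF assms]) (simp add: replace_column_def)
  then have "(\<Sum>k\<in>UNIV. A $ i $ k * (det (replace_column A k j) / det A)) = axis j 1 $ i" for i j
    unfolding matrix_vector_mult_def by (metis (no_types, lifting) vec_lambda_beta sum.cong)
  then have "A ** ?B = mat 1"
    by (simp add: vec_eq_iff matrix_matrix_mult_def mat_def axis_def)
  then show ?thesis by (simp only: matrix_left_right_inverse)
qed

text \<open>The entries are compared with \<open>max 1 K\<close> so that the bound also covers
  \<open>replace_column\<close>, whose unit column contains an entry 1. \<open>ln_plus\<close> does
  not distinguish \<open>max 1 K\<close> from \<open>K\<close>.\<close>

lemma ln_plus_cmod_det_le:
  fixes A :: "complex ^ 'n ^ 'n"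
  assumes "\<And>i j. cmod (A $ i $ j) \<le> max 1 K"
  shows "ln_plus (cmod (det A)) \<le> ln (fact CARD('n)) + real CARD('n) * ln_plus K"
proof -
  have pos: "0 < max 1 K" by simp
  have "cmod (det A) \<le> fact CARD('n) * max 1 K ^ CARD('n)" by (rule cmod_det_le[OF assms])
  then have "ln_plus (cmod (det A)) \<le> ln_plus (fact CARD('n) * max 1 K ^ CARD('n))"
    by (rule ln_plus_mono)
  also have "\<dots> \<le> ln_plus (fact CARD('n)) + ln_plus (max 1 K ^ CARD('n))"
    using pos by (intro ln_plus_mult) auto
  also have "ln_plus (fact CARD('n)) = ln (fact CARD('n))" by (simp add: ln_plus_def)
  also have "ln_plus (max 1 K ^ CARD('n)) \<le> real CARD('n) * ln_plus (max 1 K)"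
    using pos by (intro ln_plus_power) auto
  also have "ln_plus (max 1 K) = ln_plus K" by (simp add: ln_plus_def)
  finally show ?thesis by simp
qed

section \<open>Matrix-valued functions\<close>

text \<open>Measurability is required at every point, since the Borel sets of the circle are not
  complete and uniform integrability includes integrability. Existence of the radial limit is a
  Cauchy condition, and continuity of \<open>F\<close> makes the failure sets in it relatively open;
  so the set of convergence is Borel, and off it the value is constant.\<close>

lemma boundary_value_measurable:
  fixes F :: "complex \<Rightarrow> complex ^ 'n ^ 'n"
  assumes F: "continuous_on (ball 0 1) F"
  shows "boundary_value F \<in> borel_measurable circle_measure"
proof -
  let ?M = circle_measure
  have cont: "continuous_on unit_circle (\<lambda>t. F (of_real r * t))" if "0 \<le> r" "r < 1" for r
    by (rule continuous_on_subset[OF continuous_on_circle_dilation[OF F that]]) auto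
  \<comment> \<open>The oscillation beyond radius s exceeds e. This is an uncountable union over
    pairs of radii, but of relatively open sets, so no reduction to countably many radii is
    required.\<close>
  define U where "U s e = {t \<in> unit_circle. \<exists>p\<in>{s..<1}. \<exists>q\<in>{s..<1}. e < norm (F (of_real p * t) - F (of_real q * t))}"
    for s e :: real
  have U: "U s e \<in> sets ?M" if s: "0 \<le> s" for s e
  proof -
    define O' where "O' p q = {t \<in> unit_circle. norm (F (of_real p * t) - F (of_real q * t)) \<in> {e<..}}" for p q
    have "U s e = \<Union> ((\<lambda>(p, q). O' p q) ` ({s..<1} \<times> {s..<1}))"
      by (auto simp: U_def O'_def)
    moreover have "openin (top_of_set unit_circle) (O' p q)" if "p \<in> {s..<1}" "q \<in> {s..<1}" for p q
    proof -
      have "openin (top_of_set unit_circle) (unit_circle \<inter> (\<lambda>t. norm (F (of_real p * t) - F (of_real q * t))) -` {e<..})"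
        using s that by (intro continuous_openin_preimage_gen continuous_intros cont) auto
      also have "unit_circle \<inter> (\<lambda>t. norm (F (of_real p * t) - F (of_real q * t))) -` {e<..} = O' p q"
        by (auto simp: O'_def)
      finally show ?thesis .
    qed
    ultimately have "openin (top_of_set unit_circle) (U s e)" by (auto intro!: openin_Union)
    then obtain V where "open V" "U s e = unit_circle \<inter> V" by (auto simp: openin_open)
    then show ?thesis by (auto simp: sets_circle_measure sets_restrict_space)
  qed
  have conv: "(\<exists>l. ((\<lambda>r. F (of_real r * t)) \<longlongrightarrow> l) (at_left 1)) \<longleftrightarrow> (\<forall>k::nat. \<exists>m. t \<notin> U (radius m) (1 / (real k + 1)))"
    if t: "t \<in> unit_circle" for t
  proof
    assume "\<exists>l. ((\<lambda>r. F (of_real r * t)) \<longlongrightarrow> l) (at_left 1)"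
    then obtain l where l: "((\<lambda>r. F (of_real r * t)) \<longlongrightarrow> l) (at_left 1)" ..
    show "\<forall>k::nat. \<exists>m. t \<notin> U (radius m) (1 / (real k + 1))"
    proof
      fix k :: nat
      define e where "e = 1 / (2 * (real k + 1))"
      have "e > 0" by (simp add: e_def)
      with l have "\<forall>\<^sub>F r in at_left 1. dist (F (of_real r * t)) l < e" by (rule tendstoD)
      then obtain b where b: "b < 1" "\<And>r. b < r \<Longrightarrow> r < 1 \<Longrightarrow> dist (F (of_real r * t)) l < e"
        unfolding eventually_at_left_field by auto
      have "\<forall>\<^sub>F m in sequentially. b < radius m" using radius_tendsto b(1) by (rule order_tendstoD)
      then obtain m where m: "b < radius m" using eventually_happens'[OF sequentially_bot] by blast
      have "norm (F (of_real p * t) - F (of_real q * t)) \<le> 1 / (real k + 1)"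
        if "p \<in> {radius m..<1}" "q \<in> {radius m..<1}" for p q
      proof -
        have "dist (F (of_real p * t)) (F (of_real q * t)) \<le> e + e"
          using b(2)[of p] b(2)[of q] that m dist_triangle2[of "F (of_real p * t)" "F (of_real q * t)" l] by auto
        also have "e + e = 1 / (real k + 1)" by (simp add: e_def field_simps)
        finally show ?thesis by (simp add: dist_norm)
      qed
      then have "t \<notin> U (radius m) (1 / (real k + 1))" by (auto simp: U_def not_less)
      then show "\<exists>m. t \<notin> U (radius m) (1 / (real k + 1))" ..
    qed
  next
    assume *: "\<forall>k::nat. \<exists>m. t \<notin> U (radius m) (1 / (real k + 1))"
    show "\<exists>l. ((\<lambda>r. F (of_real r * t)) \<longlongrightarrow> l) (at_left 1)"
    proof (rule convergent_at_left_if_Cauchy)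
      fix e :: real assume "e > 0"
      obtain k :: nat where "1 / e < k" using reals_Archimedean2 by blast
      then have k: "1 / (real k + 1) \<le> e" using \<open>e > 0\<close> by (simp add: field_simps)
      obtain m where "t \<notin> U (radius m) (1 / (real k + 1))" using * by blast
      then have "\<forall>r\<in>{radius m..<1}. \<forall>r'\<in>{radius m..<1}. norm (F (of_real r * t) - F (of_real r' * t)) \<le> e"
        using t k by (force simp: U_def not_less)
      then show "\<exists>s<1. \<forall>r\<in>{s..<1}. \<forall>r'\<in>{s..<1}. norm (F (of_real r * t) - F (of_real r' * t)) \<le> e"
        using radius_bounds by blast
    qed
  qed
  define Cv where "Cv = {t \<in> space ?M. \<forall>k::nat. \<exists>m. t \<notin> U (radius m) (1 / (real k + 1))}"
  have [measurable]: "U (radius m) e \<in> sets ?M" for m e by (rule U[OF radius_bounds(1)])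
  have [measurable]: "Cv \<in> sets ?M" unfolding Cv_def by measurable
  have [measurable]: "(\<lambda>t. F (of_real (radius n) * t)) \<in> borel_measurable ?M" for n
    by (rule measurable_circle_continuous[OF cont[OF radius_bounds]])
  have [measurable]: "(\<lambda>t. lim (\<lambda>n. F (of_real (radius n) * t))) \<in> borel_measurable ?M"
    by (rule borel_measurable_lim_metric) measurable
  \<comment> \<open>\<open>THE l. False\<close> is the value of \<open>Lim\<close> where no limit
    exists, its defining predicate being false for every candidate.\<close>
  have "(\<lambda>t. if t \<in> Cv then lim (\<lambda>n. F (of_real (radius n) * t)) else (THE l. False)) \<in> borel_measurable ?M"
    by measurable
  moreover have "boundary_value F t = (if t \<in> Cv then lim (\<lambda>n. F (of_real (radius n) * t)) else (THE l. False))"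
    if t: "t \<in> space ?M" for t
  proof (cases "t \<in> Cv")
    case True
    then obtain l where l: "((\<lambda>r. F (of_real r * t)) \<longlongrightarrow> l) (at_left 1)" using conv[of t] t by (auto simp: Cv_def)
    then have "(\<lambda>n. F (of_real (radius n) * t)) \<longlonglongrightarrow> l" using filterlim_radius by (rule filterlim_compose)
    then have "lim (\<lambda>n. F (of_real (radius n) * t)) = l" by (rule limI)
    moreover have "boundary_value F t = l"
      unfolding boundary_value_def by (rule tendsto_Lim[OF _ l]) simp
    ultimately show ?thesis using True by simp
  next
    case False
    then have "\<not> ((\<lambda>r. F (of_real r * t)) \<longlongrightarrow> l) (at_left 1)" for l using conv[of t] t by (auto simp: Cv_def)
    then show ?thesis using False by (simp add: boundary_value_def Topological_Spaces.Lim_def)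
  qed
  ultimately show ?thesis by (subst measurable_cong) auto
qed

lemma mat_holomorphic_continuous:
  fixes F :: "complex \<Rightarrow> complex ^ 'n ^ 'n"
  assumes "mat_holomorphic_on F S"
  shows "continuous_on S F"
proof -
  have "continuous_on S (\<lambda>z. \<chi> i j. F z $ i $ j)"
    using assms unfolding mat_holomorphic_on_def
    by (intro continuous_on_vec_lambda) (auto intro: holomorphic_on_imp_continuous_on)
  then show ?thesis by (simp add: vec_lambda_eta)
qed

lemma boundary_value_tendsto:
  fixes F :: "complex \<Rightarrow> complex ^ 'n ^ 'n"
  assumes "\<And>i j. scalar_smirnov (\<lambda>z. F z $ i $ j)"
  shows "AE t in circle_measure. ((\<lambda>r. F (of_real r * t)) \<longlongrightarrow> boundary_value F t) (at_left 1)"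
proof -
  have "\<exists>fb. has_boundary_function (\<lambda>z. F z $ i $ j) fb" for i j
    using smirnov_boundary[OF assms] by blast
  then obtain fb where fb: "\<And>i j. has_boundary_function (\<lambda>z. F z $ i $ j) (fb i j)" by metis
  have "AE t in circle_measure. \<forall>p\<in>UNIV. ((\<lambda>r. F (of_real r * t) $ fst p $ snd p) \<longlongrightarrow> fb (fst p) (snd p) t) (at_left 1)"
    using fb by (intro AE_finite_allI) (auto simp: has_boundary_function_def)
  then show ?thesis
  proof eventually_elim
    fix t assume "\<forall>p\<in>UNIV. ((\<lambda>r. F (of_real r * t) $ fst p $ snd p) \<longlongrightarrow> fb (fst p) (snd p) t) (at_left 1)"
    then have "((\<lambda>r. F (of_real r * t)) \<longlongrightarrow> (\<chi> i j. fb i j t)) (at_left 1)"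
      by (intro vec_tendstoI) (simp add: split_paired_all)
    then show "((\<lambda>r. F (of_real r * t)) \<longlongrightarrow> boundary_value F t) (at_left 1)"
      unfolding boundary_value_def by (subst tendsto_Lim) simp_all
  qed
qed

lemma has_boundary_function_compose:
  fixes F :: "complex \<Rightarrow> complex ^ 'n ^ 'n"
  assumes F: "continuous_on (ball 0 1) F"
    and lim: "AE t in circle_measure. ((\<lambda>r. F (of_real r * t)) \<longlongrightarrow> boundary_value F t) (at_left 1)"
    and \<Phi>: "continuous_on UNIV \<Phi>"
  shows "has_boundary_function (\<lambda>z. \<Phi> (F z)) (\<lambda>t. \<Phi> (boundary_value F t))"
  unfolding has_boundary_function_def
proof
  show "(\<lambda>t. \<Phi> (boundary_value F t)) \<in> borel_measurable circle_measure"
    by (rule measurable_compose[OF boundary_value_measurable[OF F] borel_measurable_continuous_onI[OF \<Phi>]])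
  show "AE t in circle_measure. ((\<lambda>r. \<Phi> (F (of_real r * t))) \<longlongrightarrow> \<Phi> (boundary_value F t)) (at_left 1)"
    using lim
  proof eventually_elim
    fix t assume "((\<lambda>r. F (of_real r * t)) \<longlongrightarrow> boundary_value F t) (at_left 1)"
    then show "((\<lambda>r. \<Phi> (F (of_real r * t))) \<longlongrightarrow> \<Phi> (boundary_value F t)) (at_left 1)"
      using \<Phi> by (intro isCont_tendsto_compose[of _ \<Phi>]) (auto simp: continuous_on_eq_continuous_at)
  qed
qed

lemma continuous_on_det: "continuous_on UNIV (det :: complex ^ 'n ^ 'n \<Rightarrow> complex)"
  unfolding continuous_on_def by (auto intro!: tendsto_det tendsto_intros)

lemma continuous_on_det_replace_column:
  "continuous_on UNIV (\<lambda>A :: complex ^ 'n ^ 'n. det (replace_column A k j))"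
  unfolding continuous_on_def replace_column_def
proof (intro ballI tendsto_det)
  fix A :: "complex ^ 'n ^ 'n" and i l
  show "((\<lambda>A. (\<chi> i l. if l = k then axis j 1 $ i else A $ i $ l) $ i $ l)
      \<longlongrightarrow> (\<chi> i l. if l = k then axis j 1 $ i else A $ i $ l) $ i $ l) (at A within UNIV)"
    by (cases "l = k") (auto intro!: tendsto_intros)
qed

text \<open>A common criterion for the entries of \<open>E\<close> (c = 0, k = 1) and for its
  determinant and cofactors (c the logarithm of a factorial, k the size of the matrix).\<close>

lemma smirnov_class_scalar:
  fixes E :: "complex \<Rightarrow> complex ^ 'n ^ 'n"
  assumes E: "E \<in> smirnov_class" and g: "g holomorphic_on ball 0 1"
    and bd: "\<And>z. cmod z < 1 \<Longrightarrow> ln_plus (cmod (g z)) \<le> c + k * ln_plus (op_norm (E z))"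
    and "0 \<le> c" "0 \<le> k"
  shows "scalar_smirnov g"
  unfolding scalar_smirnov_def
proof
  show "uniformly_integrable circle_measure {0..<1} (\<lambda>r t. ln_plus (cmod (g (of_real r * t))))"
  proof (rule uniformly_integrable_bound[where h = id])
    show "uniformly_integrable circle_measure {0..<1} (\<lambda>r t. ln_plus (op_norm (E (of_real r * t))))"
      using E by (simp add: smirnov_class_def)
    fix r :: real assume r: "r \<in> {0..<1}"
    have "(\<lambda>t. g (of_real r * t)) \<in> borel_measurable circle_measure"
      by (rule measurable_dilation[OF g]) (use r in auto)
    then show "(\<lambda>t. ln_plus (cmod (g (of_real r * t)))) \<in> borel_measurable circle_measure" by measurable
    show "AE t in circle_measure. \<bar>ln_plus (cmod (g (of_real r * t)))\<bar>
        \<le> c + k * \<bar>ln_plus (op_norm (E (of_real (id r) * t)))\<bar>"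
      using r by (intro AE_I2) (auto simp: norm_mult intro!: bd)
  qed (use assms in \<open>auto intro: circle.finite_measure_axioms\<close>)
qed (fact g)

lemma smirnov_class_entry:
  fixes E :: "complex \<Rightarrow> complex ^ 'n ^ 'n"
  assumes E: "E \<in> smirnov_class"
  shows "scalar_smirnov (\<lambda>z. E z $ i $ j)"
proof (rule smirnov_class_scalar[OF E, where c = 0 and k = 1])
  show "(\<lambda>z. E z $ i $ j) holomorphic_on ball 0 1"
    using E by (simp add: smirnov_class_def mat_holomorphic_on_def)
qed (auto intro: ln_plus_mono cmod_entry_le_op_norm)

lemma ln_plus_det_le:
  "ln_plus (cmod (det A)) \<le> ln (fact CARD('n)) + real CARD('n) * ln_plus (op_norm (A :: complex ^ 'n ^ 'n))"
proof (rule ln_plus_cmod_det_le)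
  show "cmod (A $ i $ j) \<le> max 1 (op_norm A)" for i j
    using cmod_entry_le_op_norm[of A i j] by simp
qed

lemma ln_plus_det_replace_column_le:
  "ln_plus (cmod (det (replace_column A k l))) \<le> ln (fact CARD('n)) + real CARD('n) * ln_plus (op_norm (A :: complex ^ 'n ^ 'n))"
proof (rule ln_plus_cmod_det_le)
  show "cmod (replace_column A k l $ i $ j) \<le> max 1 (op_norm A)" for i j
    using cmod_entry_le_op_norm[of A i j] by (auto simp: replace_column_def axis_def)
qed

lemma smirnov_class_det:
  fixes E :: "complex \<Rightarrow> complex ^ 'n ^ 'n"
  assumes E: "E \<in> smirnov_class"
  shows "scalar_smirnov (\<lambda>z. det (E z))" "scalar_smirnov (\<lambda>z. det (replace_column (E z) k j))"
proof -
  have hol: "(\<lambda>z. E z $ i $ l) holomorphic_on ball 0 1" for i l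
    using E by (simp add: smirnov_class_def mat_holomorphic_on_def)
  have pos: "0 \<le> ln (fact CARD('n) :: real)" by simp
  show "scalar_smirnov (\<lambda>z. det (E z))"
    by (rule smirnov_class_scalar[OF E holomorphic_on_det[OF hol] ln_plus_det_le pos]) simp
  have "(\<lambda>z. replace_column (E z) k j $ i $ l) holomorphic_on ball 0 1" for i l
    using hol by (cases "l = k") (auto simp: replace_column_def)
  then show "scalar_smirnov (\<lambda>z. det (replace_column (E z) k j))"
    by (intro smirnov_class_scalar[OF E holomorphic_on_det ln_plus_det_replace_column_le pos]) simp_all
qed

lemma bounded_holomorphic_entry:
  fixes F :: "complex \<Rightarrow> complex ^ 'n ^ 'n"
  assumes "F \<in> bounded_holomorphic"
  shows "scalar_smirnov (\<lambda>z. F z $ i $ j)"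
proof -
  have hol: "mat_holomorphic_on F unit_disc" and "\<exists>C. \<forall>z\<in>unit_disc. op_norm (F z) \<le> C"
    using assms by (auto simp: bounded_holomorphic_def)
  then obtain C where "\<forall>z\<in>unit_disc. op_norm (F z) \<le> C" by blast
  with hol show ?thesis
    by (intro scalar_smirnov_bounded[of _ C])
       (auto simp: mat_holomorphic_on_def intro: order_trans[OF cmod_entry_le_op_norm])
qed

text \<open>Each term is at most \<open>exp\<close> of the sum of all \<open>ln_plus\<close> terms,
  so the sum costs only the logarithm of the number of terms.\<close>

lemma ln_plus_sum_le:
  assumes "finite I" "\<And>i. i \<in> I \<Longrightarrow> 0 \<le> x i"
  shows "ln_plus (\<Sum>i\<in>I. x i) \<le> ln_plus (real (card I)) + (\<Sum>i\<in>I. ln_plus (x i))"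
proof -
  have "x i \<le> exp (\<Sum>j\<in>I. ln_plus (x j))" if "i \<in> I" for i
  proof -
    have "x i \<le> exp (ln_plus (x i))" by (simp add: exp_ln_plus)
    also have "\<dots> \<le> exp (\<Sum>j\<in>I. ln_plus (x j))"
      using member_le_sum[OF that, of "\<lambda>j. ln_plus (x j)"] assms(1) by simp
    finally show ?thesis .
  qed
  then have "(\<Sum>i\<in>I. x i) \<le> real (card I) * exp (\<Sum>j\<in>I. ln_plus (x j))"
    by (rule sum_bounded_above)
  then have "ln_plus (\<Sum>i\<in>I. x i) \<le> ln_plus (real (card I) * exp (\<Sum>j\<in>I. ln_plus (x j)))"
    by (rule ln_plus_mono)
  also have "\<dots> \<le> ln_plus (real (card I)) + ln_plus (exp (\<Sum>j\<in>I. ln_plus (x j)))"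
    by (rule ln_plus_mult) auto
  also have "ln_plus (exp (\<Sum>j\<in>I. ln_plus (x j))) = (\<Sum>j\<in>I. ln_plus (x j))"
    by (simp add: ln_plus_pos_eq sum_nonneg)
  finally show ?thesis .
qed

lemma op_norm_scalar_matrix_le:
  "op_norm (\<chi> i j. c * (mat 1 :: complex ^ 'n ^ 'n) $ i $ j) \<le> cmod c"
  unfolding op_norm_def
proof (rule onorm_bound)
  fix x :: "complex ^ 'n"
  have "(\<chi> i j. c * (mat 1 :: complex ^ 'n ^ 'n) $ i $ j) *v x = c *s x"
    by (simp add: vec_eq_iff matrix_vector_mult_def mat_def if_distrib cong: if_cong)
       (simp add: if_distribR cong: if_cong)
  moreover have "norm (c *s x) = cmod c * norm x"
    by (simp add: norm_vec_def norm_mult L2_set_right_distrib)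
  ultimately show "norm ((\<chi> i j. c * (mat 1 :: complex ^ 'n ^ 'n) $ i $ j) *v x) \<le> cmod c * norm x"
    by simp
qed simp

section \<open>Approximate inverses of outer matrix functions\<close>

lemma outer_class_approximate_inverse:
  fixes E :: "complex \<Rightarrow> complex ^ 'n ^ 'n"
  assumes E: "E \<in> outer_class"
  obtains F :: "nat \<Rightarrow> complex \<Rightarrow> complex ^ 'n ^ 'n" where
    "\<And>k. F k \<in> bounded_holomorphic"
    "AE t in circle_measure. (\<lambda>k. boundary_value (F k) t ** boundary_value E t) \<longlonglongrightarrow> mat 1"
    "uniformly_integrable circle_measure UNIV (\<lambda>k t. ln_plus (op_norm (boundary_value (F k) t)))"
    "\<And>k. AE t in circle_measure. op_norm (boundary_value (F k) t ** boundary_value E t) \<le> 1"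
proof -
  let ?M = circle_measure
  have fm: "finite_measure ?M" by (rule circle.finite_measure_axioms)
  have Es: "E \<in> smirnov_class" and Eo: "outer (\<lambda>z. det (E z))" using E by (auto simp: outer_class_def)
  have Eh: "mat_holomorphic_on E (ball 0 1)" using Es by (simp add: smirnov_class_def)
  note Ec = mat_holomorphic_continuous[OF Eh]
  define Eb where "Eb = boundary_value E"
  have El: "AE t in ?M. ((\<lambda>r. E (of_real r * t)) \<longlongrightarrow> Eb t) (at_left 1)"
    unfolding Eb_def by (rule boundary_value_tendsto[OF smirnov_class_entry[OF Es]])
  obtain C w where C: "cmod C = 1" and wint: "integrable ?M (\<lambda>t. ln (w t))"
    and rep: "\<And>z. cmod z < 1 \<Longrightarrow> det (E z) = C * exp (LINT t|?M. (t + z) / (t - z) * of_real (ln (w t)))"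
    using Eo unfolding outer_def by auto
  define u where "u t = ln (w t)" for t
  have u: "integrable ?M u" using wint by (simp add: u_def[abs_def])
  have detE: "det (E z) = C * exp (herglotz u z)" if "cmod z < 1" for z
    using rep[OF that] by (simp add: herglotz_def u_def)
  have det_nz: "det (E z) \<noteq> 0" if "cmod z < 1" for z using detE[OF that] C by auto
  have ln_det: "ln (cmod (det (E z))) = Re (herglotz u z)" if "cmod z < 1" for z
    using detE[OF that] C by (simp add: norm_mult)
  have bdet: "has_boundary_function (\<lambda>z. det (E z)) (\<lambda>t. det (Eb t))"
    unfolding Eb_def by (rule has_boundary_function_compose[OF Ec El[unfolded Eb_def] continuous_on_det])
  have [measurable]: "(\<lambda>t. det (Eb t)) \<in> borel_measurable ?M" using bdet by (simp add: has_boundary_function_def)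
  \<comment> \<open>The weight in the outer representation is recovered as the boundary modulus of
    the determinant, by the radial limits of Herglotz integrals. In particular \<open>Eb t\<close>
    is invertible almost everywhere.\<close>
  have detb: "AE t in ?M. cmod (det (Eb t)) = exp (u t)"
    using AE_space bdet[unfolded has_boundary_function_def, THEN conjunct2] herglotz_radial_limit[OF u]
  proof eventually_elim
    fix t assume t: "t \<in> space ?M"
      and d: "((\<lambda>r. det (E (of_real r * t))) \<longlongrightarrow> det (Eb t)) (at_left 1)"
      and h: "((\<lambda>r. Re (herglotz u (of_real r * t))) \<longlongrightarrow> u t) (at_left 1)"
    have "((\<lambda>r. exp (Re (herglotz u (of_real r * t)))) \<longlongrightarrow> exp (u t)) (at_left 1)"
      by (intro tendsto_intros h)
    moreover have "\<forall>\<^sub>F r in at_left (1::real). exp (Re (herglotz u (of_real r * t))) = cmod (det (E (of_real r * t)))"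
      unfolding eventually_at_left_field
      by (intro exI[of _ 0]) (use t C in \<open>auto simp: detE norm_mult\<close>)
    ultimately have "((\<lambda>r. cmod (det (E (of_real r * t)))) \<longlongrightarrow> exp (u t)) (at_left 1)"
      by (rule Lim_transform_eventually)
    then show "cmod (det (Eb t)) = exp (u t)"
      using tendsto_norm[OF d] by (intro tendsto_unique[of "at_left (1::real)"]) auto
  qed
  define cof where "cof p A = det (replace_column A (fst p) (snd p))" for p :: "'n \<times> 'n" and A :: "complex ^ 'n ^ 'n"
  have cofs: "scalar_smirnov (\<lambda>z. cof p (E z))" for p
    unfolding cof_def by (rule smirnov_class_det(2)[OF Es])
  have cofb: "has_boundary_function (\<lambda>z. cof p (E z)) (\<lambda>t. cof p (Eb t))" for p
    unfolding Eb_def cof_def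
    by (rule has_boundary_function_compose[OF Ec El[unfolded Eb_def] continuous_on_det_replace_column])
  have [measurable]: "(\<lambda>t. cof p (Eb t)) \<in> borel_measurable ?M" for p
    using cofb[of p] by (simp add: has_boundary_function_def)
  define x where "x p t = cmod (cof p (Eb t)) / cmod (det (Eb t))" for p t
  have x0: "0 \<le> x p t" for p t by (simp add: x_def)
  have [measurable]: "x p \<in> borel_measurable ?M" for p unfolding x_def[abs_def] by measurable
  have xint: "integrable ?M (\<lambda>t. ln_plus (x p t))" for p
  proof (rule Bochner_Integration.integrable_bound)
    show "integrable ?M (\<lambda>t. ln_plus (cmod (cof p (Eb t))) + \<bar>u t\<bar>)"
      by (intro Bochner_Integration.integrable_add integrable_abs u smirnov_boundary_ln_plus_integrable[OF cofs cofb])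
    show "AE t in ?M. norm (ln_plus (x p t)) \<le> norm (ln_plus (cmod (cof p (Eb t))) + \<bar>u t\<bar>)"
      using detb
    proof eventually_elim
      fix t assume d: "cmod (det (Eb t)) = exp (u t)"
      have "ln_plus (x p t) \<le> ln_plus (cmod (cof p (Eb t))) + ln_plus (exp (- u t))"
        unfolding x_def d divide_inverse exp_minus[symmetric] by (intro ln_plus_mult) auto
      also have "ln_plus (exp (- u t)) \<le> \<bar>u t\<bar>" by (simp add: ln_plus_pos_eq)
      finally show "norm (ln_plus (x p t)) \<le> norm (ln_plus (cmod (cof p (Eb t))) + \<bar>u t\<bar>)" by simp
    qed
  qed measurable
  \<comment> \<open>The \<open>x p\<close> are the moduli of the entries of the inverse on the
    circle. A sum over all entries dominates each summand, so the single factor of modulus exp (- v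
    m) brings every entry down to at most m + 1. The level m + 1 is positive for all m and its
    growth drives \<open>v m\<close> to 0.\<close>
  define v where "v m t = (\<Sum>p\<in>UNIV. ln_plus (x p t / (real m + 1)))" for m :: nat and t
  have v0: "0 \<le> v m t" for m t by (simp add: v_def sum_nonneg)
  have x_div: "ln_plus (x p t / (real m + 1)) \<le> ln_plus (x p t)" for p t and m :: nat
  proof (rule ln_plus_mono)
    have "x p t * 1 \<le> x p t * (real m + 1)" using x0[of p t] by (intro mult_left_mono) auto
    then show "x p t / (real m + 1) \<le> x p t" by (simp add: divide_le_eq)
  qed
  have vle: "v m t \<le> (\<Sum>p\<in>UNIV. ln_plus (x p t))" for m t
    unfolding v_def by (intro sum_mono x_div)
  have [measurable]: "v m \<in> borel_measurable ?M" for m unfolding v_def[abs_def] by measurable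
  have Sint: "integrable ?M (\<lambda>t. \<Sum>p\<in>UNIV. ln_plus (x p t))"
    by (intro Bochner_Integration.integrable_sum xint)
  have vint: "integrable ?M (v m)" for m
    by (rule Bochner_Integration.integrable_bound[OF Sint]) (use vle v0 in \<open>auto simp: sum_nonneg\<close>)
  have v_lim: "(\<lambda>m. LINT t|?M. v m t) \<longlonglongrightarrow> 0"
  proof -
    have "(\<lambda>m. LINT t|?M. v m t) \<longlonglongrightarrow> (LINT t|?M. 0)"
    proof (rule integral_dominated_convergence[OF _ _ Sint])
      show "AE t in ?M. (\<lambda>m. v m t) \<longlonglongrightarrow> 0"
      proof (intro AE_I2)
        fix t
        have "(\<lambda>m. x p t / (real m + 1)) \<longlonglongrightarrow> 0" for p by real_asymp
        then have "(\<lambda>m. v m t) \<longlonglongrightarrow> (\<Sum>p\<in>(UNIV :: ('n \<times> 'n) set). ln_plus 0)"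
          unfolding v_def by (intro tendsto_sum tendsto_ln_plus) auto
        then show "(\<lambda>m. v m t) \<longlonglongrightarrow> 0" by (simp add: ln_plus_def)
      qed
      show "AE t in ?M. norm (v m t) \<le> (\<Sum>p\<in>UNIV. ln_plus (x p t))" for m
        using vle v0 by (intro AE_I2) auto
    qed auto
    then show ?thesis by simp
  qed
  define \<phi> where "\<phi> m z = exp (- herglotz (v m) z)" for m z
  note P = exp_herglotz[OF vint v0, folded \<phi>_def]
  have \<phi>h: "\<phi> m holomorphic_on ball 0 1" for m using P(1)[of m] by (simp add: \<phi>_def[abs_def])
  have "\<exists>b. has_boundary_function (\<phi> m) b" for m
    using bounded_holomorphic_boundary[OF \<phi>h P(2)] by blast
  then obtain \<phi>b where \<phi>b: "\<And>m. has_boundary_function (\<phi> m) (\<phi>b m)" by metis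
  have \<phi>b1: "AE t in ?M. cmod (\<phi>b m t) \<le> 1" for m by (rule boundary_function_bound[OF \<phi>b P(2)])
  obtain s :: "nat \<Rightarrow> nat" where s: "strict_mono s" and slim: "AE t in ?M. (\<lambda>k. \<phi>b (s k) t) \<longlonglongrightarrow> 1"
    using exp_herglotz_boundary_subseq[OF vint v0 v_lim] \<phi>b unfolding \<phi>_def[abs_def] by blast
  define F where "F m z = (\<chi> k j. \<phi> m z * cof (k, j) (E z) / det (E z))" for m z
  \<comment> \<open>For the cofactor only the Poisson inequality is available, but it enters with a
    plus sign. For det E and the damping factor, which enter with the signs opposite to and equal to
    it, equality holds. So the bound of the boundary moduli by m + 1 passes into the disc.\<close>
  have Fbd: "cmod (F m z $ k $ j) \<le> real m + 1" if z: "cmod z < 1" for m z k j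
  proof (cases "cof (k, j) (E z) = 0")
    case False
    define p where "p = (k, j)"
    have nz: "cof p (E z) \<noteq> 0" using False by (simp add: p_def)
    note S = smirnov_poisson_inequality[OF cofs cofb z nz]
    have intP: "integrable ?M (\<lambda>t. poisson_kernel z t * f t)" if "integrable ?M f" for f
      using integrable_poisson_kernel_mult[OF that z] by simp
    have ln\<phi>: "ln (cmod (\<phi> m z)) = - (LINT t|?M. poisson_kernel z t * v m t)"
      unfolding P(3)[OF z] by simp
    have "ln (cmod (\<phi> m z * cof p (E z) / det (E z))) = ln (cmod (\<phi> m z)) + ln (cmod (cof p (E z))) - ln (cmod (det (E z)))"
      using nz det_nz[OF z] by (simp add: norm_mult norm_divide ln_div ln_mult \<phi>_def)
    also have "\<dots> \<le> (LINT t|?M. poisson_kernel z t * ln (cmod (cof p (Eb t))))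
        - (LINT t|?M. poisson_kernel z t * u t) - (LINT t|?M. poisson_kernel z t * v m t)"
      using S(3) unfolding ln\<phi> ln_det[OF z] Re_herglotz[OF u z] by simp
    also have "\<dots> = (LINT t|?M. poisson_kernel z t * ln (cmod (cof p (Eb t))) - poisson_kernel z t * u t - poisson_kernel z t * v m t)"
      by (simp only: Bochner_Integration.integral_diff Bochner_Integration.integrable_diff intP S(2) u vint)
    also have "\<dots> \<le> (LINT t|?M. poisson_kernel z t * ln (real m + 1))"
    proof (rule integral_mono_AE)
      show "integrable ?M (\<lambda>t. poisson_kernel z t * ln (cmod (cof p (Eb t))) - poisson_kernel z t * u t - poisson_kernel z t * v m t)"
        by (intro Bochner_Integration.integrable_diff intP S(2) u vint)
      show "integrable ?M (\<lambda>t. poisson_kernel z t * ln (real m + 1))" by (intro intP) simp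
      show "AE t in ?M. poisson_kernel z t * ln (cmod (cof p (Eb t))) - poisson_kernel z t * u t - poisson_kernel z t * v m t
          \<le> poisson_kernel z t * ln (real m + 1)"
        using AE_space S(1) detb
      proof eventually_elim
        fix t assume "t \<in> space ?M" and c: "cof p (Eb t) \<noteq> 0" and d: "cmod (det (Eb t)) = exp (u t)"
        then have t: "cmod t = 1" by simp
        have xp: "0 < x p t" using c d by (simp add: x_def)
        have "ln (x p t / (real m + 1)) \<le> ln_plus (x p t / (real m + 1))"
          using xp by (intro ln_le_ln_plus) auto
        also have "\<dots> \<le> v m t"
          unfolding v_def by (rule member_le_sum) auto
        finally have "ln (x p t) - ln (real m + 1) \<le> v m t" using xp by (simp add: ln_div)
        moreover have "ln (x p t) = ln (cmod (cof p (Eb t))) - u t"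
          using c by (simp add: x_def d ln_div)
        ultimately have "poisson_kernel z t * (ln (cmod (cof p (Eb t))) - u t - v m t) \<le> poisson_kernel z t * ln (real m + 1)"
          using poisson_kernel_bounds(3)[OF t z] by (intro mult_left_mono) auto
        then show "poisson_kernel z t * ln (cmod (cof p (Eb t))) - poisson_kernel z t * u t - poisson_kernel z t * v m t
          \<le> poisson_kernel z t * ln (real m + 1)"
          by (simp add: right_diff_distrib)
      qed
    qed
    also have "\<dots> = ln (real m + 1)" by (simp add: poisson_kernel_integral[OF z])
    finally have "cmod (\<phi> m z * cof p (E z) / det (E z)) \<le> real m + 1"
      using nz det_nz[OF z] by (subst (asm) ln_le_cancel_iff) (auto simp: \<phi>_def)
    then show ?thesis by (simp add: F_def p_def)
  qed (simp add: F_def)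
  have Fh: "mat_holomorphic_on (F m) unit_disc" for m
    unfolding mat_holomorphic_on_def F_def
    using cofs smirnov_class_det(1)[OF Es] det_nz
    by (auto simp: scalar_smirnov_def intro!: holomorphic_intros \<phi>h)
  have Fb: "F m \<in> bounded_holomorphic" for m
  proof -
    have "op_norm (F m z) \<le> (\<Sum>i\<in>(UNIV :: 'n set). \<Sum>j\<in>(UNIV :: 'n set). real m + 1)" if "z \<in> unit_disc" for z
      using that by (intro order_trans[OF op_norm_le_sum] sum_mono Fbd) auto
    then show ?thesis using Fh unfolding bounded_holomorphic_def by blast
  qed
  have bv: "AE t in ?M. boundary_value (F m) t = (\<chi> k j. \<phi>b m t * cof (k, j) (Eb t) / det (Eb t))" for m
  proof -
    have "AE t in ?M. \<forall>p\<in>UNIV. ((\<lambda>r. cof p (E (of_real r * t))) \<longlongrightarrow> cof p (Eb t)) (at_left 1)"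
      using cofb by (intro AE_finite_allI) (auto simp: has_boundary_function_def)
    then show ?thesis
      using \<phi>b[of m, unfolded has_boundary_function_def, THEN conjunct2]
        bdet[unfolded has_boundary_function_def, THEN conjunct2] detb
    proof eventually_elim
      fix t assume c: "\<forall>p\<in>UNIV. ((\<lambda>r. cof p (E (of_real r * t))) \<longlongrightarrow> cof p (Eb t)) (at_left 1)"
        and p: "((\<lambda>r. \<phi> m (of_real r * t)) \<longlongrightarrow> \<phi>b m t) (at_left 1)"
        and d: "((\<lambda>r. det (E (of_real r * t))) \<longlongrightarrow> det (Eb t)) (at_left 1)"
        and "cmod (det (Eb t)) = exp (u t)"
      then have nz: "det (Eb t) \<noteq> 0" by auto
      have "((\<lambda>r. F m (of_real r * t)) \<longlongrightarrow> (\<chi> k j. \<phi>b m t * cof (k, j) (Eb t) / det (Eb t))) (at_left 1)"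
        unfolding F_def using c nz by (intro vec_tendstoI) (auto intro!: tendsto_intros p d)
      then show "boundary_value (F m) t = (\<chi> k j. \<phi>b m t * cof (k, j) (Eb t) / det (Eb t))"
        unfolding boundary_value_def by (intro tendsto_Lim) auto
    qed
  qed
  \<comment> \<open>On the circle the product is a scalar multiple of the identity, so both the
    limit and the bound by 1 become statements about the scalar \<open>\<phi>b\<close>.\<close>
  have prod: "AE t in ?M. boundary_value (F m) t ** Eb t = (\<chi> i j. \<phi>b m t * (mat 1 :: complex ^ 'n ^ 'n) $ i $ j)" for m
    using bv[of m] detb
  proof eventually_elim
    fix t assume b: "boundary_value (F m) t = (\<chi> k j. \<phi>b m t * cof (k, j) (Eb t) / det (Eb t))"
      and "cmod (det (Eb t)) = exp (u t)"
    then have nz: "det (Eb t) \<noteq> 0" by auto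
    have "boundary_value (F m) t ** Eb t
        = (\<chi> i j. \<phi>b m t * ((\<chi> k j. det (replace_column (Eb t) k j) / det (Eb t)) ** Eb t) $ i $ j)"
      unfolding b by (simp add: vec_eq_iff matrix_matrix_mult_def cof_def sum_distrib_left mult.assoc)
    then show "boundary_value (F m) t ** Eb t = (\<chi> i j. \<phi>b m t * (mat 1 :: complex ^ 'n ^ 'n) $ i $ j)"
      unfolding adjugate_left_inverse[OF nz] .
  qed
  have Fbm: "boundary_value (F m) \<in> borel_measurable ?M" for m
    by (rule boundary_value_measurable[OF mat_holomorphic_continuous[OF Fh]])
  show ?thesis
  proof (rule that[of "\<lambda>k. F (s k)"])
    show "F (s k) \<in> bounded_holomorphic" for k by (rule Fb)
    have "AE t in ?M. \<forall>k. boundary_value (F (s k)) t ** Eb t = (\<chi> i j. \<phi>b (s k) t * (mat 1 :: complex ^ 'n ^ 'n) $ i $ j)"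
      unfolding AE_all_countable using prod by blast
    then show "AE t in ?M. (\<lambda>k. boundary_value (F (s k)) t ** boundary_value E t) \<longlonglongrightarrow> mat 1"
      using slim
    proof eventually_elim
      fix t assume eq: "\<forall>k. boundary_value (F (s k)) t ** Eb t = (\<chi> i j. \<phi>b (s k) t * (mat 1 :: complex ^ 'n ^ 'n) $ i $ j)"
        and l: "(\<lambda>k. \<phi>b (s k) t) \<longlonglongrightarrow> 1"
      have "(\<lambda>k. (\<chi> i j. \<phi>b (s k) t * (mat 1 :: complex ^ 'n ^ 'n) $ i $ j)) \<longlonglongrightarrow> (\<chi> i j. 1 * (mat 1 :: complex ^ 'n ^ 'n) $ i $ j)"
        by (intro tendsto_vec_lambda tendsto_mult l tendsto_const)
      moreover have "(\<chi> i j. 1 * (mat 1 :: complex ^ 'n ^ 'n) $ i $ j) = mat 1" by (simp add: vec_eq_iff)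
      ultimately show "(\<lambda>k. boundary_value (F (s k)) t ** boundary_value E t) \<longlonglongrightarrow> mat 1"
        using eq by (simp add: Eb_def)
    qed
    show "AE t in ?M. op_norm (boundary_value (F (s k)) t ** boundary_value E t) \<le> 1" for k
      using prod[of "s k"] \<phi>b1[of "s k"]
    proof eventually_elim
      fix t assume eq: "boundary_value (F (s k)) t ** Eb t = (\<chi> i j. \<phi>b (s k) t * (mat 1 :: complex ^ 'n ^ 'n) $ i $ j)"
        and "cmod (\<phi>b (s k) t) \<le> 1"
      then show "op_norm (boundary_value (F (s k)) t ** boundary_value E t) \<le> 1"
        using op_norm_scalar_matrix_le[of "\<phi>b (s k) t", where ?'n = 'n] unfolding Eb_def[symmetric] eq by linarith
    qed
    \<comment> \<open>As |\<phi>b| \<le> 1, all these matrices are dominated entrywise by the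
      inverse of \<open>Eb t\<close>; one integrable majorant serves for every k.\<close>
    show "uniformly_integrable ?M UNIV (\<lambda>k t. ln_plus (op_norm (boundary_value (F (s k)) t)))"
    proof (rule uniformly_integrable_bound[where h = id and c = "ln_plus (real (card (UNIV :: ('n \<times> 'n) set)))" and k = 1,
          OF fm uniformly_integrable_const[OF fm Sint]])
      show "(\<lambda>t. ln_plus (op_norm (boundary_value (F (s k)) t))) \<in> borel_measurable ?M" for k
        using Fbm by measurable
      show "AE t in ?M. \<bar>ln_plus (op_norm (boundary_value (F (s k)) t))\<bar>
          \<le> ln_plus (real (card (UNIV :: ('n \<times> 'n) set))) + 1 * \<bar>\<Sum>p\<in>UNIV. ln_plus (x p t)\<bar>" for k
        using bv[of "s k"] \<phi>b1[of "s k"]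
      proof eventually_elim
        fix t assume b: "boundary_value (F (s k)) t = (\<chi> k' j. \<phi>b (s k) t * cof (k', j) (Eb t) / det (Eb t))"
          and p1: "cmod (\<phi>b (s k) t) \<le> 1"
        have "op_norm (boundary_value (F (s k)) t) \<le> (\<Sum>i\<in>UNIV. \<Sum>j\<in>UNIV. cmod (\<phi>b (s k) t) * x (i, j) t)"
          by (rule order_trans[OF op_norm_le_sum]) (simp add: b x_def norm_mult norm_divide)
        also have "\<dots> \<le> (\<Sum>i\<in>UNIV. \<Sum>j\<in>UNIV. x (i, j) t)"
          using p1 x0 by (intro sum_mono mult_left_le_one_le) auto
        also have "\<dots> = (\<Sum>p\<in>UNIV. x p t)"
          by (simp add: sum.cartesian_product case_prod_eta)
        finally have "ln_plus (op_norm (boundary_value (F (s k)) t)) \<le> ln_plus (\<Sum>p\<in>UNIV. x p t)"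
          by (rule ln_plus_mono)
        also have "\<dots> \<le> ln_plus (real (card (UNIV :: ('n \<times> 'n) set))) + (\<Sum>p\<in>UNIV. ln_plus (x p t))"
          using x0 by (intro ln_plus_sum_le) auto
        finally show "\<bar>ln_plus (op_norm (boundary_value (F (s k)) t))\<bar>
          \<le> ln_plus (real (card (UNIV :: ('n \<times> 'n) set))) + 1 * \<bar>\<Sum>p\<in>UNIV. ln_plus (x p t)\<bar>" by simp
      qed
    qed auto
  qed
qed

section \<open>The converse by determinants, and the two implications combined\<close>

lemma outer_class_if_approximately_invertible:
  fixes E :: "complex \<Rightarrow> complex ^ 'n ^ 'n" and F :: "nat \<Rightarrow> complex \<Rightarrow> complex ^ 'n ^ 'n"
  assumes E: "E \<in> smirnov_class" and F: "\<And>k. F k \<in> bounded_holomorphic"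
    and lim: "AE t in circle_measure. (\<lambda>k. boundary_value (F k) t ** boundary_value E t) \<longlonglongrightarrow> mat 1"
    and ui: "uniformly_integrable circle_measure UNIV (\<lambda>k t. ln_plus (op_norm (boundary_value (F k) t)))"
  shows "E \<in> outer_class"
proof -
  let ?M = circle_measure
  have Eh: "mat_holomorphic_on E (ball 0 1)" using E by (simp add: smirnov_class_def)
  have Fh: "mat_holomorphic_on (F k) (ball 0 1)" for k using F[of k] by (simp add: bounded_holomorphic_def)
  have "\<exists>B. \<forall>z\<in>unit_disc. op_norm (F k z) \<le> B" for k
    using F[of k] by (simp add: bounded_holomorphic_def)
  then obtain B where B: "\<And>k z. cmod z < 1 \<Longrightarrow> op_norm (F k z) \<le> B k" by (metis mem_ball_0)
  have bE: "has_boundary_function (\<lambda>z. det (E z)) (\<lambda>t. det (boundary_value E t))"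
    by (rule has_boundary_function_compose[OF mat_holomorphic_continuous[OF Eh]
          boundary_value_tendsto[OF smirnov_class_entry[OF E]] continuous_on_det])
  have bF: "has_boundary_function (\<lambda>z. det (F k z)) (\<lambda>t. det (boundary_value (F k) t))" for k
    by (rule has_boundary_function_compose[OF mat_holomorphic_continuous[OF Fh]
          boundary_value_tendsto[OF bounded_holomorphic_entry[OF F]] continuous_on_det])
  have "outer (\<lambda>z. det (E z))"
  proof (rule outer_if_approximately_invertible[OF smirnov_class_det(1)[OF E] bE _ _ bF])
    show "(\<lambda>z. det (F k z)) holomorphic_on ball 0 1" for k
      using Fh[of k] by (intro holomorphic_on_det) (simp add: mat_holomorphic_on_def)
    show "cmod (det (F k z)) \<le> fact CARD('n) * B k ^ CARD('n)" if "cmod z < 1" for k z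
      by (intro cmod_det_le order_trans[OF cmod_entry_le_op_norm] B that)
    show "AE t in ?M. (\<lambda>k. det (boundary_value (F k) t) * det (boundary_value E t)) \<longlonglongrightarrow> 1"
      using lim
    proof eventually_elim
      fix t assume "(\<lambda>k. boundary_value (F k) t ** boundary_value E t) \<longlonglongrightarrow> mat 1"
      then have "(\<lambda>k. det (boundary_value (F k) t ** boundary_value E t)) \<longlonglongrightarrow> det (mat 1 :: complex ^ 'n ^ 'n)"
        by (intro tendsto_det tendsto_vec_nth)
      then show "(\<lambda>k. det (boundary_value (F k) t) * det (boundary_value E t)) \<longlonglongrightarrow> 1"
        by (simp add: det_mul)
    qed
    \<comment> \<open>A determinant grows at most like a power of the operator norm, so its
      \<open>ln_plus\<close> is dominated by a constant plus a multiple of the given family.\<close>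
    show "uniformly_integrable ?M UNIV (\<lambda>k t. ln_plus (cmod (det (boundary_value (F k) t))))"
    proof (rule uniformly_integrable_bound[where h = id, OF circle.finite_measure_axioms ui])
      show "(\<lambda>t. ln_plus (cmod (det (boundary_value (F k) t)))) \<in> borel_measurable ?M" for k
      proof -
        have [measurable]: "(\<lambda>t. det (boundary_value (F k) t)) \<in> borel_measurable ?M"
          using bF[of k] by (simp add: has_boundary_function_def)
        show ?thesis by measurable
      qed
      show "AE t in ?M. \<bar>ln_plus (cmod (det (boundary_value (F k) t)))\<bar>
          \<le> ln (fact CARD('n)) + real CARD('n) * \<bar>ln_plus (op_norm (boundary_value (F (id k)) t))\<bar>" for k
        using ln_plus_det_le by (intro AE_I2) simp
    qed auto
  qed
  with E show ?thesis by (simp add: outer_class_def)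
qed

theorem theorem3p3:
  fixes E :: "complex \<Rightarrow> complex ^ 'n ^ 'n"
  shows
    "(E \<in> outer_class \<longrightarrow>
       (\<exists>F :: nat \<Rightarrow> complex \<Rightarrow> complex ^ 'n ^ 'n.
          (\<forall>k. F k \<in> bounded_holomorphic) \<and>
          (AE t in circle_measure.
             (\<lambda>k. boundary_value (F k) t ** boundary_value E t) \<longlonglongrightarrow> mat 1) \<and>
          uniformly_integrable circle_measure UNIV
             (\<lambda>k t. ln_plus (op_norm (boundary_value (F k) t))) \<and>
          (\<exists>B\<^sub>0 \<in> null_sets circle_measure. \<forall>k. \<forall>t \<in> unit_circle - B\<^sub>0.
             op_norm (boundary_value (F k) t ** boundary_value E t) \<le> 1))) \<and>
     (E \<in> smirnov_class \<longrightarrow>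
       (\<exists>F :: nat \<Rightarrow> complex \<Rightarrow> complex ^ 'n ^ 'n.
          (\<forall>k. F k \<in> bounded_holomorphic) \<and>
          (AE t in circle_measure.
             (\<lambda>k. boundary_value (F k) t ** boundary_value E t) \<longlonglongrightarrow> mat 1) \<and>
          uniformly_integrable circle_measure UNIV
             (\<lambda>k t. ln_plus (op_norm (boundary_value (F k) t)))) \<longrightarrow>
       E \<in> outer_class)"
proof (intro conjI impI)
  assume "E \<in> outer_class"
  then obtain F :: "nat \<Rightarrow> complex \<Rightarrow> complex ^ 'n ^ 'n" where F:
    "\<And>k. F k \<in> bounded_holomorphic"
    "AE t in circle_measure. (\<lambda>k. boundary_value (F k) t ** boundary_value E t) \<longlonglongrightarrow> mat 1"
    "uniformly_integrable circle_measure UNIV (\<lambda>k t. ln_plus (op_norm (boundary_value (F k) t)))"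
    "\<And>k. AE t in circle_measure. op_norm (boundary_value (F k) t ** boundary_value E t) \<le> 1"
    using outer_class_approximate_inverse by blast
  \<comment> \<open>Countability of the index set lets one null set \<open>B\<^sub>0\<close> serve
    for all k.\<close>
  have "AE t in circle_measure. \<forall>k. op_norm (boundary_value (F k) t ** boundary_value E t) \<le> 1"
    unfolding AE_all_countable using F(4) by blast
  then obtain B\<^sub>0 where B\<^sub>0:
    "{t \<in> space circle_measure. \<not> (\<forall>k. op_norm (boundary_value (F k) t ** boundary_value E t) \<le> 1)} \<subseteq> B\<^sub>0"
    "emeasure circle_measure B\<^sub>0 = 0" "B\<^sub>0 \<in> sets circle_measure"
    by (rule AE_E)
  have "\<forall>k. \<forall>t \<in> unit_circle - B\<^sub>0. op_norm (boundary_value (F k) t ** boundary_value E t) \<le> 1"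
    using B\<^sub>0(1) by auto
  moreover have "B\<^sub>0 \<in> null_sets circle_measure" using B\<^sub>0(2,3) by (rule null_setsI)
  ultimately show "\<exists>F :: nat \<Rightarrow> complex \<Rightarrow> complex ^ 'n ^ 'n.
          (\<forall>k. F k \<in> bounded_holomorphic) \<and>
          (AE t in circle_measure.
             (\<lambda>k. boundary_value (F k) t ** boundary_value E t) \<longlonglongrightarrow> mat 1) \<and>
          uniformly_integrable circle_measure UNIV
             (\<lambda>k t. ln_plus (op_norm (boundary_value (F k) t))) \<and>
          (\<exists>B\<^sub>0 \<in> null_sets circle_measure. \<forall>k. \<forall>t \<in> unit_circle - B\<^sub>0.
             op_norm (boundary_value (F k) t ** boundary_value E t) \<le> 1)"
    using F(1,2,3) by blast
next
  assume "E \<in> smirnov_class"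
    and "\<exists>F :: nat \<Rightarrow> complex \<Rightarrow> complex ^ 'n ^ 'n.
          (\<forall>k. F k \<in> bounded_holomorphic) \<and>
          (AE t in circle_measure.
             (\<lambda>k. boundary_value (F k) t ** boundary_value E t) \<longlonglongrightarrow> mat 1) \<and>
          uniformly_integrable circle_measure UNIV
             (\<lambda>k t. ln_plus (op_norm (boundary_value (F k) t)))"
  then show "E \<in> outer_class" using outer_class_if_approximately_invertible by blast
qed

end
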